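(* Let $0<R<1$, and let $Y\in C^2(B_1;\mathbb{R}^3)\cap C^1(\overline{B_1};\mathbb{R}^3)$ be a conformal immersion satisfying $$-\Delta Y=Y_x\wedge Y_y\quad\text{in }B_1,\qquad \nu_Y(1,\theta)=g_R^\sigma(\theta+\phi)\quad\text{for all }\theta,$$ for some $\sigma\in\{+1,-1\}$ and some $\phi\in\mathbb{R}$. Then there exists $a\in\mathbb{R}^3$ such that $$Y=a+Z^\sigma\circ\mathcal R_\phi .$$
   Context: $B_1$ is the open unit disk in $\mathbb{R}^2$ with Cartesian coordinates $(x,y)$ and polar coordinates $(r,\theta)$; $\wedge$ and $\times$ both denote the cross product in $\mathbb{R}^3$; $e_3=(0,0,1)$. A conformal immersion is an immersion with $|Y_x|=|Y_y|\neq 0$ and $Y_x\cdot Y_y=0$. Its induced unit normal (with sign fixed by the ordered coordinates $(x,y)$) is $$\nu_Y=\frac{Y_x\times Y_y}{|Y_x\times Y_y|},$$ and $\nu_Y(1,\theta)$ is its value at the boundary point with polar coordinates $(1,\theta)$ (the boundary condition includes that $Y_x\times Y_y\ne0$ there, so that the formula makes sense). For $\sigma\in\{+1,-1\}$, $$g_R^\sigma(\theta)=\bigl(R\cos\theta,\,R\sin\theta,\,\sigma\sqrt{1-R^2}\bigr).$$ The rotation is $\mathcal R_\phi(r,\theta)=(r,\theta+\phi)$. With $\rho=\dfrac{R}{1+\sqrt{1-R^2}}$, set $$u^+(r,\theta)=\left(\frac{2\rho r}{1+\rho^2r^2}\cos\theta,\ \frac{2\rho r}{1+\rho^2r^2}\sin\theta,\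 \frac{1-\rho^2r^2}{1+\rho^2r^2}\right),$$ $$u^-(r,\theta)=\left(\frac{2\rho r}{\rho^2+r^2}\cos\theta,\ \frac{2\rho r}{\rho^2+r^2}\sin\theta,\ \frac{r^2-\rho^2}{\rho^2+r^2}\right),$$ and $$Z^+(r,\theta)=2u^+(r,\theta)-2\sqrt{1-R^2}\,e_3,\qquad Z^-(r,\theta)=-2u^-(r,\theta+\pi)+2\sqrt{1-R^2}\,e_3 .$$ $Z^\sigma$ means $Z^+$ if $\sigma=+1$ and $Z^-$ if $\sigma=-1$. *)

theory Defs
  imports "HOL-Analysis.Analysis"
begin

section \<open>Partial derivatives and regularity classes in the plane\<close>

text \<open>
  The derivative is taken within the set \<open>S\<close>, so that it also makes sense at boundary points of
  the closed disk; there it is unique (the closed disk is convex with nonempty interior) and it is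
  the continuous extension of the interior derivative whenever such an extension exists.
  At interior points of \<open>S\<close> it is the ordinary derivative.
\<close>

definition pd :: "(real^2) set \<Rightarrow> 2 \<Rightarrow> (real^2 \<Rightarrow> real^3) \<Rightarrow> real^2 \<Rightarrow> real^3" where
  "pd S i f p = frechet_derivative f (at p within S) (axis i 1)"

text \<open>
  For \<open>S = cball 0 1\<close>, \<open>C1_on S f\<close> is equivalent to: \<open>f\<close> is \<open>C\<^sup>1\<close> in the open disk, and \<open>f\<close> and its
  first partial derivatives extend continuously to the closed disk, \<open>f\<close> on the circle being the
  extension.
\<close>

definition C1_on :: "(real^2) set \<Rightarrow> (real^2 \<Rightarrow> real^3) \<Rightarrow> bool" where
  "C1_on S f \<longleftrightarrow> f differentiable_on S \<and> (\<forall>i. continuous_on S (pd S i f))"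

definition C2_on :: "(real^2) set \<Rightarrow> (real^2 \<Rightarrow> real^3) \<Rightarrow> bool" where
  "C2_on S f \<longleftrightarrow> C1_on S f \<and> (\<forall>i. C1_on S (pd S i f))"

definition laplacian :: "(real^2) set \<Rightarrow> (real^2 \<Rightarrow> real^3) \<Rightarrow> real^2 \<Rightarrow> real^3" where
  "laplacian S f p = pd S 1 (pd S 1 f) p + pd S 2 (pd S 2 f) p"

section \<open>Conformal immersions and their normals\<close>

definition conformal_immersion_on :: "(real^2) set \<Rightarrow> (real^2 \<Rightarrow> real^3) \<Rightarrow> bool" where
  "conformal_immersion_on S Y \<longleftrightarrow>
     (\<forall>p\<in>S. norm (pd S 1 Y p) = norm (pd S 2 Y p) \<and> norm (pd S 2 Y p) \<noteq> 0 \<and>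
            pd S 1 Y p \<bullet> pd S 2 Y p = 0)"

definition normal_field :: "(real^2) set \<Rightarrow> (real^2 \<Rightarrow> real^3) \<Rightarrow> real^2 \<Rightarrow> real^3" where
  "normal_field S Y p = cross3 (pd S 1 Y p) (pd S 2 Y p)"

definition unit_normal :: "(real^2) set \<Rightarrow> (real^2 \<Rightarrow> real^3) \<Rightarrow> real^2 \<Rightarrow> real^3" where
  "unit_normal S Y p = normal_field S Y p /\<^sub>R norm (normal_field S Y p)"

section \<open>Polar coordinates and the explicit maps\<close>

definition polar :: "real \<times> real \<Rightarrow> real^2" where
  "polar = (\<lambda>(r, \<theta>). vector [r * cos \<theta>, r * sin \<theta>])"

definition rotation :: "real \<Rightarrow> real \<times> real \<Rightarrow> real \<times> real" where
  "rotation \<phi> = (\<lambda>(r, \<theta>). (r, \<theta> + \<phi>))"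

definition e3 :: "real^3" where
  "e3 = vector [0, 0, 1]"

definition g :: "real \<Rightarrow> real \<Rightarrow> real \<Rightarrow> real^3" where
  "g R \<sigma> \<theta> = vector [R * cos \<theta>, R * sin \<theta>, \<sigma> * sqrt (1 - R\<^sup>2)]"

definition rho :: "real \<Rightarrow> real" where
  "rho R = R / (1 + sqrt (1 - R\<^sup>2))"

text \<open>The maps below are functions of the polar coordinates \<open>(r, \<theta>)\<close>.\<close>

definition u_plus :: "real \<Rightarrow> real \<times> real \<Rightarrow> real^3" where
  "u_plus R = (\<lambda>(r, \<theta>). let \<rho> = rho R in
     vector [2 * \<rho> * r / (1 + \<rho>\<^sup>2 * r\<^sup>2) * cos \<theta>,
             2 * \<rho> * r / (1 + \<rho>\<^sup>2 * r\<^sup>2) * sin \<theta>,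
             (1 - \<rho>\<^sup>2 * r\<^sup>2) / (1 + \<rho>\<^sup>2 * r\<^sup>2)])"

definition u_minus :: "real \<Rightarrow> real \<times> real \<Rightarrow> real^3" where
  "u_minus R = (\<lambda>(r, \<theta>). let \<rho> = rho R in
     vector [2 * \<rho> * r / (\<rho>\<^sup>2 + r\<^sup>2) * cos \<theta>,
             2 * \<rho> * r / (\<rho>\<^sup>2 + r\<^sup>2) * sin \<theta>,
             (r\<^sup>2 - \<rho>\<^sup>2) / (\<rho>\<^sup>2 + r\<^sup>2)])"

definition Z_plus :: "real \<Rightarrow> real \<times> real \<Rightarrow> real^3" where
  "Z_plus R = (\<lambda>(r, \<theta>). 2 *\<^sub>R u_plus R (r, \<theta>) - (2 * sqrt (1 - R\<^sup>2)) *\<^sub>R e3)"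

definition Z_minus :: "real \<Rightarrow> real \<times> real \<Rightarrow> real^3" where
  "Z_minus R = (\<lambda>(r, \<theta>). - (2 *\<^sub>R u_minus R (r, \<theta> + pi)) + (2 * sqrt (1 - R\<^sup>2)) *\<^sub>R e3)"

text \<open>Only used for \<open>\<sigma> \<in> {1, -1}\<close>.\<close>

definition Z :: "real \<Rightarrow> real \<Rightarrow> real \<times> real \<Rightarrow> real^3" where
  "Z R \<sigma> = (if \<sigma> = 1 then Z_plus R else Z_minus R)"

end

theory Submission
  imports Defs "HOL-Complex_Analysis.Complex_Analysis"
begin

text \<open>
  The surface has constant mean curvature \<open>-1/2\<close>, so its Hopf differential \<open>q dz\<^sup>2\<close> is holomorphic, and \<open>q = 0\<close>
  forces \<open>Y - 2 \<nu>\<close> to be constant and \<open>\<nu>\<close> to be conformal. The point is thus that \<open>q = 0\<close>, and it is read off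
  the boundary values of \<open>z\<^sup>2 q = - \<bar>z\<bar>\<^sup>2 \<bar>Y\<^sub>x\<bar>\<^sup>2 + 2 i \<nu>\<^sub>\<theta> \<bullet> (r Y\<^sub>r - i Y\<^sub>\<theta>)\<close>.

  As \<open>Y\<close> is only \<open>C\<^sup>1\<close> up to the boundary, \<open>\<nu>\<^sub>\<theta>\<close> need not have boundary values. Near the circle, however, the
  stereographic projection \<open>\<psi>\<close> of \<open>\<nu>\<close> satisfies \<open>\<bar>\<Delta>\<psi>\<bar> \<le> C \<bar>\<nabla>\<psi>\<bar>\<close>, because \<open>\<partial>\<psi>/\<partial>z\<close> is
  controlled by \<open>Y\<^sub>x\<close>, and \<open>\<psi> = c z\<close> on the circle. An ordinary differential inequality for
  \<open>r \<mapsto> \<integral> \<bar>\<psi> - c z\<bar>\<^sup>2 d\<theta>\<close> bounds \<open>\<integral> \<bar>\<nu>\<^sub>\<theta>\<bar>\<^sup>2 d\<theta>\<close> along a sequence of radii tending to 1, so that \<open>\<nu>\<^sub>\<theta>\<close>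
  converges weakly and the Cauchy formula for \<open>z\<^sup>2 q\<close> passes to the limit.

  Let \<open>y\<close> be the boundary curve. The mean value of \<open>Re (z\<^sup>2 q)\<close>, which is zero, and the vertical component of the flux
  formula \<open>\<integral> (Y\<^sub>r + (1/2) y \<times> y') d\<theta> = 0\<close> combine to \<open>\<integral> \<bar>y'\<bar>\<^sup>2 = \<integral> (y\<^sub>1 y\<^sub>2' - y\<^sub>2 y\<^sub>1')\<close>. This is equality in the
  isoperimetric inequality, so \<open>y\<close> is a horizontal circle; then the boundary values of \<open>z\<^sup>2 q\<close> vanish, and so does \<open>q\<close>.
  Finally \<open>\<psi>\<close> is holomorphic and equal to \<open>c z\<close> on the circle, hence everywhere.
\<close>

subsection \<open>Partial derivatives on the complex plane\<close>

text \<open>The boundary condition enters through one identity: on the circle \<open>g_theta\<close>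
  is the cross product of \<open>e3\<close> with \<open>nu\<close>. Hence \<open>g_theta\<close>
  paired with the tangent is minus the third component of the conormal, which is the derivative term
  of the vertical flux; this is why the two integral identities combine to an isoperimetric equality
  with no term left over. Projecting from the south pole works for both signs, since 1 + h > 0 for h
  = \<sigma> sqrt (1 - R^2); the factor R / (1 + h) is \<rho> or 1 / \<rho> according to the sign,
  so one argument treats both caps. A priori \<open>nu\<close> may reach the south pole inside the
  disk. The projection is therefore used only near the circle until q = 0 is known, and the formula
  for \<open>nu\<close> is then carried inward by continuation. Holomorphy of \<open>q\<close> has a
  second use: it makes the second fundamental form C^1, so \<open>nu\<close> is C^2 although
  \<open>X\<close> is only C^2, and the Laplacian of the projected map exists.\<close>

definition has_partials :: "(complex \<Rightarrow> 'a::real_normed_vector) \<Rightarrow> 'a \<Rightarrow> 'a \<Rightarrow> complex \<Rightarrow> bool" where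
  "has_partials f a b z \<longleftrightarrow> (f has_derivative (\<lambda>h. Re h *\<^sub>R a + Im h *\<^sub>R b)) (at z)"

lemma has_partials_unique:
  assumes "has_partials f a b z" "has_partials f a' b' z"
  shows "a = a'" "b = b'"
proof -
  have *: "(\<lambda>h. Re h *\<^sub>R a + Im h *\<^sub>R b) = (\<lambda>h. Re h *\<^sub>R a' + Im h *\<^sub>R b')"
    using assms unfolding has_partials_def by (rule has_derivative_unique)
  show "a = a'" using fun_cong[OF *, of 1] by simp
  show "b = b'" using fun_cong[OF *, of \<i>] by simp
qed

lemma has_partials_continuous: "has_partials f a b z \<Longrightarrow> isCont f z"
  unfolding has_partials_def by (rule has_derivative_continuous)

lemma has_partials_continuous_on:
  "(\<And>z. z \<in> S \<Longrightarrow> has_partials f (a z) (b z) z) \<Longrightarrow> continuous_on S f"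
  by (meson continuous_at_imp_continuous_on has_partials_continuous)

lemma has_partials_const [simp]: "has_partials (\<lambda>z. c) 0 0 z"
  unfolding has_partials_def by simp

lemma has_partials_Re: "has_partials Re 1 0 z"
  unfolding has_partials_def by (auto intro!: derivative_eq_intros)

lemma has_partials_Im: "has_partials Im 0 1 z"
  unfolding has_partials_def by (auto intro!: derivative_eq_intros)

lemma has_partials_ident: "has_partials (\<lambda>z. z) 1 \<i> z"
  unfolding has_partials_def
  by (rule has_derivative_eq_rhs[OF has_derivative_ident]) (auto simp: complex_eq_iff)

lemma has_partials_eq_rhs:
  "has_partials f a b z \<Longrightarrow> a = a' \<Longrightarrow> b = b' \<Longrightarrow> has_partials f a' b' z"
  by simp

lemma has_partials_add:
  assumes "has_partials f a b z" "has_partials k c d z"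
  shows "has_partials (\<lambda>z. f z + k z) (a + c) (b + d) z"
  using has_derivative_add[OF assms[unfolded has_partials_def]]
  unfolding has_partials_def by (simp add: algebra_simps)

lemma has_partials_linear:
  assumes "bounded_linear T" "has_partials f a b z"
  shows "has_partials (\<lambda>z. T (f z)) (T a) (T b) z"
proof -
  interpret bounded_linear T by fact
  show ?thesis using has_derivative[OF assms(2)[unfolded has_partials_def]]
    unfolding has_partials_def by (simp add: add scaleR)
qed

lemma has_partials_minus:
  "has_partials f a b z \<Longrightarrow> has_partials (\<lambda>z. - f z) (- a) (- b) z"
  by (rule has_partials_linear[OF bounded_linear_minus[OF bounded_linear_ident]])

lemma has_partials_diff:
  assumes "has_partials f a b z" "has_partials k c d z"
  shows "has_partials (\<lambda>z. f z - k z) (a - c) (b - d) z"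
  using has_partials_add[OF assms(1) has_partials_minus[OF assms(2)]] by simp

lemma has_partials_bilinear:
  assumes "bounded_bilinear T" "has_partials f a b z" "has_partials k c d z"
  shows "has_partials (\<lambda>z. T (f z) (k z)) (T a (k z) + T (f z) c) (T b (k z) + T (f z) d) z"
proof -
  interpret bounded_bilinear T by fact
  show ?thesis using FDERIV[OF assms(2,3)[unfolded has_partials_def]]
    unfolding has_partials_def
    by (rule has_derivative_eq_rhs) (auto simp: add_left add_right scaleR_left scaleR_right algebra_simps)
qed

lemmas has_partials_mult = has_partials_bilinear[OF bounded_bilinear_mult]
lemmas has_partials_scaleR = has_partials_bilinear[OF bounded_bilinear_scaleR]
lemmas has_partials_inner = has_partials_bilinear[OF bounded_bilinear_inner]

lemma bounded_bilinear_cross3: "bounded_bilinear cross3"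
  using bilinear_conv_bounded_bilinear bilinear_cross by blast

lemmas has_partials_cross = has_partials_bilinear[OF bounded_bilinear_cross3]

lemma has_partials_inverse:
  fixes f :: "complex \<Rightarrow> 'a::real_normed_div_algebra"
  assumes "has_partials f a b z" "f z \<noteq> 0"
  shows "has_partials (\<lambda>z. inverse (f z)) (- (inverse (f z) * a * inverse (f z)))
     (- (inverse (f z) * b * inverse (f z))) z"
  using Deriv.has_derivative_inverse[OF assms(2) assms(1)[unfolded has_partials_def]]
  unfolding has_partials_def
  by (rule has_derivative_eq_rhs) (auto simp: algebra_simps)

lemma has_partials_cong:
  assumes "has_partials f a b z" "open S" "z \<in> S" "\<And>w. w \<in> S \<Longrightarrow> f w = k w"
  shows "has_partials k a b z"
  using assms(1) unfolding has_partials_def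
  by (rule has_derivative_transform_within_open[OF _ assms(2,3)]) (use assms(4) in auto)

lemma has_partials_along:
  assumes "has_partials f a b (p t)" "(p has_vector_derivative p') (at t within S)"
  shows "((\<lambda>t. f (p t)) has_vector_derivative (Re p' *\<^sub>R a + Im p' *\<^sub>R b)) (at t within S)"
proof -
  have "((f \<circ> p) has_derivative ((\<lambda>h. Re h *\<^sub>R a + Im h *\<^sub>R b) \<circ> (\<lambda>x. x *\<^sub>R p'))) (at t within S)"
    using assms unfolding has_partials_def has_vector_derivative_def
    by (intro diff_chain_within) (auto intro: has_derivative_at_withinI)
  thus ?thesis unfolding has_vector_derivative_def by (simp add: o_def algebra_simps)
qed

lemma has_partials_holomorphic:
  assumes "(f has_field_derivative d) (at z)"
  shows "has_partials f d (\<i> * d) z"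
  using assms unfolding has_partials_def has_field_derivative_def
  by (rule has_derivative_eq_rhs) (auto simp: complex_eq_iff algebra_simps)

lemma has_partials_imp_field_derivative:
  fixes f :: "complex \<Rightarrow> complex"
  assumes "has_partials f d (\<i> * d) z"
  shows "(f has_field_derivative d) (at z)"
  using assms unfolding has_partials_def has_field_derivative_def
  by (rule has_derivative_eq_rhs) (auto simp: complex_eq_iff algebra_simps)

text \<open>Young's version of the symmetry of second derivatives: \<open>fx\<close> and
  \<open>fy\<close> are only differentiable at \<open>z\<close> itself. The second difference of
  \<open>f\<close> over a square of side h is h^2 \<open>q\<close> + o(h^2) when computed through
  \<open>fx\<close>, and h^2 \<open>p'\<close> + o(h^2) when computed through
  \<open>fy\<close>.\<close>

lemma mixed_partials_eq:
  assumes r: "r > 0" and f: "\<And>w. w \<in> ball z r \<Longrightarrow> has_partials f (fx w) (fy w) w"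
    and fx: "has_partials fx p q z" and fy: "has_partials fy p' q' z"
  shows "q = p'"
proof -
  have key: "\<exists>d>0. \<forall>h. 0 < h \<longrightarrow> h < d \<longrightarrow>
      norm (f (z + h *\<^sub>R u + h *\<^sub>R v) - f (z + h *\<^sub>R u) - f (z + h *\<^sub>R v) + f z - (h * h) *\<^sub>R b) \<le> e * (h * h)"
    if e: "e > 0" and uv: "norm u = 1" "norm v = 1"
      and df: "\<And>w. w \<in> ball z r \<Longrightarrow> \<exists>D. (f has_derivative D) (at w) \<and> D u = k w"
      and dk: "(k has_derivative K) (at z)" and b: "K v = b"
    for e u v k K b
  proof -
    from dk e obtain d where d: "d > 0" "\<And>y. norm (y - z) < d \<Longrightarrow> norm (k y - k z - K (y - z)) \<le> e / 4 * norm (y - z)"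
      unfolding has_derivative_at_alt by (metis divide_pos_pos zero_less_numeral)
    interpret K: bounded_linear K using dk by (rule has_derivative_bounded_linear)
    have "norm (f (z + h *\<^sub>R u + h *\<^sub>R v) - f (z + h *\<^sub>R u) - f (z + h *\<^sub>R v) + f z - (h * h) *\<^sub>R b) \<le> e * (h * h)"
      if h: "0 < h" "h < min d r / 2" for h
    proof -
      \<comment> \<open>The mean value inequality in direction \<open>u\<close> is applied to the
        second difference minus its expected value; the linear part of \<open>k\<close> at
        \<open>z\<close> cancels in \<open>\<phi>'\<close> and leaves two small remainders.\<close>
      define \<phi> where "\<phi> t = f (z + t *\<^sub>R u + h *\<^sub>R v) - f (z + t *\<^sub>R u) - (t * h) *\<^sub>R b" for t
      define \<phi>' where "\<phi>' t = k (z + t *\<^sub>R u + h *\<^sub>R v) - k (z + t *\<^sub>R u) - h *\<^sub>R b" for t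
      have n1: "norm (t *\<^sub>R u + h *\<^sub>R v) \<le> 2 * h" "norm (t *\<^sub>R u) \<le> h" if "t \<in> {0..h}" for t
        using norm_triangle_ineq[of "t *\<^sub>R u" "h *\<^sub>R v"] that uv h by auto
      have in1: "z + t *\<^sub>R u + h *\<^sub>R v \<in> ball z r" "z + t *\<^sub>R u \<in> ball z r" if "t \<in> {0..h}" for t
        using n1[OF that] h by (auto simp: dist_norm norm_minus_commute add.assoc add.commute[of "h *\<^sub>R v"] simp del: norm_scaleR)
      have D: "((\<lambda>t. f (z + t *\<^sub>R u + w)) has_vector_derivative k (z + t *\<^sub>R u + w)) (at t within {0..h})"
        if "z + t *\<^sub>R u + w \<in> ball z r" for t w
      proof -
        from df[OF that] obtain D where D: "(f has_derivative D) (at (z + t *\<^sub>R u + w))" "D u = k (z + t *\<^sub>R u + w)"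
          by auto
        interpret D: bounded_linear D using D(1) by (rule has_derivative_bounded_linear)
        have "((\<lambda>t. z + t *\<^sub>R u + w) has_derivative (\<lambda>x. x *\<^sub>R u)) (at t within {0..h})"
          by (auto intro!: derivative_eq_intros)
        from diff_chain_within[OF this has_derivative_at_withinI[OF D(1)]]
        have "((f \<circ> (\<lambda>t. z + t *\<^sub>R u + w)) has_derivative (D \<circ> (\<lambda>x. x *\<^sub>R u))) (at t within {0..h})" .
        thus ?thesis unfolding has_vector_derivative_def o_def by (simp add: D.scaleR D(2))
      qed
      have D0: "((\<lambda>t. f (z + t *\<^sub>R u)) has_vector_derivative k (z + t *\<^sub>R u)) (at t within {0..h})"
        if "t \<in> {0..h}" for t
        using D[of t 0] in1(2)[OF that] by simp
      have der: "(\<phi> has_vector_derivative \<phi>' t) (at t within {0..h})" if "t \<in> {0..h}" for t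
        unfolding \<phi>_def \<phi>'_def
        by (intro has_vector_derivative_diff D0 D in1 that)
          (auto intro!: derivative_eq_intros simp: has_vector_derivative_def algebra_simps)
      have bd: "norm (\<phi>' t) \<le> e * h" if t: "t \<in> {0..h}" for t
      proof -
        let ?a = "t *\<^sub>R u + h *\<^sub>R v" and ?c = "t *\<^sub>R u"
        have "norm (k (z + ?a) - k z - K ?a) \<le> e / 4 * norm ?a"
          using d(2)[of "z + ?a"] n1[OF t] h by (simp del: norm_scaleR)
        also have "\<dots> \<le> e / 4 * (2 * h)" using n1[OF t] e by (intro mult_left_mono) auto
        finally have 1: "norm (k (z + ?a) - k z - K ?a) \<le> e / 4 * (2 * h)" .
        have "norm (k (z + ?c) - k z - K ?c) \<le> e / 4 * norm ?c"
          using d(2)[of "z + ?c"] n1[OF t] h by (simp del: norm_scaleR)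
        also have "\<dots> \<le> e / 4 * (2 * h)" using n1[OF t] e h by (intro mult_left_mono) auto
        finally have 2: "norm (k (z + ?c) - k z - K ?c) \<le> e / 4 * (2 * h)" .
        have "\<phi>' t = (k (z + ?a) - k z - K ?a) - (k (z + ?c) - k z - K ?c)"
          unfolding \<phi>'_def by (simp add: K.add K.scaleR b add.assoc)
        also have "norm \<dots> \<le> norm (k (z + ?a) - k z - K ?a) + norm (k (z + ?c) - k z - K ?c)"
          by (rule norm_triangle_ineq4)
        finally show ?thesis using 1 2 by simp
      qed
      have "norm (\<phi> h - \<phi> 0) \<le> e * h * norm (h - 0)"
        by (rule differentiable_bound[OF convex_real_interval(5) der[unfolded has_vector_derivative_def]])
          (use bd h in \<open>auto intro!: onorm_le simp: mult.commute mult_left_mono abs_mult\<close>)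
      thus ?thesis using h unfolding \<phi>_def by (simp add: algebra_simps)
    qed
    thus ?thesis using d r by (intro exI[of _ "min d r / 2"]) auto
  qed
  have "norm (q - p') \<le> e" if "e > 0" for e
  proof -
    obtain d1 where d1: "d1 > 0" "\<And>h. 0 < h \<Longrightarrow> h < d1 \<Longrightarrow>
      norm (f (z + h *\<^sub>R 1 + h *\<^sub>R \<i>) - f (z + h *\<^sub>R 1) - f (z + h *\<^sub>R \<i>) + f z - (h * h) *\<^sub>R q) \<le> e/2 * (h * h)"
    proof -
      have "\<exists>D. (f has_derivative D) (at w) \<and> D 1 = fx w" if "w \<in> ball z r" for w
        using f[OF that] unfolding has_partials_def by (intro exI[of _ "\<lambda>h. Re h *\<^sub>R fx w + Im h *\<^sub>R fy w"]) simp
      from key[of "e/2" 1 \<i> fx, OF _ _ _ this fx[unfolded has_partials_def]] \<open>e > 0\<close> that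
      show ?thesis by (auto simp del: scaleR_one)
    qed
    obtain d2 where d2: "d2 > 0" "\<And>h. 0 < h \<Longrightarrow> h < d2 \<Longrightarrow>
      norm (f (z + h *\<^sub>R \<i> + h *\<^sub>R 1) - f (z + h *\<^sub>R \<i>) - f (z + h *\<^sub>R 1) + f z - (h * h) *\<^sub>R p') \<le> e/2 * (h * h)"
    proof -
      have "\<exists>D. (f has_derivative D) (at w) \<and> D \<i> = fy w" if "w \<in> ball z r" for w
        using f[OF that] unfolding has_partials_def by (intro exI[of _ "\<lambda>h. Re h *\<^sub>R fx w + Im h *\<^sub>R fy w"]) simp
      from key[of "e/2" \<i> 1 fy, OF _ _ _ this fy[unfolded has_partials_def]] \<open>e > 0\<close> that
      show ?thesis by (auto simp del: scaleR_one)
    qed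
    define h where "h = min d1 d2 / 2"
    have h: "0 < h" "h < d1" "h < d2" using d1 d2 by (auto simp: h_def)
    let ?D = "f (z + h *\<^sub>R 1 + h *\<^sub>R \<i>) - f (z + h *\<^sub>R 1) - f (z + h *\<^sub>R \<i>) + f z"
    have e2: "f (z + h *\<^sub>R \<i> + h *\<^sub>R 1) - f (z + h *\<^sub>R \<i>) - f (z + h *\<^sub>R 1) + f z = ?D"
      by (simp add: algebra_simps)
    have "norm ((h * h) *\<^sub>R (q - p')) = norm ((?D - (h*h) *\<^sub>R p') - (?D - (h*h) *\<^sub>R q))"
      by (simp add: algebra_simps)
    also have "\<dots> \<le> e/2 * (h * h) + e/2 * (h * h)"
      using d1(2)[OF h(1,2)] d2(2)[OF h(1,3), unfolded e2] norm_triangle_ineq4 by (smt (verit, best))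
    finally have "(h * h) * norm (q - p') \<le> (h * h) * e" unfolding norm_scaleR by (simp add: field_simps)
    thus ?thesis using h by simp
  qed
  from field_le_epsilon[of "norm (q - p')" 0] this show ?thesis by force
qed

section \<open>Differentiation under the integral and primitives of closed forms\<close>

lemma has_partials_integral:
  fixes F :: "complex \<Rightarrow> real \<Rightarrow> 'a::banach"
  assumes F: "\<And>z t. z \<in> U \<Longrightarrow> t \<in> {c..d} \<Longrightarrow> has_partials (\<lambda>z. F z t) (A z t) (B z t) z"
    and cF: "\<And>z. z \<in> U \<Longrightarrow> continuous_on {c..d} (F z)"
    and cA: "continuous_on (U \<times> {c..d}) (\<lambda>(z, t). A z t)"
    and cB: "continuous_on (U \<times> {c..d}) (\<lambda>(z, t). B z t)"
    and U: "open U" "convex U" "z \<in> U"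
  shows "has_partials (\<lambda>z. integral {c..d} (F z)) (integral {c..d} (A z)) (integral {c..d} (B z)) z"
proof -
  define G where "G a b = Blinfun (\<lambda>h::complex. Re h *\<^sub>R a + Im h *\<^sub>R b)" for a b :: 'a
  have G: "blinfun_apply (G a b) = (\<lambda>h. Re h *\<^sub>R a + Im h *\<^sub>R b)" for a b
    unfolding G_def
    by (rule bounded_linear_Blinfun_apply)
      (auto intro!: bounded_linear_intros bounded_linear_Re bounded_linear_Im)
  have contG: "continuous_on (U \<times> {c..d}) (\<lambda>(z, t). G (A z t) (B z t))"
    unfolding split_beta
  proof (rule continuous_on_blinfun_componentwise)
    fix i :: complex
    show "continuous_on (U \<times> {c..d}) (\<lambda>p. blinfun_apply (G (A (fst p) (snd p)) (B (fst p) (snd p))) i)"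
      unfolding G by (intro continuous_intros cA[unfolded split_beta] cB[unfolded split_beta])
  qed
  have leib: "((\<lambda>z. integral (cbox c d) (F z)) has_derivative integral (cbox c d) (\<lambda>t. G (A z t) (B z t))) (at z within U)"
  proof (rule leibniz_rule)
    fix w t assume "w \<in> U" "t \<in> cbox c d"
    hence "has_partials (\<lambda>z. F z t) (A w t) (B w t) w" using F by simp
    thus "((\<lambda>z. F z t) has_derivative blinfun_apply (G (A w t) (B w t))) (at w within U)"
      unfolding G has_partials_def by (rule has_derivative_at_withinI)
  next
    fix w assume "w \<in> U"
    from integrable_continuous_real[OF cF[OF this]] show "F w integrable_on cbox c d" by simp
  qed (use contG U in simp_all)
  have eq: "blinfun_apply (integral (cbox c d) (\<lambda>t. G (A z t) (B z t)))
      = (\<lambda>h. Re h *\<^sub>R integral {c..d} (A z) + Im h *\<^sub>R integral {c..d} (B z))"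
  proof
    fix h
    have P: "continuous_on {c..d} (Pair z)" "Pair z ` {c..d} \<subseteq> U \<times> {c..d}"
      using U by (auto intro!: continuous_intros)
    have c: "continuous_on {c..d} (\<lambda>t. G (A z t) (B z t))" "continuous_on {c..d} (A z)" "continuous_on {c..d} (B z)"
      using continuous_on_compose2[OF contG P] continuous_on_compose2[OF cA P]
        continuous_on_compose2[OF cB P] by auto
    have i: "(A z) integrable_on {c..d}" "(B z) integrable_on {c..d}"
      using c by (auto intro: integrable_continuous_real)
    show "blinfun_apply (integral (cbox c d) (\<lambda>t. G (A z t) (B z t))) h
      = Re h *\<^sub>R integral {c..d} (A z) + Im h *\<^sub>R integral {c..d} (B z)"
    proof -
      have "blinfun_apply (integral (cbox c d) (\<lambda>t. G (A z t) (B z t))) h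
         = integral (cbox c d) (\<lambda>t. G (A z t) (B z t) h)"
        using integrable_continuous_real[OF c(1)] by (subst blinfun_apply_integral) auto
      also have "\<dots> = integral {c..d} (\<lambda>t. Re h *\<^sub>R A z t) + integral {c..d} (\<lambda>t. Im h *\<^sub>R B z t)"
        unfolding G using integral_add[OF integrable_cmul[OF i(1)] integrable_cmul[OF i(2)]] by simp
      finally show ?thesis by simp
    qed
  qed
  show ?thesis unfolding has_partials_def
    using leib unfolding at_within_open[OF \<open>z \<in> U\<close> \<open>open U\<close>] eq by simp
qed

text \<open>The radial primitive of the form \<open>a dx + b dy\<close>, with the defect caused by \<open>b\<^sub>x - a\<^sub>y\<close>.\<close>

lemma primitive_of_form:
  fixes a b ax ay bx by' :: "complex \<Rightarrow> 'a::euclidean_space"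
  assumes a: "\<And>z. z \<in> ball 0 s \<Longrightarrow> has_partials a (ax z) (ay z) z"
    and b: "\<And>z. z \<in> ball 0 s \<Longrightarrow> has_partials b (bx z) (by' z) z"
    and c: "continuous_on (ball 0 s) ax" "continuous_on (ball 0 s) ay"
      "continuous_on (ball 0 s) bx" "continuous_on (ball 0 s) by'"
    and z: "z \<in> ball 0 s"
  shows "has_partials (\<lambda>z. integral {0..1} (\<lambda>t. Re z *\<^sub>R a (t *\<^sub>R z) + Im z *\<^sub>R b (t *\<^sub>R z)))
     (a z + integral {0..1} (\<lambda>t. (t * Im z) *\<^sub>R (bx (t *\<^sub>R z) - ay (t *\<^sub>R z))))
     (b z - integral {0..1} (\<lambda>t. (t * Re z) *\<^sub>R (bx (t *\<^sub>R z) - ay (t *\<^sub>R z)))) z"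
proof -
  have in_ball: "t *\<^sub>R w \<in> ball 0 s" if "w \<in> ball 0 s" "t \<in> {0..1}" for t :: real and w :: complex
    using that mult_left_le_one_le[of "cmod w" t] by auto
  have scaled: "has_partials (\<lambda>z. k (t *\<^sub>R z)) (t *\<^sub>R kx (t *\<^sub>R w)) (t *\<^sub>R ky (t *\<^sub>R w)) w"
    if "\<And>z. z \<in> ball 0 s \<Longrightarrow> has_partials k (kx z) (ky z) z" "w \<in> ball 0 s" "t \<in> {0..1}" for k kx ky :: "complex \<Rightarrow> 'a" and t w
  proof -
    have "((k \<circ> (\<lambda>z. t *\<^sub>R z)) has_derivative ((\<lambda>h. Re h *\<^sub>R kx (t *\<^sub>R w) + Im h *\<^sub>R ky (t *\<^sub>R w)) \<circ> (\<lambda>h. t *\<^sub>R h))) (at w)"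
      by (intro diff_chain_at that(1)[OF in_ball[OF that(2,3)], unfolded has_partials_def]
          bounded_linear_imp_has_derivative bounded_linear_scaleR_right)
    thus ?thesis unfolding has_partials_def o_def
      by (rule has_derivative_eq_rhs) (auto simp: algebra_simps)
  qed
  have ca: "continuous_on (ball 0 s) a" "continuous_on (ball 0 s) b"
    by (rule has_partials_continuous_on[OF a] has_partials_continuous_on[OF b], assumption)+
  have cs: "continuous_on (ball 0 s \<times> {0..1}) (\<lambda>(w, t). k (t *\<^sub>R w))"
    if "continuous_on (ball 0 s) k" for k :: "complex \<Rightarrow> 'a"
    unfolding split_beta
    by (rule continuous_on_compose2[OF that]) (use in_ball in \<open>auto intro!: continuous_intros\<close>)
  have c1: "continuous_on {0..1} (\<lambda>t. k (t *\<^sub>R w))" if "continuous_on (ball 0 s) k" "w \<in> ball 0 s" for k :: "complex \<Rightarrow> 'a" and w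
    by (rule continuous_on_compose2[OF that(1)]) (use in_ball that in \<open>auto intro!: continuous_intros\<close>)
  note c1' = c1[OF ca(1) z] c1[OF ca(2) z] c1[OF c(1) z] c1[OF c(2) z] c1[OF c(3) z] c1[OF c(4) z]
  define A where "A w t = a (t *\<^sub>R w) + Re w *\<^sub>R t *\<^sub>R ax (t *\<^sub>R w) + Im w *\<^sub>R t *\<^sub>R bx (t *\<^sub>R w)" for w t
  define B where "B w t = b (t *\<^sub>R w) + Re w *\<^sub>R t *\<^sub>R ay (t *\<^sub>R w) + Im w *\<^sub>R t *\<^sub>R by' (t *\<^sub>R w)" for w t
  have main: "has_partials (\<lambda>z. integral {0..1} (\<lambda>t. Re z *\<^sub>R a (t *\<^sub>R z) + Im z *\<^sub>R b (t *\<^sub>R z)))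
     (integral {0..1} (A z)) (integral {0..1} (B z)) z"
  proof (rule has_partials_integral[where U = "ball 0 s"])
    fix w :: complex and t assume w: "w \<in> ball 0 s" "t \<in> {0..1::real}"
    show "has_partials (\<lambda>z. Re z *\<^sub>R a (t *\<^sub>R z) + Im z *\<^sub>R b (t *\<^sub>R z)) (A w t) (B w t) w"
      by (rule has_partials_eq_rhs[OF has_partials_add[OF has_partials_scaleR[OF has_partials_Re scaled[OF a w]]
            has_partials_scaleR[OF has_partials_Im scaled[OF b w]]]])
        (auto simp: A_def B_def)
  next
    fix w :: complex assume "w \<in> ball 0 s"
    thus "continuous_on {0..1} (\<lambda>t. Re w *\<^sub>R a (t *\<^sub>R w) + Im w *\<^sub>R b (t *\<^sub>R w))"
      by (intro continuous_intros c1 ca)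
  next
    show "continuous_on (ball 0 s \<times> {0..1}) (\<lambda>(z, t). A z t)"
      unfolding A_def split_beta
      by (intro continuous_intros cs[OF ca(1), unfolded split_beta] cs[OF c(1), unfolded split_beta] cs[OF c(3), unfolded split_beta])
    show "continuous_on (ball 0 s \<times> {0..1}) (\<lambda>(z, t). B z t)"
      unfolding B_def split_beta
      by (intro continuous_intros cs[OF ca(2), unfolded split_beta] cs[OF c(2), unfolded split_beta] cs[OF c(4), unfolded split_beta])
  qed (use z in auto)
  \<comment> \<open>The integrand is the derivative of t k(t z). Compared with it,
    \<open>A z t\<close> contains \<open>bx\<close> in place of \<open>ay\<close>, and
    \<open>B z t\<close> contains \<open>ay\<close> in place of \<open>bx\<close>; the difference is
    the curl term.\<close>
  have ftc: "((\<lambda>t. k (t *\<^sub>R z) + t *\<^sub>R (Re z *\<^sub>R kx (t *\<^sub>R z) + Im z *\<^sub>R ky (t *\<^sub>R z))) has_integral k z) {0..1}"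
    if k: "\<And>z. z \<in> ball 0 s \<Longrightarrow> has_partials k (kx z) (ky z) z" for k kx ky :: "complex \<Rightarrow> 'a"
  proof -
    have "((\<lambda>t. t *\<^sub>R k (t *\<^sub>R z)) has_vector_derivative
        (k (t *\<^sub>R z) + t *\<^sub>R (Re z *\<^sub>R kx (t *\<^sub>R z) + Im z *\<^sub>R ky (t *\<^sub>R z)))) (at t within {0..1})" if "t \<in> {0..1}" for t
    proof -
      have "((\<lambda>t. k (t *\<^sub>R z)) has_vector_derivative (Re z *\<^sub>R kx (t *\<^sub>R z) + Im z *\<^sub>R ky (t *\<^sub>R z))) (at t within {0..1})"
        proof (rule has_partials_along[OF k])
        show "t *\<^sub>R z \<in> ball 0 s" using in_ball[OF z that] .
        show "((\<lambda>t. t *\<^sub>R z) has_vector_derivative z) (at t within {0..1})"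
          unfolding has_vector_derivative_def
          by (intro bounded_linear_imp_has_derivative bounded_linear_scaleR_left)
      qed
      from has_vector_derivative_scaleR[OF DERIV_ident this] show ?thesis by (simp add: add.commute)
    qed
    from fundamental_theorem_of_calculus[OF _ this] show ?thesis by simp
  qed
  have "integral {0..1} (A z) - integral {0..1} (\<lambda>t. (t * Im z) *\<^sub>R (bx (t *\<^sub>R z) - ay (t *\<^sub>R z)))
     = integral {0..1} (\<lambda>t. A z t - (t * Im z) *\<^sub>R (bx (t *\<^sub>R z) - ay (t *\<^sub>R z)))"
    unfolding A_def
    by (rule integral_diff[symmetric]) (auto intro!: integrable_continuous_real continuous_intros c1')
  also have "\<dots> = a z"
    using integral_unique[OF ftc[OF a]] by (simp add: A_def algebra_simps)
  finally have 1: "integral {0..1} (A z) = a z + integral {0..1} (\<lambda>t. (t * Im z) *\<^sub>R (bx (t *\<^sub>R z) - ay (t *\<^sub>R z)))"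
    by (simp add: algebra_simps)
  have "integral {0..1} (B z) + integral {0..1} (\<lambda>t. (t * Re z) *\<^sub>R (bx (t *\<^sub>R z) - ay (t *\<^sub>R z)))
     = integral {0..1} (\<lambda>t. B z t + (t * Re z) *\<^sub>R (bx (t *\<^sub>R z) - ay (t *\<^sub>R z)))"
    unfolding B_def
    by (rule integral_add[symmetric]) (auto intro!: integrable_continuous_real continuous_intros c1')
  also have "\<dots> = b z"
    using integral_unique[OF ftc[OF b]] by (simp add: B_def algebra_simps)
  finally have 2: "integral {0..1} (B z) = b z - integral {0..1} (\<lambda>t. (t * Re z) *\<^sub>R (bx (t *\<^sub>R z) - ay (t *\<^sub>R z)))"
    by (simp add: algebra_simps)
  show ?thesis using main unfolding 1 2 .
qed

text \<open>The radial primitive of \<open>Q n\<close> dz has complex derivative \<open>Q n\<close>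
  up to an error bounded by the Cauchy-Riemann defect. The primitives therefore converge together
  with their derivatives, the limit is a complex primitive of \<open>q\<close>, and derivatives of
  holomorphic functions are holomorphic.\<close>

lemma uniform_limit_dbar_field_derivative:
  fixes Q :: "nat \<Rightarrow> complex \<Rightarrow> complex"
  assumes Q: "\<And>n z. z \<in> ball 0 s \<Longrightarrow> has_partials (Q n) (Qx n z) (Qy n z) z"
    and c: "\<And>n. continuous_on (ball 0 s) (Qx n)" "\<And>n. continuous_on (ball 0 s) (Qy n)"
    and lim: "uniform_limit (ball 0 s) Q q sequentially"
    and dbar: "uniform_limit (ball 0 s) (\<lambda>n z. Qx n z + \<i> * Qy n z) (\<lambda>z. 0) sequentially"
    and s: "0 < s" "s \<le> 1"
  shows "q holomorphic_on ball 0 s"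
proof -
  define U where "U n z = integral {0..1} (\<lambda>t. Re z *\<^sub>R Q n (t *\<^sub>R z) + Im z *\<^sub>R (\<i> * Q n (t *\<^sub>R z)))" for n z
  \<comment> \<open>For the form \<open>Q n\<close> dx + \<i> \<open>Q n\<close> dy this is the
    curl, that is \<i> times the Cauchy-Riemann defect.\<close>
  define d where "d n z = \<i> * (Qx n z + \<i> * Qy n z)" for n z
  define I where "I n z = integral {0..1} (\<lambda>t. t *\<^sub>R d n (t *\<^sub>R z))" for n z
  have cQ: "continuous_on (ball 0 s) (Q n)" for n
    using Q by (rule has_partials_continuous_on)
  have cd: "continuous_on (ball 0 s) (d n)" for n
    unfolding d_def by (intro continuous_intros c)
  have inb: "t *\<^sub>R z \<in> ball 0 s" if "z \<in> ball 0 s" "t \<in> {0..1}" for t :: real and z :: complex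
    using that mult_left_le_one_le[of "norm z" t] by auto
  have cdt: "continuous_on {0..1} (\<lambda>t. d n (t *\<^sub>R z))" if "z \<in> ball 0 s" for n z
    by (rule continuous_on_compose2[OF cd]) (use inb that in \<open>auto intro!: continuous_intros\<close>)
  have dU: "has_partials (U n) (Q n z + Im z *\<^sub>R I n z) (\<i> * Q n z - Re z *\<^sub>R I n z) z"
    if z: "z \<in> ball 0 s" for n z
  proof -
    have "has_partials (U n) (Q n z + integral {0..1} (\<lambda>t. (t * Im z) *\<^sub>R (\<i> * Qx n (t *\<^sub>R z) - Qy n (t *\<^sub>R z))))
      (\<i> * Q n z - integral {0..1} (\<lambda>t. (t * Re z) *\<^sub>R (\<i> * Qx n (t *\<^sub>R z) - Qy n (t *\<^sub>R z)))) z"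
      unfolding U_def
      by (rule primitive_of_form[where s = s and ax = "Qx n" and by' = "\<lambda>z. \<i> * Qy n z"])
        (use Q z c in \<open>auto intro!: continuous_intros has_partials_linear[OF bounded_linear_mult_right]\<close>)
    moreover have "integral {0..1} (\<lambda>t. (t * k) *\<^sub>R (\<i> * Qx n (t *\<^sub>R z) - Qy n (t *\<^sub>R z))) = k *\<^sub>R I n z" for k
      unfolding I_def d_def integral_cmul[symmetric] by (simp add: algebra_simps)
    ultimately show ?thesis by simp
  qed
  have I: "norm (I n z) \<le> e" if z: "z \<in> ball 0 s" and e: "\<And>w. w \<in> ball 0 s \<Longrightarrow> norm (d n w) \<le> e" for n z e
  proof -
    have "norm (I n z) \<le> integral {0..1} (\<lambda>t::real. e)"
      unfolding I_def
    proof (rule integral_norm_bound_integral)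
      show "(\<lambda>t. t *\<^sub>R d n (t *\<^sub>R z)) integrable_on {0..1}"
        by (intro integrable_continuous_real continuous_intros cdt z)
      fix t :: real assume t: "t \<in> {0..1}"
      have "0 \<le> e" using e[OF z] norm_ge_zero order_trans by blast
      thus "norm (t *\<^sub>R d n (t *\<^sub>R z)) \<le> e"
        using e[OF inb[OF z t]] t mult_mono[of t 1 "norm (d n (t *\<^sub>R z))" e] by simp
    qed auto
    thus ?thesis by simp
  qed
  have "\<exists>g. \<forall>z\<in>ball 0 s. (\<lambda>n. U n z) \<longlonglongrightarrow> g z \<and> (g has_derivative (\<lambda>h. h * q z)) (at z within ball 0 s)"
  proof (rule has_derivative_sequence[where f' = "\<lambda>n z h. Re h *\<^sub>R (Q n z + Im z *\<^sub>R I n z) + Im h *\<^sub>R (\<i> * Q n z - Re z *\<^sub>R I n z)"])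
    fix n z assume "z \<in> ball (0::complex) s"
    from dU[OF this] show "(U n has_derivative (\<lambda>h. Re h *\<^sub>R (Q n z + Im z *\<^sub>R I n z) + Im h *\<^sub>R (\<i> * Q n z - Re z *\<^sub>R I n z))) (at z within ball 0 s)"
      unfolding has_partials_def by (rule has_derivative_at_withinI)
  next
    fix e :: real assume e: "e > 0"
    have "\<forall>\<^sub>F n in sequentially. \<forall>z\<in>ball 0 s. dist (Q n z) (q z) < e/3"
      using lim e unfolding uniform_limit_iff by (meson divide_pos_pos zero_less_numeral)
    moreover have "\<forall>\<^sub>F n in sequentially. \<forall>z\<in>ball 0 s. dist (Qx n z + \<i> * Qy n z) 0 < e/3"
      using dbar e unfolding uniform_limit_iff by (meson divide_pos_pos zero_less_numeral)
    ultimately show "\<forall>\<^sub>F n in sequentially. \<forall>z\<in>ball 0 s. \<forall>h. norm (Re h *\<^sub>R (Q n z + Im z *\<^sub>R I n z) + Im h *\<^sub>R (\<i> * Q n z - Re z *\<^sub>R I n z) - h * q z) \<le> e * norm h"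
    proof eventually_elim
      case (elim n)
      show ?case
      proof (intro ballI allI)
        fix z h assume z: "z \<in> ball (0::complex) s"
        have "norm (I n z) \<le> e/3"
          by (rule I[OF z]) (use elim in \<open>auto simp: d_def norm_mult intro: less_imp_le\<close>)
        hence "norm ((Re h * Im z - Im h * Re z) *\<^sub>R I n z) \<le> (2 * norm h) * (e/3)"
          unfolding norm_scaleR
        proof (intro mult_mono)
          have "\<bar>Re h * Im z - Im h * Re z\<bar> \<le> \<bar>Re h\<bar> * \<bar>Im z\<bar> + \<bar>Im h\<bar> * \<bar>Re z\<bar>"
            by (metis abs_mult abs_triangle_ineq4)
          also have "\<dots> \<le> norm h * 1 + norm h * 1"
            using z s abs_Re_le_cmod[of z] abs_Im_le_cmod[of z]
            by (intro add_mono mult_mono abs_Re_le_cmod abs_Im_le_cmod) auto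
          finally show "\<bar>Re h * Im z - Im h * Re z\<bar> \<le> 2 * norm h" by simp
        qed auto
        moreover have "norm (h * (Q n z - q z)) \<le> norm h * (e/3)"
          unfolding norm_mult using elim(1) z by (intro mult_left_mono) (auto simp: dist_norm less_imp_le)
        moreover have "Re h *\<^sub>R (Q n z + Im z *\<^sub>R I n z) + Im h *\<^sub>R (\<i> * Q n z - Re z *\<^sub>R I n z) - h * q z
          = h * (Q n z - q z) + (Re h * Im z - Im h * Re z) *\<^sub>R I n z"
          by (auto simp: complex_eq_iff algebra_simps)
        ultimately have "norm (Re h *\<^sub>R (Q n z + Im z *\<^sub>R I n z) + Im h *\<^sub>R (\<i> * Q n z - Re z *\<^sub>R I n z) - h * q z)
            \<le> norm h * (e/3) + 2 * norm h * (e/3)"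
          using norm_triangle_mono by metis
        thus "norm (Re h *\<^sub>R (Q n z + Im z *\<^sub>R I n z) + Im h *\<^sub>R (\<i> * Q n z - Re z *\<^sub>R I n z) - h * q z) \<le> e * norm h"
          by (simp add: field_simps)
      qed
    qed
  next
    show "(0::complex) \<in> ball 0 s" using s by simp
    show "(\<lambda>n. U n 0) \<longlonglongrightarrow> 0" by (simp add: U_def)
  qed simp
  then obtain g where g: "\<And>z. z \<in> ball 0 s \<Longrightarrow> (g has_derivative (\<lambda>h. h * q z)) (at z within ball 0 s)"
    by blast
  have g': "(g has_field_derivative q z) (at z)" if "z \<in> ball 0 s" for z
    using g[OF that] unfolding has_field_derivative_def at_within_open[OF that open_ball]
    by (simp only: mult_commute_abs)
  hence "g holomorphic_on ball 0 s"
    unfolding holomorphic_on_open[OF open_ball] by blast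
  hence "deriv g holomorphic_on ball 0 s" by (intro holomorphic_deriv) auto
  thus ?thesis by (rule holomorphic_transform) (use g' DERIV_imp_deriv in blast)
qed

lemma uniform_limit_difference_quotient:
  fixes f :: "complex \<Rightarrow> 'a::real_normed_vector"
  assumes f: "\<And>z. z \<in> ball 0 1 \<Longrightarrow> has_partials f (fx z) (fy z) z"
    and c: "continuous_on (ball 0 1) fx" and s: "0 < s" "s < 1"
    and t: "t \<longlonglongrightarrow> 0" "\<And>n. t n > 0"
  shows "uniform_limit (ball 0 s) (\<lambda>n z. (1 / t n) *\<^sub>R (f (z + of_real (t n)) - f z)) fx sequentially"
  unfolding uniform_limit_iff
proof (intro allI impI)
  fix e :: real assume e: "e > 0"
  \<comment> \<open>A radius between \<open>s\<close> and 1: for small steps the segment from z to z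
    + t stays in the compact disk \<open>cball 0 S\<close>, where \<open>fx\<close> is uniformly
    continuous.\<close>
  define S where "S = (s + 1) / 2"
  have S: "s < S" "S < 1" using s by (auto simp: S_def)
  have "uniformly_continuous_on (cball 0 S) fx"
    by (rule compact_uniformly_continuous) (use S in \<open>auto intro: continuous_on_subset[OF c]\<close>)
  then obtain d where d: "d > 0" "\<And>x y. x \<in> cball 0 S \<Longrightarrow> y \<in> cball 0 S \<Longrightarrow> dist y x < d \<Longrightarrow> dist (fx y) (fx x) < e/2"
    unfolding uniformly_continuous_on_def using e by (metis half_gt_zero)
  have "\<forall>\<^sub>F n in sequentially. t n < min d (S - s)"
    using t(1) d S by (intro order_tendstoD) auto
  thus "\<forall>\<^sub>F n in sequentially. \<forall>z\<in>ball 0 s. dist ((1 / t n) *\<^sub>R (f (z + of_real (t n)) - f z)) (fx z) < e"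
  proof eventually_elim
    case (elim n)
    show ?case
    proof
      fix z :: complex assume z: "z \<in> ball 0 s"
      let ?t = "t n"
      have inS: "z + of_real u \<in> cball 0 S" if "u \<in> {0..?t}" for u
        using z that elim norm_triangle_ineq[of z "of_real u"] by auto
      have der: "((\<lambda>u. f (z + of_real u)) has_vector_derivative fx (z + of_real u)) (at u within {0..?t})" if "u \<in> {0..?t}" for u
      proof -
        have "((\<lambda>u. f (z + of_real u)) has_vector_derivative (Re 1 *\<^sub>R fx (z + of_real u) + Im 1 *\<^sub>R fy (z + of_real u))) (at u within {0..?t})"
        proof (rule has_partials_along[OF f])
          show "z + of_real u \<in> ball 0 1" using inS[OF that] S by auto
          show "((\<lambda>u. z + complex_of_real u) has_vector_derivative 1) (at u within {0..?t})"
            by (auto intro!: derivative_eq_intros simp: has_vector_derivative_def scaleR_conv_of_real)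
        qed
        thus ?thesis by simp
      qed
      have "norm (f (z + of_real ?t) - f (z + of_real 0) - (?t - 0) *\<^sub>R fx (z + of_real 0)) \<le> norm (?t - 0) * (e/2)"
      proof (rule vector_differentiable_bound_linearization[of "{0..?t}"])
        show "closed_segment 0 ?t \<subseteq> {0..?t}" using t(2)[of n] by (simp add: closed_segment_eq_real_ivl)
        fix u assume u: "u \<in> {0..?t}"
        have "dist (fx (z + of_real u)) (fx (z + of_real 0)) < e/2"
          using u elim t(2)[of n] by (intro d(2) inS) (auto simp: dist_norm)
        thus "norm (fx (z + of_real u) - fx (z + of_real 0)) \<le> e/2" by (simp add: dist_norm)
      qed (use der t(2)[of n] in auto)
      hence *: "norm (f (z + of_real ?t) - f z - ?t *\<^sub>R fx z) \<le> ?t * (e/2)" using t(2)[of n] by simp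
      have "(1 / ?t) *\<^sub>R (f (z + of_real ?t) - f z) - fx z = (1 / ?t) *\<^sub>R (f (z + of_real ?t) - f z - ?t *\<^sub>R fx z)"
        using t(2)[of n] by (simp add: scaleR_diff_right)
      also have "norm \<dots> \<le> (1 / ?t) * (?t * (e/2))"
        using * t(2)[of n] unfolding norm_scaleR by (intro mult_mono) auto
      also have "\<dots> = e/2" using t(2)[of n] by simp
      finally show "dist ((1 / ?t) *\<^sub>R (f (z + of_real ?t) - f z)) (fx z) < e"
        using e by (simp add: dist_norm)
    qed
  qed
qed

subsection \<open>Conformal surfaces of constant mean curvature\<close>

text \<open>As \<open>cross3 a b\<close> has length a \<bullet> a, dividing by a \<bullet> a gives
  the unit normal without a square root, and the formula can be differentiated by the product and
  inverse rules.\<close>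

lemma conformal_frame:
  fixes a b :: "real^3"
  assumes ab: "b \<bullet> b = a \<bullet> a" "a \<bullet> b = 0" "a \<noteq> 0"
  defines "n \<equiv> inverse (a \<bullet> a) *\<^sub>R cross3 a b"
  shows "cross3 a b = (a \<bullet> a) *\<^sub>R n" "n \<bullet> n = 1" "n \<bullet> a = 0" "n \<bullet> b = 0"
    "cross3 n a = b" "cross3 n b = - a" "a \<bullet> n = 0" "b \<bullet> n = 0"
proof -
  have L: "a \<bullet> a \<noteq> 0" using ab by simp
  show 1: "cross3 a b = (a \<bullet> a) *\<^sub>R n" using L by (simp add: n_def)
  have "cross3 a b \<bullet> cross3 a b = (a \<bullet> a) * (a \<bullet> a)"
    by (simp add: dot_cross ab inner_commute[of b a])
  thus "n \<bullet> n = 1" using L by (simp add: n_def field_simps)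
  show "n \<bullet> a = 0" "n \<bullet> b = 0" "a \<bullet> n = 0" "b \<bullet> n = 0"
    by (simp_all add: n_def dot_cross_self)
  have c: "cross3 a (cross3 a b) = - ((a \<bullet> a) *\<^sub>R b)"
    by (simp add: Lagrange ab)
  have d: "cross3 b (cross3 a b) = (a \<bullet> a) *\<^sub>R a"
    by (simp add: Lagrange ab inner_commute[of b a])
  show "cross3 n a = b" "cross3 n b = - a"
    using c d L cross_skew[of n a] cross_skew[of n b] by (simp_all add: n_def cross_mult_right)
qed

text \<open>A single \<open>X12\<close> serves as both mixed derivatives. The assumptions concern
  the open disk only, so that \<open>X1\<close> and \<open>X2\<close> may later carry boundary
  values as well.\<close>

locale cmc_disc =
  fixes X X1 X2 X11 X12 X22 :: "complex \<Rightarrow> real^3"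
  assumes dX: "z \<in> ball 0 1 \<Longrightarrow> has_partials X (X1 z) (X2 z) z"
    and dX1: "z \<in> ball 0 1 \<Longrightarrow> has_partials X1 (X11 z) (X12 z) z"
    and dX2: "z \<in> ball 0 1 \<Longrightarrow> has_partials X2 (X12 z) (X22 z) z"
    and cX: "continuous_on (ball 0 1) X11" "continuous_on (ball 0 1) X12" "continuous_on (ball 0 1) X22"
    and conf: "z \<in> ball 0 1 \<Longrightarrow> X2 z \<bullet> X2 z = X1 z \<bullet> X1 z" "z \<in> ball 0 1 \<Longrightarrow> X1 z \<bullet> X2 z = 0"
      "z \<in> ball 0 1 \<Longrightarrow> X1 z \<noteq> 0"
    and cmc: "z \<in> ball 0 1 \<Longrightarrow> X11 z + X22 z = - cross3 (X1 z) (X2 z)"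
begin

definition L :: "complex \<Rightarrow> real" where "L z = X1 z \<bullet> X1 z"

definition nu :: "complex \<Rightarrow> real^3" where "nu z = inverse (L z) *\<^sub>R cross3 (X1 z) (X2 z)"

text \<open>Here begin the coefficients \<open>e\<close>, \<open>m\<close>, \<open>k\<close> of the
  second fundamental form with respect to \<open>nu\<close>.\<close>

definition e where "e z = X11 z \<bullet> nu z"
definition m where "m z = X12 z \<bullet> nu z"
definition k where "k z = X22 z \<bullet> nu z"

text \<open>The right-hand sides of the Weingarten formulas; \<open>dnu\<close> shows that they are
  the partial derivatives of \<open>nu\<close>.\<close>

definition N1 where "N1 z = - (inverse (L z) *\<^sub>R (e z *\<^sub>R X1 z + m z *\<^sub>R X2 z))"
definition N2 where "N2 z = - (inverse (L z) *\<^sub>R (m z *\<^sub>R X1 z + k z *\<^sub>R X2 z))"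

text \<open>Four times the coefficient of the Hopf differential.\<close>

definition q :: "complex \<Rightarrow> complex" where "q z = Complex (2 * e z + L z) (- 2 * m z)"

lemma L_pos: "z \<in> ball 0 1 \<Longrightarrow> L z > 0"
  using conf(3) by (simp add: L_def)

lemma frame_facts:
  assumes z: "z \<in> ball 0 1"
  shows "cross3 (X1 z) (X2 z) = L z *\<^sub>R nu z" "nu z \<bullet> nu z = 1" "nu z \<bullet> X1 z = 0" "nu z \<bullet> X2 z = 0"
    "cross3 (nu z) (X1 z) = X2 z" "cross3 (nu z) (X2 z) = - X1 z" "X1 z \<bullet> nu z = 0" "X2 z \<bullet> nu z = 0"
  using conformal_frame[OF conf[OF z]] unfolding nu_def L_def by blast+

lemma frame_expansion:
  assumes z: "z \<in> ball 0 1"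
  shows "v = ((v \<bullet> X1 z) / L z) *\<^sub>R X1 z + ((v \<bullet> X2 z) / L z) *\<^sub>R X2 z + (v \<bullet> nu z) *\<^sub>R nu z"
proof -
  define w where "w = v - (((v \<bullet> X1 z) / L z) *\<^sub>R X1 z + ((v \<bullet> X2 z) / L z) *\<^sub>R X2 z + (v \<bullet> nu z) *\<^sub>R nu z)"
  note f = frame_facts[OF z] and L = L_pos[OF z]
  have w: "w \<bullet> X1 z = 0" "w \<bullet> X2 z = 0" "w \<bullet> nu z = 0"
    using L f conf[OF z] by (simp_all add: w_def inner_diff_left inner_add_left inner_commute[of "X2 z" "X1 z"] L_def[symmetric])
  \<comment> \<open>Lagrange's identity: a vector orthogonal to \<open>X1\<close> and
    \<open>X2\<close> is parallel to \<open>nu\<close>, and being orthogonal to \<open>nu\<close> as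
    well it vanishes.\<close>
  have "cross3 w (cross3 (X1 z) (X2 z)) = 0" using w by (simp add: Lagrange)
  hence "cross3 w (nu z) = 0" using L f(1) by (simp add: cross_mult_right)
  hence "cross3 (nu z) (cross3 w (nu z)) = 0" by simp
  hence "w = 0" using w f by (simp add: Lagrange inner_commute)
  thus ?thesis by (simp add: w_def)
qed

text \<open>Both partial derivatives of the two conformality relations.\<close>

lemma conformality_derivatives:
  assumes z: "z \<in> ball 0 1"
  shows "X12 z \<bullet> X2 z = X11 z \<bullet> X1 z" "X22 z \<bullet> X2 z = X12 z \<bullet> X1 z"
    "X11 z \<bullet> X2 z = - (X12 z \<bullet> X1 z)" "X22 z \<bullet> X1 z = - (X11 z \<bullet> X1 z)"
proof -
  have 1: "has_partials (\<lambda>z. X1 z \<bullet> X1 z - X2 z \<bullet> X2 z) 0 0 z"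
    by (rule has_partials_cong[OF has_partials_const[of 0] open_ball z]) (simp add: conf)
  have 2: "has_partials (\<lambda>z. X1 z \<bullet> X2 z) 0 0 z"
    by (rule has_partials_cong[OF has_partials_const[of 0] open_ball z]) (simp add: conf)
  note a = has_partials_diff[OF has_partials_inner[OF dX1[OF z] dX1[OF z]] has_partials_inner[OF dX2[OF z] dX2[OF z]]]
  note b = has_partials_inner[OF dX1[OF z] dX2[OF z]]
  from has_partials_unique[OF a 1] has_partials_unique[OF b 2]
  show 3: "X12 z \<bullet> X2 z = X11 z \<bullet> X1 z" "X22 z \<bullet> X2 z = X12 z \<bullet> X1 z"
    and "X11 z \<bullet> X2 z = - (X12 z \<bullet> X1 z)" "X22 z \<bullet> X1 z = - (X11 z \<bullet> X1 z)"
    by (auto simp: inner_commute)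
qed

text \<open>This is mean curvature -1/2, since the trace is twice the mean curvature times
  \<open>L\<close>. It turns (e - k) - 2 \<i> m into the form chosen for \<open>q\<close>, in which
  only x-derivatives of \<open>X1\<close> and \<open>X2\<close> occur; difference quotients in one
  direction then suffice.\<close>

lemma mean_curvature: "z \<in> ball 0 1 \<Longrightarrow> e z + k z = - L z"
  using cmc[of z] frame_facts[of z] by (simp add: e_def k_def flip: inner_add_left)

text \<open>The Gauss formulas. As \<open>dL\<close> confirms, \<open>a\<close> and \<open>b\<close>
  are the partial derivatives of (log L) / 2, the Christoffel symbols of a conformal metric.\<close>

lemma second_derivatives:
  assumes z: "z \<in> ball 0 1"
  defines "a \<equiv> (X11 z \<bullet> X1 z) / L z" and "b \<equiv> (X12 z \<bullet> X1 z) / L z"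
  shows "X11 z = a *\<^sub>R X1 z - b *\<^sub>R X2 z + e z *\<^sub>R nu z"
    and "X12 z = b *\<^sub>R X1 z + a *\<^sub>R X2 z + m z *\<^sub>R nu z"
    and "X22 z = - a *\<^sub>R X1 z + b *\<^sub>R X2 z + k z *\<^sub>R nu z"
  using frame_expansion[OF z, of "X11 z"] frame_expansion[OF z, of "X12 z"] frame_expansion[OF z, of "X22 z"]
  by (simp_all add: conformality_derivatives[OF z] e_def m_def k_def a_def b_def)

lemma dL: "z \<in> ball 0 1 \<Longrightarrow> has_partials L (2 * (X11 z \<bullet> X1 z)) (2 * (X12 z \<bullet> X1 z)) z"
  unfolding L_def
  by (rule has_partials_eq_rhs[OF has_partials_inner[OF dX1 dX1]]) (auto simp: inner_commute)

text \<open>Differentiability comes from the explicit quotient; the values come from differentiating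
  nu \<bullet> nu = 1 and nu \<bullet> X1 = nu \<bullet> X2 = 0 and expanding in the frame.\<close>

lemma dnu: assumes z: "z \<in> ball 0 1" shows "has_partials nu (N1 z) (N2 z) z"
proof -
  note f = frame_facts[OF z]
  have "\<exists>a b. has_partials nu a b z"
    unfolding nu_def
    by (intro exI) (rule has_partials_scaleR[OF has_partials_inverse[OF dL[OF z] less_imp_neq[OF L_pos[OF z], symmetric]]
        has_partials_cross[OF dX1[OF z] dX2[OF z]]])
  then obtain a b where ab: "has_partials nu a b z" by blast
  have 1: "has_partials (\<lambda>z. nu z \<bullet> nu z) 0 0 z"
    by (rule has_partials_cong[OF has_partials_const[of 1] open_ball z]) (simp add: frame_facts)
  have 2: "has_partials (\<lambda>z. nu z \<bullet> X1 z) 0 0 z"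
    by (rule has_partials_cong[OF has_partials_const[of 0] open_ball z]) (simp add: frame_facts)
  have 3: "has_partials (\<lambda>z. nu z \<bullet> X2 z) 0 0 z"
    by (rule has_partials_cong[OF has_partials_const[of 0] open_ball z]) (simp add: frame_facts)
  from has_partials_unique[OF has_partials_inner[OF ab ab] 1]
    has_partials_unique[OF has_partials_inner[OF ab dX1[OF z]] 2]
    has_partials_unique[OF has_partials_inner[OF ab dX2[OF z]] 3]
  have "a \<bullet> nu z = 0" "b \<bullet> nu z = 0" "a \<bullet> X1 z = - e z" "a \<bullet> X2 z = - m z" "b \<bullet> X1 z = - m z" "b \<bullet> X2 z = - k z"
    by (auto simp: inner_commute e_def m_def k_def)
  hence "a = N1 z" "b = N2 z"
    using frame_expansion[OF z, of a] frame_expansion[OF z, of b]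
    by (simp_all add: N1_def N2_def divide_inverse scaleR_add_right mult.commute)
  with ab show ?thesis by simp
qed

lemma continuous_frame:
  "continuous_on (ball 0 1) X" "continuous_on (ball 0 1) X1" "continuous_on (ball 0 1) X2"
  "continuous_on (ball 0 1) nu" "continuous_on (ball 0 1) L"
  by (rule has_partials_continuous_on[OF dX] has_partials_continuous_on[OF dX1]
      has_partials_continuous_on[OF dX2] has_partials_continuous_on[OF dnu] has_partials_continuous_on[OF dL], assumption)+

lemma continuous_N: "continuous_on (ball 0 1) N1" "continuous_on (ball 0 1) N2"
  unfolding N1_def N2_def e_def m_def k_def
  by (intro continuous_intros continuous_frame cX; use L_pos in force)+

lemma N_inner:
  assumes z: "z \<in> ball 0 1"
  shows "N1 z \<bullet> X1 z = - e z" "N1 z \<bullet> X2 z = - m z" "N2 z \<bullet> X1 z = - m z" "N2 z \<bullet> X2 z = - k z"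
    "N1 z \<bullet> nu z = 0" "N2 z \<bullet> nu z = 0"
  using conf[OF z] L_pos[OF z] frame_facts[OF z]
  by (simp_all add: N1_def N2_def inner_add_left inner_diff_left inner_add_right inner_commute[of "X2 z" "X1 z"]
      L_def[symmetric])

text \<open>Real and imaginary part of the limiting Cauchy-Riemann defect of the approximations of
  \<open>q\<close>. The differenced equation has already removed all third derivatives, and the
  Gauss and Weingarten formulas cancel what is left.\<close>

lemma hopf_dbar:
  assumes z: "z \<in> ball 0 1"
  shows "- 2 * ((cross3 (X11 z) (X2 z) + cross3 (X1 z) (X12 z)) \<bullet> nu z) + 2 * (X11 z \<bullet> N1 z)
       + 2 * (X12 z \<bullet> N2 z) + 2 * (X11 z \<bullet> X1 z) = 0"
    and "2 * (X11 z \<bullet> N2 z) - 2 * (X12 z \<bullet> N1 z) + 2 * (X12 z \<bullet> X1 z) = 0"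
proof -
  note f = frame_facts[OF z] and L = L_pos[OF z]
  define a b where "a = (X11 z \<bullet> X1 z) / L z" and "b = (X12 z \<bullet> X1 z) / L z"
  note sd = second_derivatives[OF z, folded a_def b_def]
  have ab: "X11 z \<bullet> X1 z = L z * a" "X12 z \<bullet> X1 z = L z * b" using L by (auto simp: a_def b_def)
  have "cross3 (X11 z) (X2 z) \<bullet> nu z = X11 z \<bullet> X1 z"
    using cross_triple[of "X11 z" "X2 z" "nu z"] f(6) cross_skew[of "X2 z" "nu z"]
    by (simp add: inner_commute)
  moreover have "cross3 (X1 z) (X12 z) \<bullet> nu z = X12 z \<bullet> X2 z"
    using cross_triple[of "nu z" "X1 z" "X12 z"] f(5) cross_triple[of "X1 z" "X12 z" "nu z"] by (simp add: inner_commute)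
  moreover have "X11 z \<bullet> N1 z = - a * e z + b * m z" "X12 z \<bullet> N2 z = - b * m z - a * k z"
     "X11 z \<bullet> N2 z = - a * m z + b * k z" "X12 z \<bullet> N1 z = - b * e z - a * m z"
    using N_inner[OF z] by (subst sd, simp add: inner_add_left inner_diff_left inner_commute[of "X1 z" "N1 z"]
        inner_commute[of "X2 z" "N1 z"] inner_commute[of "nu z" "N1 z"] inner_commute[of "X1 z" "N2 z"]
        inner_commute[of "X2 z" "N2 z"] inner_commute[of "nu z" "N2 z"])+
  moreover have k: "k z = - L z - e z" using mean_curvature[OF z] by simp
  ultimately show "- 2 * ((cross3 (X11 z) (X2 z) + cross3 (X1 z) (X12 z)) \<bullet> nu z) + 2 * (X11 z \<bullet> N1 z)
       + 2 * (X12 z \<bullet> N2 z) + 2 * (X11 z \<bullet> X1 z) = 0"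
    and "2 * (X11 z \<bullet> N2 z) - 2 * (X12 z \<bullet> N1 z) + 2 * (X12 z \<bullet> X1 z) = 0"
    by (simp_all add: inner_add_left conformality_derivatives[OF z] ab algebra_simps)
qed

text \<open>As \<open>X\<close> is only \<open>C\<^sup>2\<close>, the Codazzi equations cannot be obtained by differentiating the second
  fundamental form. Replacing \<open>X\<^sub>x\<^sub>x\<close> and \<open>X\<^sub>x\<^sub>y\<close> by difference quotients in the \<open>x\<close>-direction gives
  \<open>C\<^sup>1\<close> approximations of \<open>q\<close> whose Cauchy-Riemann defects tend to zero.\<close>

lemma hopf_holomorphic_on_ball:
  assumes s: "0 < s" "s < 1"
  shows "q holomorphic_on ball 0 s"
proof -
  \<comment> \<open>The denominator n + 2 keeps every step below 1 - s, so translates of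
    \<open>ball 0 s\<close> stay in the unit disk.\<close>
  define t where "t n = (1 - s) / real (n + 2)" for n
  have t: "t \<longlonglongrightarrow> 0" unfolding t_def
    by (rule tendsto_divide_0[OF tendsto_const], rule filterlim_at_top_imp_at_infinity,
        rule filterlim_compose[OF filterlim_real_sequentially filterlim_add_const_nat_at_top])
  have t0: "t n > 0" for n using s by (auto simp: t_def intro!: divide_pos_pos add_pos_nonneg)
  have t1: "t n < 1 - s" for n
  proof -
    have "t n \<le> (1 - s) / 2" unfolding t_def using s by (intro frac_le) auto
    thus ?thesis using s by simp
  qed
  have zt: "z + of_real (t n) \<in> ball 0 1" if "z \<in> ball 0 s" for z :: complex and n
    using that t0[of n] t1[of n] norm_triangle_ineq[of z "of_real (t n)"] by auto
  have z1: "z \<in> ball 0 1" if "z \<in> ball 0 s" for z :: complex using that s by auto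
  define D where "D f n z = (1 / t n) *\<^sub>R (f (z + of_real (t n)) - f z)" for f :: "complex \<Rightarrow> real^3" and n z
  have dD: "has_partials (D f n) (D fx n z) (D fy n z) z"
    if "\<And>z. z \<in> ball 0 1 \<Longrightarrow> has_partials f (fx z) (fy z) z" "z \<in> ball 0 s" for f fx fy n z
  proof -
    have "((f \<circ> (\<lambda>z. z + of_real (t n))) has_derivative ((\<lambda>h. Re h *\<^sub>R fx (z + of_real (t n)) + Im h *\<^sub>R fy (z + of_real (t n))) \<circ> (\<lambda>h. h))) (at z)"
      using that(1)[OF zt[OF that(2)]] unfolding has_partials_def
      by (intro diff_chain_at) (auto intro!: derivative_eq_intros)
    hence "has_partials (\<lambda>z. f (z + of_real (t n))) (fx (z + of_real (t n))) (fy (z + of_real (t n))) z"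
      unfolding has_partials_def by (simp add: o_def)
    from has_partials_linear[OF bounded_linear_scaleR_right has_partials_diff[OF this that(1)[OF z1[OF that(2)]]]]
    show ?thesis unfolding D_def .
  qed
  have cD: "continuous_on (ball 0 s) (D f n)" if "continuous_on (ball 0 1) f" for f n
  proof -
    have "continuous_on (ball 0 s) (\<lambda>z. f (z + of_real (t n)))"
      by (rule continuous_on_compose2[OF that]) (use zt in \<open>auto intro!: continuous_intros simp del: mem_ball\<close>)
    thus ?thesis unfolding D_def using z1 by (intro continuous_intros continuous_on_subset[OF that]) auto
  qed
  have lD: "uniform_limit (ball 0 s) (D f) fx sequentially"
    if "\<And>z. z \<in> ball 0 1 \<Longrightarrow> has_partials f (fx z) (fy z) z" "continuous_on (ball 0 1) fx" for f fx fy
    unfolding D_def by (rule uniform_limit_difference_quotient[OF that s t t0])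
  define Q where "Q n z = complex_of_real (2 * (D X1 n z \<bullet> nu z) + L z) - \<i> * of_real (2 * (D X2 n z \<bullet> nu z))" for n z
  define Qx where "Qx n z = complex_of_real (2 * (D X11 n z \<bullet> nu z + D X1 n z \<bullet> N1 z) + 2 * (X11 z \<bullet> X1 z))
      - \<i> * of_real (2 * (D X12 n z \<bullet> nu z + D X2 n z \<bullet> N1 z))" for n z
  define Qy where "Qy n z = complex_of_real (2 * (D X12 n z \<bullet> nu z + D X1 n z \<bullet> N2 z) + 2 * (X12 z \<bullet> X1 z))
      - \<i> * of_real (2 * (D X22 n z \<bullet> nu z + D X2 n z \<bullet> N2 z))" for n z
  define C where "C z = cross3 (X1 z) (X2 z)" for z
  define C1 where "C1 z = cross3 (X11 z) (X2 z) + cross3 (X1 z) (X12 z)" for z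
  define C2 where "C2 z = cross3 (X12 z) (X2 z) + cross3 (X1 z) (X22 z)" for z
  have dC: "has_partials C (C1 z) (C2 z) z" if "z \<in> ball 0 1" for z
    unfolding C_def C1_def C2_def by (rule has_partials_cross[OF dX1 dX2]) (use that in auto)
  have cc: "continuous_on (ball 0 1) (\<lambda>z. cross3 (f z) (g z))"
    if "continuous_on (ball 0 1) f" "continuous_on (ball 0 1) g" for f g :: "complex \<Rightarrow> real^3"
    using bounded_bilinear.continuous_on[OF bounded_bilinear_cross3 that] .
  have cC1: "continuous_on (ball 0 1) C1"
    unfolding C1_def by (intro continuous_intros cc continuous_frame cX)
  note lims = lD[OF dX1 cX(1)] lD[OF dX2 cX(2)] lD[OF dC cC1]
  have bd: "bounded (f ` ball 0 s)" if "continuous_on (ball 0 1) f" for f :: "complex \<Rightarrow> 'b::real_normed_vector"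
  proof -
    have "compact (f ` cball 0 s)"
      by (rule compact_continuous_image) (use s in \<open>auto intro: continuous_on_subset[OF that]\<close>)
    thus ?thesis by (meson ball_subset_cball bounded_subset compact_imp_bounded image_mono)
  qed
  have li: "uniform_limit (ball 0 s) (\<lambda>n z. f n z \<bullet> g z) (\<lambda>z. f' z \<bullet> g z) sequentially"
    if "uniform_limit (ball 0 s) f f' sequentially" "continuous_on (ball 0 1) f'" "continuous_on (ball 0 1) g"
    for f f' and g :: "complex \<Rightarrow> real^3"
    by (rule bounded_bilinear.bounded_uniform_limit[OF bounded_bilinear_inner that(1) uniform_limit_const bd bd])
      (use that in auto)
  have lo: "uniform_limit (ball 0 s) (\<lambda>n z. complex_of_real (f n z)) (\<lambda>z. of_real (f' z)) sequentially"
    if "uniform_limit (ball 0 s) f f' sequentially" for f f'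
    using bounded_linear.uniform_limit[OF bounded_linear_of_real that] .
  have lm: "uniform_limit (ball 0 s) (\<lambda>n z. c * f n z) (\<lambda>z. c * f' z) sequentially"
    if "uniform_limit (ball 0 s) f f' sequentially" for f f' and c :: "'b::real_normed_algebra"
    using bounded_linear.uniform_limit[OF bounded_linear_mult_right that] .
  show ?thesis
  proof (rule uniform_limit_dbar_field_derivative[where Q = Q and Qx = Qx and Qy = Qy])
    fix n z assume z: "z \<in> ball (0::complex) s"
    have inn: "has_partials (\<lambda>z. D f n z \<bullet> nu z) (D fx n z \<bullet> nu z + D f n z \<bullet> N1 z) (D fy n z \<bullet> nu z + D f n z \<bullet> N2 z) z"
      if "\<And>z. z \<in> ball 0 1 \<Longrightarrow> has_partials f (fx z) (fy z) z" for f fx fy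
      by (rule has_partials_inner[OF dD[OF that z] dnu[OF z1[OF z]]])
    show "has_partials (Q n) (Qx n z) (Qy n z) z"
      unfolding Q_def Qx_def Qy_def
      by (intro has_partials_diff has_partials_linear[OF bounded_linear_of_real] has_partials_linear[OF bounded_linear_mult_right]
          has_partials_add inn[OF dX1] inn[OF dX2] dL[OF z1[OF z]])
  next
    fix n
    have cs: "continuous_on (ball 0 s) f" if "continuous_on (ball 0 1) f" for f :: "complex \<Rightarrow> real^3"
      by (rule continuous_on_subset[OF that]) (use z1 in blast)
    show "continuous_on (ball 0 s) (Qx n)" "continuous_on (ball 0 s) (Qy n)"
      unfolding Qx_def Qy_def
      by (intro continuous_on_diff continuous_on_of_real continuous_on_add continuous_on_mult
          continuous_on_inner continuous_on_const cD cs continuous_frame cX continuous_N)+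
  next
    have "uniform_limit (ball 0 s) Q (\<lambda>z. complex_of_real (2 * (X11 z \<bullet> nu z) + L z) - \<i> * of_real (2 * (X12 z \<bullet> nu z))) sequentially"
      unfolding Q_def
      by (intro uniform_limit_minus uniform_limit_add lo lm li uniform_limit_const lims cX continuous_frame)
    moreover have "(\<lambda>z. complex_of_real (2 * (X11 z \<bullet> nu z) + L z) - \<i> * of_real (2 * (X12 z \<bullet> nu z))) = q"
      by (auto simp: q_def e_def m_def complex_eq_iff)
    ultimately show "uniform_limit (ball 0 s) Q q sequentially" by simp
  next
    have "uniform_limit (ball 0 s) (\<lambda>n z. complex_of_real ((-2) * (D C n z \<bullet> nu z) + 2 * (D X1 n z \<bullet> N1 z) + 2 * (D X2 n z \<bullet> N2 z) + 2 * (X11 z \<bullet> X1 z))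
        + \<i> * of_real (2 * (D X1 n z \<bullet> N2 z) - 2 * (D X2 n z \<bullet> N1 z) + 2 * (X12 z \<bullet> X1 z)))
       (\<lambda>z. complex_of_real ((-2) * (C1 z \<bullet> nu z) + 2 * (X11 z \<bullet> N1 z) + 2 * (X12 z \<bullet> N2 z) + 2 * (X11 z \<bullet> X1 z))
        + \<i> * of_real (2 * (X11 z \<bullet> N2 z) - 2 * (X12 z \<bullet> N1 z) + 2 * (X12 z \<bullet> X1 z))) sequentially"
      by (intro uniform_limit_minus uniform_limit_add lo lm li uniform_limit_const lims cX continuous_frame continuous_N cC1)
    hence "uniform_limit (ball 0 s) (\<lambda>n z. complex_of_real ((-2) * (D C n z \<bullet> nu z) + 2 * (D X1 n z \<bullet> N1 z) + 2 * (D X2 n z \<bullet> N2 z) + 2 * (X11 z \<bullet> X1 z))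
        + \<i> * of_real (2 * (D X1 n z \<bullet> N2 z) - 2 * (D X2 n z \<bullet> N1 z) + 2 * (X12 z \<bullet> X1 z))) (\<lambda>z. 0) sequentially"
      by (rule uniform_limit_cong'[THEN iffD1, rotated 2])
        (use hopf_dbar[OF z1] in \<open>auto simp: C1_def simp del: mem_ball\<close>)
    thus "uniform_limit (ball 0 s) (\<lambda>n z. Qx n z + \<i> * Qy n z) (\<lambda>z. 0) sequentially"
    proof (rule uniform_limit_cong'[THEN iffD1, rotated 2])
      fix n z assume z: "z \<in> ball (0::complex) s"
      \<comment> \<open>Differencing the equation trades D X11 + D X22, which would tend to third
        derivatives, for the quotient of the C^1 function \<open>C\<close>.\<close>
      have "D X11 n z + D X22 n z = - D C n z"
        using cmc[OF z1[OF z]] cmc[OF zt[OF z, of n]]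
        by (simp add: D_def C_def algebra_simps flip: scaleR_add_right)
      hence "(D X11 n z + D X22 n z) \<bullet> nu z = - D C n z \<bullet> nu z" by simp
      hence "D X22 n z \<bullet> nu z = - (D C n z \<bullet> nu z) - D X11 n z \<bullet> nu z" by (simp add: inner_add_left)
      thus "complex_of_real ((-2) * (D C n z \<bullet> nu z) + 2 * (D X1 n z \<bullet> N1 z) + 2 * (D X2 n z \<bullet> N2 z) + 2 * (X11 z \<bullet> X1 z))
        + \<i> * of_real (2 * (D X1 n z \<bullet> N2 z) - 2 * (D X2 n z \<bullet> N1 z) + 2 * (X12 z \<bullet> X1 z)) = Qx n z + \<i> * Qy n z"
        by (simp add: Qx_def Qy_def complex_eq_iff algebra_simps)
    qed auto
  qed (use s in auto)
qed

lemma hopf_holomorphic: "q holomorphic_on ball 0 1"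
proof -
  have "q holomorphic_on (\<Union>s\<in>{0<..<1}. ball 0 s)"
    by (rule holomorphic_on_UN_open) (auto intro!: hopf_holomorphic_on_ball)
  moreover have "z \<in> (\<Union>s\<in>{0<..<1}. ball 0 s)" if "z \<in> ball 0 1" for z :: complex
    using that by (auto intro!: bexI[of _ "(1 + norm z) / 2"] simp: add_pos_nonneg)
  ultimately show ?thesis by (metis holomorphic_on_subset subsetI)
qed

text \<open>The conservation law belonging to translations: with \<open>a\<close> and
  \<open>b\<close> as in the proof, b_x - a_y = X11 + X22 + cross3 X1 X2 = 0, so a dx + b dy is
  exact in the disk and its integral over a circle vanishes.\<close>

lemma flux_zero:
  assumes r: "0 \<le> r" "r < 1"
  defines "z \<equiv> \<lambda>\<theta>. of_real r * cis \<theta>"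
  shows "((\<lambda>\<theta>. Re (z \<theta>) *\<^sub>R (X1 (z \<theta>) + (1/2) *\<^sub>R cross3 (X (z \<theta>)) (X2 (z \<theta>)))
       - Im (z \<theta>) *\<^sub>R (- X2 (z \<theta>) + (1/2) *\<^sub>R cross3 (X (z \<theta>)) (X1 (z \<theta>)))) has_integral 0) {0..2*pi}"
proof -
  define a where "a w = - X2 w + (1/2) *\<^sub>R cross3 (X w) (X1 w)" for w
  define b where "b w = X1 w + (1/2) *\<^sub>R cross3 (X w) (X2 w)" for w
  define a1 where "a1 w = - X12 w + (1/2) *\<^sub>R (cross3 (X1 w) (X1 w) + cross3 (X w) (X11 w))" for w
  define a2 where "a2 w = - X22 w + (1/2) *\<^sub>R (cross3 (X2 w) (X1 w) + cross3 (X w) (X12 w))" for w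
  define b1 where "b1 w = X11 w + (1/2) *\<^sub>R (cross3 (X1 w) (X2 w) + cross3 (X w) (X12 w))" for w
  define b2 where "b2 w = X12 w + (1/2) *\<^sub>R (cross3 (X2 w) (X2 w) + cross3 (X w) (X22 w))" for w
  have cc: "continuous_on (ball 0 1) (\<lambda>z. cross3 (f z) (g z))"
    if "continuous_on (ball 0 1) f" "continuous_on (ball 0 1) g" for f g :: "complex \<Rightarrow> real^3"
    using bounded_bilinear.continuous_on[OF bounded_bilinear_cross3 that] .
  have eps: "b1 w - a2 w = 0" if "w \<in> ball 0 1" for w
  proof -
    have "b1 w - a2 w = X11 w + X22 w + (1/2) *\<^sub>R cross3 (X1 w) (X2 w) + (1/2) *\<^sub>R cross3 (X1 w) (X2 w)"
      using cross_skew[of "X2 w" "X1 w"] by (simp add: b1_def a2_def algebra_simps)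
    also have "\<dots> = X11 w + X22 w + cross3 (X1 w) (X2 w)"
      by (simp only: add.assoc scaleR_add_left[symmetric]) simp
    finally show ?thesis using cmc[OF that] by simp
  qed
  define U where "U z = integral {0..1} (\<lambda>t. Re z *\<^sub>R a (t *\<^sub>R z) + Im z *\<^sub>R b (t *\<^sub>R z))" for z
  have dU: "has_partials U (a w) (b w) w" if w: "w \<in> ball 0 1" for w
  proof -
    have "has_partials U (a w + integral {0..1} (\<lambda>t. (t * Im w) *\<^sub>R (b1 (t *\<^sub>R w) - a2 (t *\<^sub>R w))))
        (b w - integral {0..1} (\<lambda>t. (t * Re w) *\<^sub>R (b1 (t *\<^sub>R w) - a2 (t *\<^sub>R w)))) w"
      unfolding U_def
    proof (rule primitive_of_form[where s = 1 and ax = a1 and by' = b2])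
      fix z assume z: "z \<in> ball (0::complex) 1"
      show "has_partials a (a1 z) (a2 z) z"
        unfolding a_def a1_def a2_def
        by (intro has_partials_add has_partials_minus has_partials_linear[OF bounded_linear_scaleR_right]
            has_partials_cross dX dX1 dX2 z)
      show "has_partials b (b1 z) (b2 z) z"
        unfolding b_def b1_def b2_def
        by (intro has_partials_add has_partials_minus has_partials_linear[OF bounded_linear_scaleR_right]
            has_partials_cross dX dX1 dX2 z)
    next
      show "continuous_on (ball 0 1) a1" "continuous_on (ball 0 1) a2"
        "continuous_on (ball 0 1) b1" "continuous_on (ball 0 1) b2"
        unfolding a1_def a2_def b1_def b2_def
        by (intro continuous_intros cc continuous_frame cX)+
    qed (rule w)
    moreover have "b1 (t *\<^sub>R w) - a2 (t *\<^sub>R w) = 0" if "t \<in> {0..1}" for t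
      by (rule eps) (use that w mult_left_le_one_le[of "cmod w" t] in auto)
    hence "integral {0..1} (\<lambda>t. (t * c) *\<^sub>R (b1 (t *\<^sub>R w) - a2 (t *\<^sub>R w))) = 0" for c
      by (intro integral_unique has_integral_is_0) simp
    ultimately show ?thesis by simp
  qed
  have zb: "z \<theta> \<in> ball 0 1" for \<theta> using r by (simp add: z_def norm_mult)
  have "((\<lambda>\<theta>. U (z \<theta>)) has_vector_derivative (Re (z \<theta>) *\<^sub>R b (z \<theta>) - Im (z \<theta>) *\<^sub>R a (z \<theta>))) (at \<theta> within {0..2*pi})" for \<theta>
  proof -
    have "(z has_vector_derivative \<i> * z \<theta>) (at \<theta> within {0..2*pi})"
      unfolding z_def cis_conv_exp
      by (rule has_vector_derivative_real_field) (auto intro!: derivative_eq_intros)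
    from has_partials_along[OF dU[OF zb] this] show ?thesis by simp
  qed
  from fundamental_theorem_of_calculus[OF _ this]
  have "((\<lambda>\<theta>. Re (z \<theta>) *\<^sub>R b (z \<theta>) - Im (z \<theta>) *\<^sub>R a (z \<theta>)) has_integral (U (z (2*pi)) - U (z 0))) {0..2*pi}" by simp
  thus ?thesis by (simp add: a_def b_def z_def)
qed

text \<open>\<open>T\<close> is the angular derivative of \<open>nu\<close>, and z (X1 - \<i> X2) is
  r X_r - \<i> X_\<theta>. The mean curvature relation eliminates the radial derivative of
  \<open>nu\<close>, which could not be controlled at the circle.\<close>

lemma hopf_polar:
  assumes z: "z \<in> ball 0 1"
  defines "T \<equiv> Re z *\<^sub>R N2 z - Im z *\<^sub>R N1 z"
  shows "z\<^sup>2 * q z = - of_real ((norm z)\<^sup>2 * L z)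
     + 2 * \<i> * z * (of_real (T \<bullet> X1 z) - \<i> * of_real (T \<bullet> X2 z))"
proof -
  have k: "k z = - L z - e z" using mean_curvature[OF z] by simp
  show ?thesis
    unfolding cmod_power2 using N_inner[OF z]
    by (simp add: T_def inner_diff_left k complex_eq_iff q_def power2_eq_square algebra_simps)
qed

end

unbundle no fps_syntax

subsection \<open>Stereographic projection of the Gauss map\<close>

definition horizontal :: "real^3 \<Rightarrow> complex" where "horizontal v = Complex (v $ 1) (v $ 2)"

lemma bounded_linear_horizontal: "bounded_linear horizontal"
  by (rule linear_conv_bounded_linear[THEN iffD1])
    (auto intro!: linearI simp: horizontal_def complex_eq_iff)

lemma bounded_linear_third: "bounded_linear (\<lambda>v::real^3. v $ 3)"
  by (rule bounded_linear_vec_nth)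

text \<open>Projection from the south pole. There the inverse of 0 is 0 and \<open>stereo\<close>
  takes the meaningless value 0, which is why \<open>chart\<close> is introduced below.\<close>

definition stereo :: "real^3 \<Rightarrow> complex" where
  "stereo n = horizontal n * of_real (inverse (1 + n $ 3))"

text \<open>\<open>(1 + n\<^sub>3)\<close> times the differential of the stereographic projection at \<open>n\<close>.\<close>

definition dstereo :: "real^3 \<Rightarrow> real^3 \<Rightarrow> complex" where
  "dstereo n v = horizontal v - stereo n * of_real (v $ 3)"

lemma linear_dstereo: "linear (dstereo n)"
  by (rule linearI) (auto simp: dstereo_def horizontal_def complex_eq_iff algebra_simps)

lemmas dstereo_simps = linear_add[OF linear_dstereo] linear_scale[OF linear_dstereo]
  linear_neg[OF linear_dstereo] linear_diff[OF linear_dstereo]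

text \<open>In the coordinates p, s and a the sphere is the single relation a (p^2 + s^2) = 2 - a,
  that is a = 2 / (1 + |w|^2) with w = p + \<i> s, and later identities become polynomial.\<close>

lemma stereo_coordinates:
  fixes n :: "real^3"
  assumes n: "n \<bullet> n = 1" and a: "1 + n $ 3 \<noteq> 0"
  defines "p \<equiv> Re (stereo n)" and "s \<equiv> Im (stereo n)" and "a \<equiv> 1 + n $ 3"
  shows "n $ 1 = a * p" "n $ 2 = a * s" "n $ 3 = a - 1" "a * (p * p + s * s) = 2 - a"
proof -
  show 1: "n $ 1 = a * p" "n $ 2 = a * s" "n $ 3 = a - 1"
  proof -
    have "x = a * (x * inverse a)" for x using a by (simp add: a_def)
    thus "n $ 1 = a * p" "n $ 2 = a * s"
      unfolding p_def s_def stereo_def horizontal_def a_def[symmetric]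
      by (simp_all del: of_real_inverse)
  qed (simp add: a_def)
  have "n $ 1 * n $ 1 + n $ 2 * n $ 2 + n $ 3 * n $ 3 = 1"
    using n by (simp add: inner_vec_def sum_3)
  hence "a * (a * (p * p + s * s) + a - 2) = 0" unfolding 1 by (simp add: algebra_simps)
  thus "a * (p * p + s * s) = 2 - a" using a unfolding a_def[symmetric] by simp
qed

text \<open>Stereographic projection is conformal and preserves orientation. Up to the factor 1 + n
  $ 3 that \<open>dstereo\<close> absorbs, its differential is an isometry of the tangent plane
  carrying the quarter turn \<open>cross3 n\<close> to multiplication by \<i>.\<close>

lemma dstereo_tangent:
  fixes n v :: "real^3"
  assumes n: "n \<bullet> n = 1" and a: "1 + n $ 3 \<noteq> 0" and v: "n \<bullet> v = 0"
  shows "v $ 3 = - (1 + n $ 3) * Re (cnj (stereo n) * dstereo n v)"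
    and "dstereo n (cross3 n v) = \<i> * dstereo n v"
    and "(norm (dstereo n v))\<^sup>2 = v \<bullet> v"
proof -
  define p s b where "p = Re (stereo n)" and "s = Im (stereo n)" and "b = 1 + n $ 3"
  note c = stereo_coordinates[OF n a, folded p_def s_def b_def]
  have st: "stereo n = Complex p s" by (simp add: p_def s_def)
  have b: "b \<noteq> 0" using a by (simp add: b_def)
  define V1 V2 V3 where "V1 = v $ 1" and "V2 = v $ 2" and "V3 = v $ 3"
  have v': "b * p * V1 + b * s * V2 + (b - 1) * V3 = 0"
    using v by (simp add: inner_vec_def sum_3 c V1_def V2_def V3_def)
  have c4: "b * p * p + b * s * s = 2 - b" using c(4) by (simp add: algebra_simps)
  have r: "p * V1 + s * V2 = - ((b - 1) * V3) / b" using v' b by (simp add: field_simps)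
  have ps: "p * p + s * s = (2 - b) / b" using c4 b by (simp add: field_simps)
  have "V3 = - b * (p * (V1 - p * V3) + s * (V2 - s * V3))"
    using v' c4 by algebra
  thus "v $ 3 = - (1 + n $ 3) * Re (cnj (stereo n) * dstereo n v)"
    by (simp add: dstereo_def horizontal_def st b_def[symmetric] V1_def V2_def V3_def algebra_simps)
  have "b * s * V3 - (b - 1) * V2 - p * (b * p * V2 - b * s * V1) = - (V2 - s * V3)"
    using v' c4 by algebra
  moreover have "(b - 1) * V1 - b * p * V3 - s * (b * p * V2 - b * s * V1) = V1 - p * V3"
    using v' c4 by algebra
  ultimately show "dstereo n (cross3 n v) = \<i> * dstereo n v"
    by (simp add: dstereo_def horizontal_def st complex_eq_iff cross3_def c V1_def V2_def V3_def algebra_simps)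
  have "b * ((V1 - p * V3) * (V1 - p * V3) + (V2 - s * V3) * (V2 - s * V3)) = b * (V1 * V1 + V2 * V2 + V3 * V3)"
    using v' c4 by algebra
  hence "(V1 - p * V3) * (V1 - p * V3) + (V2 - s * V3) * (V2 - s * V3) = V1 * V1 + V2 * V2 + V3 * V3"
    using b by simp
  thus "(norm (dstereo n v))\<^sup>2 = v \<bullet> v"
    unfolding cmod_power2 by (simp add: dstereo_def horizontal_def st inner_vec_def sum_3 V1_def V2_def V3_def power2_eq_square)
qed

text \<open>The normal is not tangent, but second derivatives of the surface have a normal part
  whose image enters \<open>laplacian_psi\<close>.\<close>

lemma dstereo_self:
  fixes n :: "real^3"
  assumes "1 + n $ 3 \<noteq> 0" shows "dstereo n n = stereo n"
  using assms by (simp add: dstereo_def stereo_def horizontal_def complex_eq_iff field_simps)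

text \<open>The product is the horizontal part of a unit vector, and 0 at the south pole.\<close>

lemma norm_stereo_le:
  fixes n :: "real^3"
  assumes n: "n \<bullet> n = 1" shows "norm (of_real (1 + n $ 3) * stereo n) \<le> 1"
proof (cases "1 + n $ 3 = 0")
  case False
  define a where "a = 1 + n $ 3"
  have a: "a \<noteq> 0" using False by (simp add: a_def)
  have "of_real (1 + n $ 3) * stereo n = Complex (n $ 1) (n $ 2)"
    unfolding stereo_def horizontal_def a_def[symmetric] using a
    by (simp add: complex_eq_iff power2_eq_square)
  hence "(norm (of_real (1 + n $ 3) * stereo n))\<^sup>2 = n $ 1 * n $ 1 + n $ 2 * n $ 2"
    by (simp only: cmod_power2 complex.sel) (simp add: power2_eq_square)
  also have "\<dots> \<le> 1"
  proof -
    have "n $ 1 * n $ 1 + n $ 2 * n $ 2 + n $ 3 * n $ 3 = 1" using n by (simp add: inner_vec_def sum_3)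
    thus ?thesis using zero_le_square[of "n $ 3"] by linarith
  qed
  finally show ?thesis by (simp add: abs_square_le_1 power_le_one_iff)
qed (simp del: of_real_add)

subsection \<open>Functions with continuous partial derivatives\<close>

text \<open>Hides the derivatives behind an existential, for regularity arguments in which their
  formulas do not matter.\<close>

definition C1_partials_on :: "complex set \<Rightarrow> (complex \<Rightarrow> 'a::real_normed_vector) \<Rightarrow> bool" where
  "C1_partials_on S f \<longleftrightarrow> (\<exists>fx fy. (\<forall>z\<in>S. has_partials f (fx z) (fy z) z) \<and> continuous_on S fx \<and> continuous_on S fy)"

lemma C1_partials_onI:
  "(\<And>z. z \<in> S \<Longrightarrow> has_partials f (fx z) (fy z) z) \<Longrightarrow> continuous_on S fx \<Longrightarrow> continuous_on S fy \<Longrightarrow> C1_partials_on S f"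
  unfolding C1_partials_on_def by blast

lemma C1_partials_on_continuous: "C1_partials_on S f \<Longrightarrow> continuous_on S f"
  unfolding C1_partials_on_def using has_partials_continuous_on by blast

lemma C1_partials_on_subset: "C1_partials_on S f \<Longrightarrow> T \<subseteq> S \<Longrightarrow> C1_partials_on T f"
  unfolding C1_partials_on_def by (meson continuous_on_subset subsetD)

lemma C1_partials_on_linear:
  assumes "bounded_linear T" "C1_partials_on S f"
  shows "C1_partials_on S (\<lambda>z. T (f z))"
proof -
  from assms(2) obtain fx fy where *: "\<And>z. z \<in> S \<Longrightarrow> has_partials f (fx z) (fy z) z" "continuous_on S fx" "continuous_on S fy"
    unfolding C1_partials_on_def by blast
  show ?thesis
    by (rule C1_partials_onI[OF has_partials_linear[OF assms(1) *(1)]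
        bounded_linear.continuous_on[OF assms(1) *(2)] bounded_linear.continuous_on[OF assms(1) *(3)]])
qed

lemma C1_partials_on_add:
  assumes "C1_partials_on S f" "C1_partials_on S k"
  shows "C1_partials_on S (\<lambda>z. f z + k z)"
proof -
  from assms obtain fx fy kx ky where *: "\<And>z. z \<in> S \<Longrightarrow> has_partials f (fx z) (fy z) z" "continuous_on S fx" "continuous_on S fy"
    "\<And>z. z \<in> S \<Longrightarrow> has_partials k (kx z) (ky z) z" "continuous_on S kx" "continuous_on S ky"
    unfolding C1_partials_on_def by blast
  show ?thesis
    by (rule C1_partials_onI[OF has_partials_add[OF *(1) *(4)] continuous_on_add[OF *(2,5)] continuous_on_add[OF *(3,6)]])
qed

lemma C1_partials_on_minus: "C1_partials_on S f \<Longrightarrow> C1_partials_on S (\<lambda>z. - f z)"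
  by (rule C1_partials_on_linear[OF bounded_linear_minus[OF bounded_linear_ident]])

lemma C1_partials_on_diff: "C1_partials_on S f \<Longrightarrow> C1_partials_on S k \<Longrightarrow> C1_partials_on S (\<lambda>z. f z - k z)"
  using C1_partials_on_add[OF _ C1_partials_on_minus] by fastforce

lemma C1_partials_on_bilinear:
  assumes T: "bounded_bilinear T" and "C1_partials_on S f" "C1_partials_on S k"
  shows "C1_partials_on S (\<lambda>z. T (f z) (k z))"
proof -
  from assms obtain fx fy kx ky where *: "\<And>z. z \<in> S \<Longrightarrow> has_partials f (fx z) (fy z) z" "continuous_on S fx" "continuous_on S fy"
    "\<And>z. z \<in> S \<Longrightarrow> has_partials k (kx z) (ky z) z" "continuous_on S kx" "continuous_on S ky"
    unfolding C1_partials_on_def by blast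
  have c: "continuous_on S f" "continuous_on S k" using assms C1_partials_on_continuous by blast+
  note cont = bounded_bilinear.continuous_on[OF T]
  show ?thesis
    by (rule C1_partials_onI[OF has_partials_bilinear[OF T *(1,4)] continuous_on_add[OF cont[OF *(2) c(2)] cont[OF c(1) *(5)]]
        continuous_on_add[OF cont[OF *(3) c(2)] cont[OF c(1) *(6)]]])
qed

lemma C1_partials_on_inverse:
  fixes f :: "complex \<Rightarrow> 'a::real_normed_div_algebra"
  assumes "C1_partials_on S f" "\<And>z. z \<in> S \<Longrightarrow> f z \<noteq> 0"
  shows "C1_partials_on S (\<lambda>z. inverse (f z))"
proof -
  from assms obtain fx fy where *: "\<And>z. z \<in> S \<Longrightarrow> has_partials f (fx z) (fy z) z" "continuous_on S fx" "continuous_on S fy"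
    unfolding C1_partials_on_def by blast
  have "continuous_on S f" using assms C1_partials_on_continuous by blast
  hence i: "continuous_on S (\<lambda>z. inverse (f z))" using assms(2) by (intro continuous_intros) auto
  show ?thesis
    by (rule C1_partials_onI[OF has_partials_inverse[OF *(1) assms(2)]]; (assumption | intro continuous_intros i *(2,3)))
qed

lemmas C1_partials_on_scaleR = C1_partials_on_bilinear[OF bounded_bilinear_scaleR]
lemmas C1_partials_on_mult = C1_partials_on_bilinear[OF bounded_bilinear_mult]

lemma C1_partials_on_const: "C1_partials_on S (\<lambda>z. c)"
  by (rule C1_partials_onI[OF has_partials_const]) auto

lemma C1_partials_on_holomorphic:
  assumes "f holomorphic_on S" "open S" shows "C1_partials_on S f"
proof (rule C1_partials_onI)
  show "has_partials f (deriv f z) (\<i> * deriv f z) z" if "z \<in> S" for z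
    using has_partials_holomorphic[OF holomorphic_derivI[OF assms that]] .
  have "continuous_on S (deriv f)" using holomorphic_deriv[OF assms] holomorphic_on_imp_continuous_on by blast
  thus "continuous_on S (deriv f)" "continuous_on S (\<lambda>z. \<i> * deriv f z)" by (auto intro!: continuous_intros)
qed

section \<open>The projected Gauss map and its elliptic equation\<close>

context cmc_disc
begin

lemma C1_frame: "C1_partials_on (ball 0 1) X1" "C1_partials_on (ball 0 1) X2" "C1_partials_on (ball 0 1) nu" "C1_partials_on (ball 0 1) L"
  by (rule C1_partials_onI[OF dX1 cX(1,2)] C1_partials_onI[OF dX2 cX(2,3)] C1_partials_onI[OF dnu continuous_N]; assumption)+
    (rule C1_partials_onI[OF dL], assumption, (intro continuous_intros cX continuous_frame)+)

text \<open>The gain of regularity: \<open>e\<close> and \<open>m\<close> are recovered from the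
  holomorphic \<open>q\<close> and the C^1 function \<open>L\<close>, and \<open>k\<close> follows
  from the mean curvature relation.\<close>

lemma C1_N: "C1_partials_on (ball 0 1) N1" "C1_partials_on (ball 0 1) N2"
proof -
  have q: "C1_partials_on (ball 0 1) q"
    using hopf_holomorphic by (intro C1_partials_on_holomorphic) auto
  have "e = (\<lambda>z. (1/2) * (Re (q z) - L z))" "m = (\<lambda>z. (-1/2) * Im (q z))" by (auto simp: q_def)
  hence em: "C1_partials_on (ball 0 1) e" "C1_partials_on (ball 0 1) m"
    by (simp_all only:)
      (rule C1_partials_on_linear[OF bounded_linear_mult_right C1_partials_on_diff[OF C1_partials_on_linear[OF bounded_linear_Re q] C1_frame(4)]]
        C1_partials_on_linear[OF bounded_linear_mult_right C1_partials_on_linear[OF bounded_linear_Im q]])+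
  have k: "C1_partials_on (ball 0 1) k"
  proof -
    have "C1_partials_on (ball 0 1) (\<lambda>z. - L z - e z)"
      by (intro C1_partials_on_diff C1_partials_on_minus C1_frame em)
    then obtain fx fy where *: "\<And>z. z \<in> ball 0 1 \<Longrightarrow> has_partials (\<lambda>z. - L z - e z) (fx z) (fy z) z"
      "continuous_on (ball 0 1) fx" "continuous_on (ball 0 1) fy" unfolding C1_partials_on_def by blast
    have "has_partials k (fx z) (fy z) z" if "z \<in> ball 0 1" for z
      by (rule has_partials_cong[OF *(1)[OF that] open_ball that]) (use mean_curvature in \<open>simp add: algebra_simps eq_diff_eq\<close>)
    thus ?thesis using *(2,3) by (rule C1_partials_onI)
  qed
  have L: "L z \<noteq> 0" if "z \<in> ball 0 1" for z using L_pos[OF that] by simp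
  show "C1_partials_on (ball 0 1) N1" "C1_partials_on (ball 0 1) N2"
    unfolding N1_def N2_def
    by (intro C1_partials_on_minus C1_partials_on_scaleR C1_partials_on_add em k C1_frame C1_partials_on_inverse L; assumption)+
qed

definition height :: "complex \<Rightarrow> real" where "height z = 1 + nu z $ 3"
definition psi :: "complex \<Rightarrow> complex" where "psi z = stereo (nu z)"
definition P1 where "P1 z = dstereo (nu z) (N1 z) * of_real (inverse (height z))"
definition P2 where "P2 z = dstereo (nu z) (N2 z) * of_real (inverse (height z))"
text \<open>Built from first derivatives of \<open>X\<close> only, yet equal to twice the
  z-derivative of \<open>psi\<close> by \<open>P_beta\<close>; this is what makes that derivative
  controllable up to the circle.\<close>

definition beta where "beta z = dstereo (nu z) (X1 z) * of_real (inverse (height z))"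

definition chart :: "complex set" where "chart = {z \<in> ball 0 1. height z \<noteq> 0}"

lemma chartD: "z \<in> chart \<Longrightarrow> z \<in> ball 0 1" "z \<in> chart \<Longrightarrow> 1 + nu z $ 3 \<noteq> 0" "z \<in> chart \<Longrightarrow> height z \<noteq> 0"
  by (auto simp: chart_def height_def)

lemma open_chart: "open chart"
proof -
  have "continuous_on (ball 0 1) height"
    unfolding height_def by (intro continuous_intros continuous_frame)
  from continuous_open_preimage[OF this open_ball, of "- {0}"] have "open (ball 0 1 \<inter> height -` (- {0}))" by auto
  moreover have "ball 0 1 \<inter> height -` (- {0}) = chart" by (auto simp: chart_def)
  ultimately show ?thesis by simp
qed

lemma dheight: "z \<in> ball 0 1 \<Longrightarrow> has_partials height (N1 z $ 3) (N2 z $ 3) z"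
  using has_partials_add[OF has_partials_const has_partials_linear[OF bounded_linear_third dnu], of z 1]
  unfolding height_def by simp

lemma dpsi: assumes z: "z \<in> chart" shows "has_partials psi (P1 z) (P2 z) z"
proof -
  note z' = chartD[OF z]
  have "has_partials (\<lambda>z. horizontal (nu z) * of_real (inverse (height z)))
     (horizontal (N1 z) * of_real (inverse (height z)) + horizontal (nu z) * of_real (- (inverse (height z) * N1 z $ 3 * inverse (height z))))
     (horizontal (N2 z) * of_real (inverse (height z)) + horizontal (nu z) * of_real (- (inverse (height z) * N2 z $ 3 * inverse (height z)))) z"
    by (intro has_partials_mult has_partials_linear[OF bounded_linear_horizontal] has_partials_linear[OF bounded_linear_of_real]
        has_partials_inverse dnu dheight z')
  moreover have "horizontal (v) * of_real (inverse (height z)) + horizontal (nu z) * of_real (- (inverse (height z) * v $ 3 * inverse (height z)))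
     = dstereo (nu z) v * of_real (inverse (height z))" for v
    by (simp add: dstereo_def stereo_def height_def[symmetric] algebra_simps)
  ultimately show ?thesis unfolding P1_def P2_def psi_def stereo_def height_def by simp
qed

lemma C1_P: "C1_partials_on chart P1" "C1_partials_on chart P2"
proof -
  have sub: "chart \<subseteq> ball 0 1" by (auto simp: chart_def)
  note s = C1_partials_on_subset[OF _ sub]
  have h: "C1_partials_on chart (\<lambda>z. complex_of_real (inverse (height z)))"
    unfolding height_def
    by (rule C1_partials_on_linear[OF bounded_linear_of_real], rule C1_partials_on_inverse)
      (intro C1_partials_on_add C1_partials_on_const C1_partials_on_linear[OF bounded_linear_third] s[OF C1_frame(3)], simp add: chartD)
  have "C1_partials_on chart (\<lambda>z. (horizontal (N z) - (horizontal (nu z) * of_real (inverse (height z))) * of_real (N z $ 3)) * of_real (inverse (height z)))"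
    if "C1_partials_on (ball 0 1) N" for N :: "complex \<Rightarrow> real^3"
    by (intro C1_partials_on_mult C1_partials_on_diff C1_partials_on_linear[OF bounded_linear_horizontal] h
        C1_partials_on_linear[OF bounded_linear_of_real] C1_partials_on_linear[OF bounded_linear_third] s[OF that] s[OF C1_frame(3)])
  from this[OF C1_N(1)] this[OF C1_N(2)] show "C1_partials_on chart P1" "C1_partials_on chart P2"
    unfolding P1_def P2_def dstereo_def stereo_def height_def .
qed

text \<open>As \<open>dstereo\<close> is complex linear on the tangent plane, P1 and P2 are -(beta /
  L)(e + \<i> m) and -(beta / L)(m + \<i> k). The z-derivative of \<open>psi\<close> then sees only
  e + k = - L, the conjugate derivative only the trace-free part, which is the conjugate of
  \<open>q\<close>.\<close>

lemma P_beta: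
  assumes z: "z \<in> chart"
  shows "P1 z - \<i> * P2 z = beta z"
    and "P1 z + \<i> * P2 z = - beta z * Complex (e z - k z) (2 * m z) * of_real (inverse (L z))"
    and "dstereo (nu z) (X1 z) = of_real (height z) * beta z" "dstereo (nu z) (X2 z) = \<i> * of_real (height z) * beta z"
    and "X1 z $ 3 = - (height z)\<^sup>2 * Re (cnj (psi z) * beta z)" "X2 z $ 3 = (height z)\<^sup>2 * Im (cnj (psi z) * beta z)"
    and "L z = (height z)\<^sup>2 * (norm (beta z))\<^sup>2"
proof -
  note zd = chartD[OF z] and f = frame_facts[OF chartD(1)[OF z]]
  have L: "L z \<noteq> 0" using L_pos[OF zd(1)] by simp
  show b1: "dstereo (nu z) (X1 z) = of_real (height z) * beta z"
    using zd(3) by (simp add: beta_def)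
  show b2: "dstereo (nu z) (X2 z) = \<i> * of_real (height z) * beta z"
    using dstereo_tangent(2)[OF f(2) zd(2) f(3)] f(5) b1 by simp
  have dN: "dstereo (nu z) (- (c *\<^sub>R (x *\<^sub>R X1 z + y *\<^sub>R X2 z))) * of_real (inverse (height z))
      = - beta z * of_real c * Complex x y" for c x y
  proof -
    have "dstereo (nu z) (- (c *\<^sub>R (x *\<^sub>R X1 z + y *\<^sub>R X2 z)))
       = - (of_real c * (of_real x * (of_real (height z) * beta z) + of_real y * (\<i> * of_real (height z) * beta z)))"
      by (simp add: dstereo_simps b1 b2 scaleR_conv_of_real[where 'a = complex])
    thus ?thesis using zd(3) by (simp add: Complex_eq field_simps)
  qed
  have p1: "P1 z = - beta z * of_real (inverse (L z)) * Complex (e z) (m z)"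
    unfolding P1_def N1_def by (rule dN)
  have p2: "P2 z = - beta z * of_real (inverse (L z)) * Complex (m z) (k z)"
    unfolding P2_def N2_def by (rule dN)
  have k: "k z = - L z - e z" using mean_curvature[OF zd(1)] by simp
  have LL: "L z * inverse (L z) = 1" "inverse (L z) * (L z * x) = x" "L z * (inverse (L z) * x) = x" for x
    using L by simp_all
  show "P1 z - \<i> * P2 z = beta z"
    and "P1 z + \<i> * P2 z = - beta z * Complex (e z - k z) (2 * m z) * of_real (inverse (L z))"
    unfolding p1 p2 k by (simp_all add: complex_eq_iff algebra_simps LL del: of_real_inverse)
  show "X1 z $ 3 = - (height z)\<^sup>2 * Re (cnj (psi z) * beta z)" "X2 z $ 3 = (height z)\<^sup>2 * Im (cnj (psi z) * beta z)"
    using dstereo_tangent(1)[OF f(2) zd(2) f(3)] dstereo_tangent(1)[OF f(2) zd(2) f(4)]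
    unfolding b1 b2 height_def[symmetric] psi_def[symmetric] by (simp_all add: power2_eq_square algebra_simps)
  show "L z = (height z)\<^sup>2 * (norm (beta z))\<^sup>2"
    using dstereo_tangent(3)[OF f(2) zd(2) f(3)] unfolding b1 by (simp add: L_def norm_mult power_mult_distrib)
qed

text \<open>The harmonic map equation of the Gauss map in stereographic coordinates:
  \<open>height\<close> is 2 / (1 + |psi|^2) and \<open>beta\<close> is P1 - \<i> P2. By symmetry of
  the mixed derivatives the Laplacian is beta_x + \<i> beta_y, and computing this from the
  definition of \<open>beta\<close> brings in the Gauss formulas.\<close>

lemma laplacian_psi:
  assumes z: "z \<in> chart" and P1: "has_partials P1 P11 P12 z" and P2: "has_partials P2 P21 P22 z"
  shows "P12 = P21" "P11 + P22 = of_real (height z) * cnj (psi z) * beta z * (P1 z + \<i> * P2 z)"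
proof -
  note zd = chartD[OF z] and f = frame_facts[OF chartD(1)[OF z]]
  from open_chart z obtain r where r: "r > 0" "ball z r \<subseteq> chart" using open_contains_ball by blast
  show sym: "P12 = P21"
    by (rule mixed_partials_eq[OF r(1) _ P1 P2]) (use r(2) dpsi in blast)
  define h where "h = height z"
  \<comment> \<open>\<open>T1\<close> and \<open>T2\<close> are the partial derivatives of dstereo
    (nu z) (X1 z), which is height times beta.\<close>
  define T1 where "T1 = dstereo (nu z) (X11 z) - P1 z * of_real (X1 z $ 3)"
  define T2 where "T2 = dstereo (nu z) (X12 z) - P2 z * of_real (X1 z $ 3)"
  have h: "h \<noteq> 0" using zd by (simp add: h_def)
  hence hh: "of_real h * (inverse (of_real h) * x) = x" for x :: complex by simp
  have "has_partials (\<lambda>z. (horizontal (X1 z) - psi z * of_real (X1 z $ 3)) * of_real (inverse (height z)))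
      ((horizontal (X11 z) - (P1 z * of_real (X1 z $ 3) + psi z * of_real (X11 z $ 3))) * of_real (inverse (height z))
        + (horizontal (X1 z) - psi z * of_real (X1 z $ 3)) * of_real (- (inverse (height z) * N1 z $ 3 * inverse (height z))))
      ((horizontal (X12 z) - (P2 z * of_real (X1 z $ 3) + psi z * of_real (X12 z $ 3))) * of_real (inverse (height z))
        + (horizontal (X1 z) - psi z * of_real (X1 z $ 3)) * of_real (- (inverse (height z) * N2 z $ 3 * inverse (height z)))) z"
    by (intro has_partials_mult has_partials_diff has_partials_linear[OF bounded_linear_horizontal] has_partials_linear[OF bounded_linear_of_real]
        has_partials_linear[OF bounded_linear_third] has_partials_inverse dX1 dpsi dheight zd z)
  moreover have "horizontal (X1 z) - psi z * of_real (X1 z $ 3) = of_real h * beta z"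
    using P_beta(3)[OF z] by (simp add: dstereo_def psi_def h_def)
  moreover have "(\<lambda>z. (horizontal (X1 z) - psi z * of_real (X1 z $ 3)) * of_real (inverse (height z))) = beta"
    by (auto simp: beta_def dstereo_def psi_def)
  ultimately have db: "has_partials beta ((T1 - beta z * of_real (N1 z $ 3)) * of_real (inverse h))
      ((T2 - beta z * of_real (N2 z $ 3)) * of_real (inverse h)) z"
    by (simp add: hh h_def[symmetric] T1_def T2_def dstereo_def psi_def algebra_simps)
  have "has_partials beta (P11 - \<i> * P21) (P12 - \<i> * P22) z"
    by (rule has_partials_cong[OF has_partials_diff[OF P1 has_partials_linear[OF bounded_linear_mult_right P2]] open_chart z])
      (rule P_beta)
  from has_partials_unique[OF this db] have ee:
    "P11 - \<i> * P21 = (T1 - beta z * of_real (N1 z $ 3)) * of_real (inverse h)"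
    "P12 - \<i> * P22 = (T2 - beta z * of_real (N2 z $ 3)) * of_real (inverse h)" by auto
  have "(P11 - \<i> * P21) + \<i> * (P12 - \<i> * P22)
     = (T1 + \<i> * T2 - beta z * (of_real (N1 z $ 3) + \<i> * of_real (N2 z $ 3))) * of_real (inverse h)"
    unfolding ee by (simp add: algebra_simps)
  moreover have "(P11 - \<i> * P21) + \<i> * (P12 - \<i> * P22) = P11 + P22"
    using sym by (simp add: complex_eq_iff)
  ultimately have lap: "P11 + P22 = (T1 + \<i> * T2 - beta z * (of_real (N1 z $ 3) + \<i> * of_real (N2 z $ 3))) * of_real (inverse h)"
    by simp
  \<comment> \<open>The Christoffel terms cancel because \<open>X2\<close> goes to \<i> times the
    image of \<open>X1\<close>; only the normal parts survive.\<close>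
  have "dstereo (nu z) (X11 z) + \<i> * dstereo (nu z) (X12 z) = Complex (e z) (m z) * psi z"
  proof -
    define a b where "a = (X11 z \<bullet> X1 z) / L z" and "b = (X12 z \<bullet> X1 z) / L z"
    show ?thesis
      unfolding second_derivatives(1,2)[OF zd(1), folded a_def b_def]
      using P_beta(3,4)[OF z] dstereo_self[OF zd(2)]
      by (simp add: dstereo_simps psi_def[symmetric] complex_eq_iff algebra_simps)
  qed
  hence T12: "T1 + \<i> * T2 = Complex (e z) (m z) * psi z - (P1 z + \<i> * P2 z) * of_real (X1 z $ 3)"
    by (simp add: T1_def T2_def algebra_simps)
  define t u l where "t = X1 z $ 3" and "u = X2 z $ 3" and "l = L z"
  define p1 p2 b1 b2 where "p1 = Re (psi z)" and "p2 = Im (psi z)" and "b1 = Re (beta z)" and "b2 = Im (beta z)"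
  define x y where "x = e z - k z" and "y = 2 * m z"
  have tu: "t = - h\<^sup>2 * (p1 * b1 + p2 * b2)" "u = h\<^sup>2 * (p1 * b2 - p2 * b1)" "l = h\<^sup>2 * (b1\<^sup>2 + b2\<^sup>2)"
    using P_beta(5-7)[OF z] by (auto simp: t_def u_def l_def p1_def p2_def b1_def b2_def h_def cmod_power2)
  have l0: "l \<noteq> 0" using L_pos[OF zd(1)] by (simp add: l_def)
  have emk: "e z = (x - l) / 2" "k z = - (x + l) / 2" "m z = y / 2"
    using mean_curvature[OF zd(1)] by (auto simp: x_def y_def l_def)
  have N3: "N1 z $ 3 = - inverse l * ((x - l) / 2 * t + y / 2 * u)" "N2 z $ 3 = - inverse l * (y / 2 * t - (x + l) / 2 * u)"
    unfolding N1_def N2_def emk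
    by (simp_all add: t_def u_def l_def) (simp add: algebra_simps)
  have gam: "P1 z + \<i> * P2 z = - beta z * Complex x y * of_real (inverse l)"
    using P_beta(2)[OF z] by (simp add: x_def y_def l_def)
  have bz: "beta z = Complex b1 b2" "psi z = Complex p1 p2" by (auto simp: b1_def b2_def p1_def p2_def)
  have "of_real l * (T1 + \<i> * T2 - beta z * (of_real (N1 z $ 3) + \<i> * of_real (N2 z $ 3)))
      = - (of_real (h\<^sup>2) * cnj (psi z) * beta z * (beta z * Complex x y))"
    (is "_ = ?R")
  proof -
    have "of_real l * (T1 + \<i> * T2 - beta z * (of_real (N1 z $ 3) + \<i> * of_real (N2 z $ 3)))
       = of_real l * Complex ((x - l)/2) (y/2) * psi z + beta z * Complex x y * of_real t
         + beta z * Complex ((x - l) / 2 * t + y / 2 * u) (y / 2 * t - (x + l) / 2 * u)"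
      unfolding T12 gam N3 emk t_def[symmetric] using l0 by (simp add: complex_eq_iff field_simps)
    also have "\<dots> = ?R"
      unfolding bz tu by (simp add: complex_eq_iff power2_eq_square field_simps)
    finally show ?thesis .
  qed
  hence "T1 + \<i> * T2 - beta z * (of_real (N1 z $ 3) + \<i> * of_real (N2 z $ 3))
     = of_real (h\<^sup>2) * cnj (psi z) * beta z * (P1 z + \<i> * P2 z)"
    using l0 unfolding gam by (simp add: field_simps)
  thus "P11 + P22 = of_real (height z) * cnj (psi z) * beta z * (P1 z + \<i> * P2 z)"
    unfolding lap using h by (simp add: h_def power2_eq_square field_simps)
qed

text \<open>The nonlinearity is quadratic in the gradient, but one factor is \<open>beta\<close>, of
  length |X1| / |height|, and |height| |psi| is at most 1; what is left is linear.\<close>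

lemma norm_laplacian_psi_le:
  assumes z: "z \<in> chart" and "has_partials P1 P11 P12 z" and "has_partials P2 P21 P22 z"
  shows "norm (P11 + P22) \<le> norm (X1 z) / \<bar>height z\<bar> * (norm (P1 z) + norm (P2 z))"
proof -
  note zd = chartD[OF z] and f = frame_facts[OF chartD(1)[OF z]]
  have "norm (P11 + P22) = norm (of_real (height z) * psi z) * norm (beta z) * norm (P1 z + \<i> * P2 z)"
    unfolding laplacian_psi(2)[OF assms] by (simp add: norm_mult)
  also have "\<dots> \<le> 1 * norm (beta z) * (norm (P1 z) + norm (P2 z))"
    using norm_stereo_le[OF f(2)] norm_triangle_ineq[of "P1 z" "\<i> * P2 z"]
    by (intro mult_mono) (auto simp: height_def psi_def norm_mult)
  also have "norm (beta z) = norm (X1 z) / \<bar>height z\<bar>"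
  proof -
    have "(norm (dstereo (nu z) (X1 z)))\<^sup>2 = (norm (X1 z))\<^sup>2"
      using dstereo_tangent(3)[OF f(2) zd(2) f(3)] by (simp add: power2_norm_eq_inner)
    thus ?thesis by (simp add: beta_def norm_mult divide_inverse norm_inverse)
  qed
  finally show ?thesis by simp
qed

text \<open>Isometry of \<open>dstereo\<close> again: it turns energy bounds for \<open>psi\<close>
  into bounds for the derivatives of \<open>nu\<close>.\<close>

lemma norm_N_combination:
  assumes z: "z \<in> chart"
  shows "norm (a *\<^sub>R N1 z + b *\<^sub>R N2 z) = \<bar>height z\<bar> * norm (a *\<^sub>R P1 z + b *\<^sub>R P2 z)"
proof -
  note zd = chartD[OF z] and f = frame_facts[OF chartD(1)[OF z]] and N = N_inner[OF chartD(1)[OF z]]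
  let ?v = "a *\<^sub>R N1 z + b *\<^sub>R N2 z"
  have "nu z \<bullet> ?v = 0" using N by (simp add: inner_add_right inner_commute)
  hence "(norm (dstereo (nu z) ?v))\<^sup>2 = (norm ?v)\<^sup>2"
    using dstereo_tangent(3)[OF f(2) zd(2)] by (simp add: power2_norm_eq_inner)
  hence "norm ?v = norm (dstereo (nu z) ?v)" by simp
  also have "dstereo (nu z) ?v = of_real (height z) * (a *\<^sub>R P1 z + b *\<^sub>R P2 z)"
  proof -
    have hh: "of_real (height z) * (inverse (of_real (height z)) * x) = x" for x :: complex using zd(3) by simp
    have "dstereo (nu z) ?v = a *\<^sub>R dstereo (nu z) (N1 z) + b *\<^sub>R dstereo (nu z) (N2 z)"
      by (simp add: dstereo_simps)
    thus ?thesis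
      by (simp add: hh P1_def P2_def scaleR_conv_of_real[where 'a = complex] algebra_simps)
  qed
  finally show ?thesis by (simp add: norm_mult)
qed

text \<open>The point is umbilic: e = k = - L / 2 and m = 0.\<close>

lemma hopf_zero_imp:
  assumes z: "z \<in> ball 0 1" and q: "q z = 0"
  shows "N1 z = (1/2) *\<^sub>R X1 z" "N2 z = (1/2) *\<^sub>R X2 z"
proof -
  have "e z = - L z / 2" "m z = 0" using q by (auto simp: q_def complex_eq_iff)
  moreover from this have "k z = - L z / 2" using mean_curvature[OF z] by simp
  ultimately show "N1 z = (1/2) *\<^sub>R X1 z" "N2 z = (1/2) *\<^sub>R X2 z"
    using L_pos[OF z] by (simp_all add: N1_def N2_def)
qed

lemma hopf_zero_imp_holomorphic:
  assumes z: "z \<in> chart" and q: "q z = 0"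
  shows "(psi has_field_derivative P1 z) (at z)"
proof -
  have "P2 z = \<i> * P1 z"
    unfolding P1_def P2_def hopf_zero_imp[OF chartD(1)[OF z] q]
    using P_beta(3,4)[OF z] by (simp add: dstereo_simps complex_eq_iff)
  thus ?thesis using dpsi[OF z] has_partials_imp_field_derivative by simp
qed

end

subsection \<open>An energy estimate on circles\<close>

text \<open>Beyond the last point where f \<le> M the function would be nonincreasing, so it cannot
  end above M.\<close>

lemma le_of_nonincreasing_above:
  fixes f :: "real \<Rightarrow> real"
  assumes ab: "a \<le> b" and d: "\<And>x. x \<in> {a..b} \<Longrightarrow> (f has_real_derivative f' x) (at x)"
    and fa: "f a \<le> M" and neg: "\<And>x. x \<in> {a..b} \<Longrightarrow> f x > M \<Longrightarrow> f' x \<le> 0"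
  shows "f b \<le> M"
proof (rule ccontr)
  assume "\<not> f b \<le> M"
  define S where "S = {x \<in> {a..b}. f x \<le> M}"
  have cf: "continuous_on {a..b} f"
    using d by (meson DERIV_isCont continuous_at_imp_continuous_on)
  have "closed S" unfolding S_def by (rule continuous_on_closed_Collect_le[OF cf]) auto
  hence cS: "compact S" by (metis (no_types, lifting) S_def bounded_closed_interval bounded_subset compact_eq_bounded_closed mem_Collect_eq subsetI)
  have "a \<in> S" using fa ab by (auto simp: S_def)
  then obtain c where c: "c \<in> S" "\<And>x. x \<in> S \<Longrightarrow> x \<le> c"
    using compact_attains_sup[OF cS] by blast
  have cb: "c < b" using c(1) \<open>\<not> f b \<le> M\<close> by (cases "c = b") (auto simp: S_def)
  have "\<exists>z. c < z \<and> z < b \<and> f b - f c = (b - c) * f' z"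
    by (rule MVT2[OF cb]) (use c(1) d in \<open>auto simp: S_def\<close>)
  then obtain z where z: "c < z" "z < b" "f b - f c = (b - c) * f' z" by blast
  have "z \<notin> S" using c(2)[of z] z(1) by auto
  hence "f z > M" "z \<in> {a..b}" using z c(1) by (auto simp: S_def)
  hence "f' z \<le> 0" using neg by blast
  hence "f b \<le> f c" using z cb by (smt (verit) mult_nonneg_nonpos)
  thus False using c(1) \<open>\<not> f b \<le> M\<close> by (auto simp: S_def)
qed

text \<open>For a function \<eta> on the circle of radius r, read \<open>E\<close>, \<open>D\<close>
  and \<open>J\<close> as the integrals of |\<eta>|^2, |\<nabla>\<eta>|^2 and \<eta> \<bullet>
  \<Delta>\<eta>. Then \<open>dP\<close> is Green's formula and \<open>E_lim\<close> says that
  \<eta> vanishes at the boundary. The bound 1/2 \<le> r0 keeps division by r harmless.\<close>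

locale circle_energy =
  fixes E E' D J :: "real \<Rightarrow> real" and C r0 :: real
  assumes r0: "1/2 \<le> r0" "r0 < 1" and C: "0 \<le> C"
    and dE: "r \<in> {r0<..<1} \<Longrightarrow> (E has_real_derivative E' r) (at r)"
    and dP: "r \<in> {r0<..<1} \<Longrightarrow> ((\<lambda>r. r * E' r) has_real_derivative 2 * r * (D r + J r)) (at r)"
    and nonneg: "r \<in> {r0<..<1} \<Longrightarrow> 0 \<le> E r" "r \<in> {r0<..<1} \<Longrightarrow> 0 \<le> D r"
    and E'_le: "r \<in> {r0<..<1} \<Longrightarrow> \<bar>E' r\<bar> \<le> 2 * (sqrt (E r) * sqrt (D r))"
    and J_le: "r \<in> {r0<..<1} \<Longrightarrow> \<bar>J r\<bar> \<le> C * sqrt (E r) * (1 + sqrt (D r))"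
    and E_lim: "(E \<longlongrightarrow> 0) (at_left 1)"
begin

lemma E_le_1: "\<exists>r1. r0 < r1 \<and> r1 < 1 \<and> (\<forall>r\<in>{r1..<1}. E r \<le> 1)"
proof -
  have "\<forall>\<^sub>F r in at_left 1. E r < 1" using E_lim by (intro order_tendstoD) auto
  then obtain b where b: "b < 1" "\<And>r. b < r \<Longrightarrow> r < 1 \<Longrightarrow> E r < 1"
    unfolding eventually_at_left_field by blast
  show ?thesis using b r0
    by (intro exI[of _ "(max b r0 + 1) / 2"]) (auto intro!: less_imp_le[OF b(2)] simp: field_simps)
qed

text \<open>The square root \<open>s = sqrt (E + \<delta>)\<close> satisfies \<open>- (r s')' \<le> K (1 + \<bar>r s'\<bar>)\<close>, so \<open>- s'\<close> cannot blow up
  before \<open>r = 1\<close>, uniformly in \<open>\<delta>\<close>.\<close>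

lemma E_quadratic_decay: "\<exists>V r1. 0 \<le> V \<and> r0 < r1 \<and> r1 < 1 \<and> (\<forall>r\<in>{r1..<1}. E r \<le> V\<^sup>2 * (1 - r)\<^sup>2 \<and> E r \<le> 1)"
proof -
  obtain r1 where r1: "r0 < r1" "r1 < 1" and E1: "\<And>r. r \<in> {r1..<1} \<Longrightarrow> E r \<le> 1"
    using E_le_1 by blast
  \<comment> \<open>\<open>K\<close> collects C + C^2 s with s \<le> 2. \<open>M\<close> bounds w at
    the left end and is at least 1, as the barrier argument requires; the factor 2 in
    \<open>V\<close> pays for division by x \<ge> 1/2.\<close>
  define K where "K = C + 2 * C\<^sup>2"
  define M where "M = 1 + sqrt (D r1)"
  define V where "V = 2 * (M * exp (2 * K))"
  have K: "K \<ge> 0" using C by (simp add: K_def)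
  have M1: "M \<ge> 1" using nonneg(2)[of r1] r1 by (simp add: M_def)
  have V: "V \<ge> 0" using M1 by (simp add: V_def)
  have main: "sqrt (E r) \<le> sqrt \<delta> + V * (1 - r)" if r: "r \<in> {r1..<1}" and \<delta>: "0 < \<delta>" "\<delta> \<le> 1" for r \<delta>
  proof -
    define s where "s x = sqrt (E x + \<delta>)" for x
    define s' where "s' x = E' x / (2 * s x)" for x
    define w where "w x = - (x * E' x) / (2 * s x)" for x
    define w' where "w' x = - (x / s x) * (D x + J x - (s' x)\<^sup>2)" for x
    have in0: "x \<in> {r0<..<1}" if "x \<in> {r1..<1}" for x using that r1 by auto
    have spos: "s x > 0" if "x \<in> {r1..<1}" for x
      using nonneg(1)[OF in0[OF that]] \<delta> by (simp add: s_def)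
    have s2: "s x \<le> 2" if "x \<in> {r1..<1}" for x
    proof -
      have "s x \<le> sqrt 4" unfolding s_def using E1[OF that] \<delta> by (intro real_sqrt_le_mono) simp
      thus ?thesis by simp
    qed
    have ssq: "s x * s x = E x + \<delta>" if "x \<in> {r1..<1}" for x
      using nonneg(1)[OF in0[OF that]] \<delta> by (simp add: s_def)
    have Es: "sqrt (E x) \<le> s x" if "x \<in> {r1..<1}" for x
      using \<delta> by (simp add: s_def)
    have ds: "(s has_real_derivative s' x) (at x)" if "x \<in> {r1..<1}" for x
    proof -
      have "E x + \<delta> > 0" using nonneg(1)[OF in0[OF that]] \<delta> by simp
      from DERIV_chain2[OF DERIV_real_sqrt[OF this] DERIV_add[OF dE[OF in0[OF that]] DERIV_const]]
      show ?thesis unfolding s_def s'_def by (simp add: field_simps)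
    qed
    have s'_le: "\<bar>s' x\<bar> \<le> sqrt (D x)" if "x \<in> {r1..<1}" for x
    proof -
      have "\<bar>E' x\<bar> \<le> 2 * (s x * sqrt (D x))"
        using E'_le[OF in0[OF that]] mult_right_mono[OF Es[OF that], of "sqrt (D x)"] nonneg(2)[OF in0[OF that]] by simp
      thus ?thesis using spos[OF that] by (simp add: s'_def abs_mult field_simps)
    qed
    have dw: "(w has_real_derivative w' x) (at x)" if x: "x \<in> {r1..<1}" for x
    proof -
      have "((\<lambda>x. - (x * E' x) / (2 * s x)) has_real_derivative
         ((- (2 * x * (D x + J x))) * (2 * s x) - (- (x * E' x)) * (2 * s' x)) / ((2 * s x) * (2 * s x))) (at x)"
        using spos[OF x] by (intro DERIV_divide DERIV_minus dP[OF in0[OF x]] DERIV_cmult ds[OF x]) auto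
      moreover have "((- (2 * x * (D x + J x))) * (2 * s x) - (- (x * E' x)) * (2 * s' x)) / ((2 * s x) * (2 * s x)) = w' x"
        using spos[OF x] by (simp add: w'_def s'_def field_simps power2_eq_square)
      ultimately show ?thesis unfolding w_def by simp
    qed
    have w'_le: "w' x \<le> K * (1 + \<bar>w x\<bar>)" if x: "x \<in> {r1..<1}" for x
    proof -
      have x01: "0 < x" "x < 1" "1/2 \<le> x" using x r1 r0 by auto
      define d y where "d = sqrt (D x)" and "y = \<bar>s' x\<bar>"
      have dd: "D x = d * d" using nonneg(2)[OF in0[OF x]] by (simp add: d_def)
      have yd: "0 \<le> y" "y \<le> d" using s'_le[OF x] by (auto simp: y_def d_def)
      have wy: "\<bar>w x\<bar> = x * y" using x01 spos[OF x] by (simp add: w_def y_def s'_def abs_mult)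
      have J: "- J x \<le> C * s x * (1 + d)"
      proof -
        have "- J x \<le> C * sqrt (E x) * (1 + d)" using J_le[OF in0[OF x]] by (simp add: d_def)
        also have "\<dots> \<le> C * s x * (1 + d)" using Es[OF x] C yd by (intro mult_right_mono mult_left_mono) auto
        finally show ?thesis .
      qed
      have "w' x = (x / s x) * (y * y - d * d - J x)"
        by (simp add: w'_def dd y_def power2_eq_square algebra_simps)
      also have "\<dots> \<le> (x / s x) * (s x * (C + C * y + C\<^sup>2 * s x))"
      proof (intro mult_left_mono)
        show "y * y - d * d - J x \<le> s x * (C + C * y + C\<^sup>2 * s x)"
        \<comment> \<open>Either d exceeds y by C s, and then d^2 - y^2 absorbs the term C s d, or d
          is at most y + C s and can be replaced by it.\<close>
        proof (cases "d - y \<ge> C * s x")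
          case True
          have "C * s x * d \<le> (d - y) * (d + y)"
            using True yd C spos[OF x] by (intro mult_mono) auto
          moreover have "0 \<le> C * s x * (C * s x) + C * s x * y" using C spos[OF x] yd by simp
          ultimately show ?thesis using J by (simp add: algebra_simps power2_eq_square)
        next
          case False
          have "y * y \<le> d * d" using yd by (intro mult_mono) auto
          moreover have "C * s x * d \<le> C * s x * (y + C * s x)"
            using False C spos[OF x] by (intro mult_left_mono) auto
          ultimately show ?thesis using J by (simp add: algebra_simps power2_eq_square)
        qed
      qed (use x01 spos[OF x] in auto)
      also have "\<dots> = x * (C + C\<^sup>2 * s x) + C * (x * y)" using spos[OF x] by (simp add: algebra_simps)
      also have "\<dots> \<le> 1 * (C + C\<^sup>2 * 2) + K * (x * y)"
      proof (intro add_mono mult_mono)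
        show "s x \<le> 2" by (rule s2[OF x])
      qed (use x01 C yd spos[OF x] in \<open>auto simp: K_def\<close>)
      finally show ?thesis unfolding wy by (simp add: K_def algebra_simps)
    qed
    have w_le: "w x \<le> M * exp (2 * K)" if x: "x \<in> {r1..<1}" for x
    proof -
      \<comment> \<open>Where the left side exceeds M \<ge> 1, also w \<ge> 1 and K (1 + w) \<le> 2
        K w; the exponential weight then makes it nonincreasing.\<close>
      have "w x * exp (- 2 * K * x) \<le> M"
      proof (rule le_of_nonincreasing_above[where a = r1 and f = "\<lambda>x. w x * exp (- 2 * K * x)"
            and f' = "\<lambda>x. (w' x - 2 * K * w x) * exp (- 2 * K * x)"])
        fix u assume u: "u \<in> {r1..x}"
        hence u': "u \<in> {r1..<1}" using x by auto
        show "((\<lambda>x. w x * exp (- 2 * K * x)) has_real_derivative (w' u - 2 * K * w u) * exp (- 2 * K * u)) (at u)"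
          using dw[OF u'] by (auto intro!: derivative_eq_intros simp: algebra_simps)
        assume "w u * exp (- 2 * K * u) > M"
        moreover have "exp (- 2 * K * u) \<le> 1" using K u r1 r0 by simp
        ultimately have "w u \<ge> 1" using M1
          by (smt (verit, best) exp_ge_zero mult_le_cancel_left1 mult_nonneg_nonneg mult_nonpos_nonneg mult_left_le zero_less_mult_pos)
        hence "K * (1 + \<bar>w u\<bar>) \<le> K * (2 * w u)" using K by (intro mult_left_mono) auto
        hence "w' u - 2 * K * w u \<le> 0" using w'_le[OF u'] by simp
        thus "(w' u - 2 * K * w u) * exp (- 2 * K * u) \<le> 0" by (intro mult_nonpos_nonneg) auto
      next
        have "w r1 = - (r1 * s' r1)" by (simp add: w_def s'_def)
        hence "w r1 \<le> \<bar>r1 * s' r1\<bar>" by linarith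
        also have "\<dots> \<le> 1 * sqrt (D r1)" unfolding abs_mult using s'_le[of r1] r1 r0 by (intro mult_mono) auto
        finally have "w r1 \<le> M" by (simp add: M_def)
        moreover have "exp (- 2 * K * r1) \<le> 1" using K r1 r0 by simp
        ultimately show "w r1 * exp (- 2 * K * r1) \<le> M" using M1
          by (smt (verit) exp_ge_zero mult_left_le mult_nonpos_nonneg)
      qed (use x in auto)
      hence "w x \<le> M * exp (2 * K * x)" by (simp add: exp_minus field_simps)
      also have "\<dots> \<le> M * exp (2 * K)" using M1 K x by (intro mult_left_mono) (auto intro: mult_left_le)
      finally show ?thesis .
    qed
    have inc: "s r + V * r \<le> s r' + V * r'" if r': "r \<le> r'" "r' < 1" for r'
    proof (rule DERIV_nonneg_imp_nondecreasing[OF r'(1), of "\<lambda>r. s r + V * r"])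
      fix x assume x: "r \<le> x" "x \<le> r'"
      hence x': "x \<in> {r1..<1}" using r r' by auto
      have x01: "1/2 \<le> x" "x < 1" using x' r1 r0 by auto
      have "- s' x = w x / x" using x01 by (simp add: w_def s'_def)
      also have "\<dots> \<le> M * exp (2 * K) / x" using w_le[OF x'] x01 by (intro divide_right_mono) auto
      also have "\<dots> \<le> M * exp (2 * K) / (1/2)" using x01 M1 by (intro divide_left_mono) auto
      finally have "s' x + V \<ge> 0" by (simp add: V_def)
      moreover have "((\<lambda>r. s r + V * r) has_real_derivative s' x + V) (at x)"
        using ds[OF x'] by (auto intro!: derivative_eq_intros)
      ultimately show "\<exists>y. ((\<lambda>r. s r + V * r) has_real_derivative y) (at x) \<and> 0 \<le> y" by blast
    qed
    have lim: "((\<lambda>r'. s r' + V * r') \<longlongrightarrow> sqrt (0 + \<delta>) + V * 1) (at_left 1)"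
      unfolding s_def by (intro tendsto_intros E_lim)
    have "\<forall>\<^sub>F r' in at_left 1. s r + V * r \<le> s r' + V * r'"
      unfolding eventually_at_left_field using r inc by (intro exI[of _ r]) auto
    from tendsto_lowerbound[OF lim this] have "s r + V * r \<le> sqrt \<delta> + V" by simp
    thus ?thesis using Es[OF r] by (simp add: algebra_simps)
  qed
  have "E r \<le> V\<^sup>2 * (1 - r)\<^sup>2" if r: "r \<in> {r1..<1}" for r
  proof -
    have "sqrt (E r) \<le> 0 + V * (1 - r)"
    proof (rule tendsto_lowerbound)
      show "((\<lambda>\<delta>. sqrt \<delta> + V * (1 - r)) \<longlongrightarrow> 0 + V * (1 - r)) (at_right 0)"
        by (intro tendsto_intros) (auto intro!: tendsto_eq_intros)
      show "\<forall>\<^sub>F \<delta> in at_right 0. sqrt (E r) \<le> sqrt \<delta> + V * (1 - r)"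
        unfolding eventually_at_right_field using main[OF r] by (intro exI[of _ 1]) auto
    qed simp
    hence "(sqrt (E r))\<^sup>2 \<le> (V * (1 - r))\<^sup>2" using nonneg(1)[of r] r r1 by (intro power_mono) auto
    thus ?thesis using nonneg(1)[of r] r r1 by (simp add: power_mult_distrib)
  qed
  with V r1 E1 show ?thesis by blast
qed

text \<open>If D stayed above M near r = 1, then (r E')' \<ge> m there. Since E tends to 0,
  integrating twice from the boundary gives E \<ge> (m / 2)(1 - r)^2, which contradicts the decay E
  \<le> V^2 (1 - r)^2. The argument by contradiction yields radii arbitrarily close to 1, not all of
  them.\<close>

lemma energy_bounded_along_sequence: "\<exists>M. \<forall>r2<1. \<exists>r. r2 < r \<and> r0 < r \<and> r < 1 \<and> D r \<le> M"
proof -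
  obtain V r1 where V: "0 \<le> V" "r0 < r1" "r1 < 1" and
    E: "\<And>r. r \<in> {r1..<1} \<Longrightarrow> E r \<le> V\<^sup>2 * (1 - r)\<^sup>2" "\<And>r. r \<in> {r1..<1} \<Longrightarrow> E r \<le> 1"
    using E_quadratic_decay by blast
  \<comment> \<open>Chosen so that m / 2 > V^2; \<open>M\<close> makes D / 2 - C - C^2 / 2 at least
    m, after C sqrt D has been absorbed into D / 2 + C^2 / 2.\<close>
  define m where "m = 2 * V\<^sup>2 + 1"
  define M where "M = 2 * (m + C + C\<^sup>2 / 2)"
  have m: "m > 0" by (simp add: m_def add_nonneg_pos)
  show ?thesis
  proof (rule exI[of _ M], intro allI impI, rule ccontr)
    fix r2 :: real assume r2: "r2 < 1" and no: "\<nexists>r. r2 < r \<and> r0 < r \<and> r < 1 \<and> D r \<le> M"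
    define r3 where "r3 = (max r1 r2 + 1) / 2"
    have r3: "r1 < r3" "r2 < r3" "r3 < 1" "1/2 \<le> r3" using r2 V r0 by (auto simp: r3_def field_simps)
    have D: "D r > M" if "r \<in> {r3..<1}" for r using no that r3 V by force
    have in0: "x \<in> {r0<..<1}" "x \<in> {r1..<1}" if "x \<in> {r3..<1}" for x using that r3 V by auto
    define P where "P r = r * E' r" for r
    have P': "2 * x * (D x + J x) \<ge> m" if x: "x \<in> {r3..<1}" for x
    proof -
      define d s where "d = sqrt (D x)" and "s = sqrt (E x)"
      have dd: "D x = d * d" "d \<ge> 0" using nonneg(2)[OF in0(1)[OF x]] by (auto simp: d_def)
      have s: "0 \<le> s" "s \<le> 1" using nonneg(1)[OF in0(1)[OF x]] E(2)[OF in0(2)[OF x]] by (auto simp: s_def)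
      have "- J x \<le> C * s * (1 + d)" using J_le[OF in0(1)[OF x]] by (simp add: d_def s_def)
      also have "\<dots> \<le> C * 1 * (1 + d)" using s C dd by (intro mult_right_mono mult_left_mono) auto
      also have "C * d \<le> (d * d + C * C) / 2" using sum_squares_bound[of C d] by (simp add: power2_eq_square algebra_simps)
      hence "C * 1 * (1 + d) \<le> C + (d * d + C * C) / 2" by (simp add: algebra_simps)
      finally have "D x + J x \<ge> d * d / 2 - C - C\<^sup>2 / 2" by (simp add: dd power2_eq_square field_simps)
      moreover have "d * d / 2 - C - C\<^sup>2 / 2 \<ge> m" using D[OF x] by (simp add: dd M_def)
      ultimately have "D x + J x \<ge> m" by simp
      moreover have "1 \<le> 2 * x" using x r3 by auto
      ultimately show ?thesis using m mult_mono[of 1 "2 * x" m "D x + J x"] by simp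
    qed
    have Pinc: "P a - m * a \<le> P b - m * b" if ab: "r3 \<le> a" "a \<le> b" "b < 1" for a b
    proof (rule DERIV_nonneg_imp_nondecreasing[OF ab(2), of "\<lambda>r. P r - m * r"])
      fix x assume "a \<le> x" "x \<le> b"
      hence x: "x \<in> {r3..<1}" using ab by auto
      have "((\<lambda>r. P r - m * r) has_real_derivative 2 * x * (D x + J x) - m) (at x)"
        unfolding P_def using DERIV_diff[OF dP[OF in0(1)[OF x]] DERIV_cmult[OF DERIV_ident]] by simp
      thus "\<exists>y. ((\<lambda>r. P r - m * r) has_real_derivative y) (at x) \<and> 0 \<le> y" using P'[OF x] by force
    qed
    \<comment> \<open>Were P positive at a, it would stay at least as large, E would grow at least
      linearly from there on and could not tend to 0.\<close>
    have Pneg: "P a \<le> 0" if a: "a \<in> {r3..<1}" for a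
    proof (rule ccontr)
      assume Pa: "\<not> P a \<le> 0"
      have inc: "E a - P a * a \<le> E b - P a * b" if ab: "a \<le> b" "b < 1" for b
      proof (rule DERIV_nonneg_imp_nondecreasing[OF ab(1), of "\<lambda>r. E r - P a * r"])
        fix x assume x: "a \<le> x" "x \<le> b"
        hence x': "x \<in> {r3..<1}" using a ab by auto
        have "m * a \<le> m * x" using x m by (intro mult_left_mono) auto
        hence "P a \<le> P x" using Pinc[of a x] x a ab by auto
        also have "P x = x * E' x" by (simp add: P_def)
        finally have 1: "P a \<le> x * E' x" .
        have x0: "0 < x" "x < 1" using x' r3 by auto
        have "0 < x * E' x" using 1 Pa by simp
        hence "E' x > 0" using x0 by (simp add: zero_less_mult_iff)
        hence "x * E' x \<le> E' x" using x0 by (simp add: mult_le_cancel_right1)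
        hence "P a \<le> E' x" using 1 by simp
        moreover have "((\<lambda>r. E r - P a * r) has_real_derivative E' x - P a) (at x)"
          using dE[OF in0(1)[OF x']] by (auto intro!: derivative_eq_intros)
        ultimately show "\<exists>y. ((\<lambda>r. E r - P a * r) has_real_derivative y) (at x) \<and> 0 \<le> y" by force
      qed
      have lim: "((\<lambda>b. E b - P a * b) \<longlongrightarrow> 0 - P a * 1) (at_left 1)" by (intro tendsto_intros E_lim)
      have "\<forall>\<^sub>F b in at_left 1. E a - P a * a \<le> E b - P a * b"
        unfolding eventually_at_left_field using a inc by (intro exI[of _ a]) auto
      from tendsto_lowerbound[OF lim this] have "E a + P a * (1 - a) \<le> 0" by (simp add: algebra_simps)
      moreover have "P a * (1 - a) > 0" using Pa a by auto
      ultimately show False using nonneg(1)[OF in0(1)[OF a]] by simp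
    qed
    have Pm: "P a \<le> - m * (1 - a)" if a: "a \<in> {r3..<1}" for a
    proof -
      have lim: "((\<lambda>b. P a - m * a + m * b) \<longlongrightarrow> P a - m * a + m * 1) (at_left 1)" by (intro tendsto_intros)
      have "P a - m * a + m * b \<le> 0" if "a \<le> b" "b < 1" for b
        using Pinc[of a b] Pneg[of b] that a by auto
      hence "\<forall>\<^sub>F b in at_left 1. P a - m * a + m * b \<le> 0"
        unfolding eventually_at_left_field using a by (intro exI[of _ a]) auto
      from tendsto_upperbound[OF lim this] show ?thesis by (simp add: algebra_simps)
    qed
    have "E r3 \<ge> m / 2 * (1 - r3)\<^sup>2"
    proof -
      have inc: "m / 2 * (1 - r3)\<^sup>2 - E r3 \<le> m / 2 * (1 - b)\<^sup>2 - E b" if ab: "r3 \<le> b" "b < 1" for b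
      proof (rule DERIV_nonneg_imp_nondecreasing[OF ab(1), of "\<lambda>r. m / 2 * (1 - r)\<^sup>2 - E r"])
        fix x assume x: "r3 \<le> x" "x \<le> b"
        hence x': "x \<in> {r3..<1}" using ab by auto
        have x0: "0 < x" "x < 1" using x' r3 by auto
        have "E' x = P x / x" using x0 by (simp add: P_def)
        also have "\<dots> \<le> P x" using Pneg[OF x'] x0 by (simp add: divide_le_eq mult_le_cancel_left1)
        also have "\<dots> \<le> - m * (1 - x)" by (rule Pm[OF x'])
        finally have "- m * (1 - x) - E' x \<ge> 0" by simp
        moreover have "((\<lambda>r. m / 2 * (1 - r)\<^sup>2 - E r) has_real_derivative - m * (1 - x) - E' x) (at x)"
          using dE[OF in0(1)[OF x']] by (auto intro!: derivative_eq_intros simp: field_simps)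
        ultimately show "\<exists>y. ((\<lambda>r. m / 2 * (1 - r)\<^sup>2 - E r) has_real_derivative y) (at x) \<and> 0 \<le> y" by blast
      qed
      have lim: "((\<lambda>b. m / 2 * (1 - b)\<^sup>2 - E b) \<longlongrightarrow> m / 2 * (1 - 1)\<^sup>2 - 0) (at_left 1)" by (intro tendsto_intros E_lim)
      have "\<forall>\<^sub>F b in at_left 1. m / 2 * (1 - r3)\<^sup>2 - E r3 \<le> m / 2 * (1 - b)\<^sup>2 - E b"
        unfolding eventually_at_left_field using r3 inc by (intro exI[of _ r3]) auto
      from tendsto_lowerbound[OF lim this] show ?thesis by simp
    qed
    moreover have "E r3 \<le> V\<^sup>2 * (1 - r3)\<^sup>2" using E(1)[of r3] r3 by auto
    ultimately have "m / 2 * (1 - r3)\<^sup>2 \<le> V\<^sup>2 * (1 - r3)\<^sup>2" by simp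
    hence "m / 2 \<le> V\<^sup>2" using r3 by (simp add: mult_le_cancel_right)
    thus False by (simp add: m_def)
  qed
qed

end

section \<open>Integrals over circles, Green's formula and weak convergence\<close>

abbreviation circ :: "real \<Rightarrow> real \<Rightarrow> complex" where "circ r \<theta> \<equiv> of_real r * cis \<theta>"

definition annulus :: "real \<Rightarrow> complex set" where "annulus r0 = {z. r0 < norm z \<and> norm z < 1}"

lemma open_annulus: "open (annulus r0)"
proof -
  have "annulus r0 = ball 0 1 - cball 0 r0" by (auto simp: annulus_def)
  thus ?thesis by (simp add: open_Diff)
qed

lemma circ_in_annulus: "0 \<le> r0 \<Longrightarrow> r \<in> {r0<..<1} \<Longrightarrow> circ r \<theta> \<in> annulus r0"
  by (simp add: annulus_def norm_mult)

lemma continuous_on_circ: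
  assumes "0 \<le> r0" "continuous_on (annulus r0) f"
  shows "continuous_on ({r0<..<1} \<times> S) (\<lambda>(r, \<theta>). f (circ r \<theta>))"
    and "r \<in> {r0<..<1} \<Longrightarrow> continuous_on S (\<lambda>\<theta>. f (circ r \<theta>))"
proof -
  show "continuous_on ({r0<..<1} \<times> S) (\<lambda>(r, \<theta>). f (circ r \<theta>))"
    unfolding split_beta
    by (rule continuous_on_compose2[OF assms(2)])
      (use circ_in_annulus[OF assms(1)] in \<open>auto intro!: continuous_intros\<close>)
  show "continuous_on S (\<lambda>\<theta>. f (circ r \<theta>))" if "r \<in> {r0<..<1}"
    by (rule continuous_on_compose2[OF assms(2)])
      (use circ_in_annulus[OF assms(1) that] in \<open>auto intro!: continuous_intros\<close>)
qed

lemma circ_deriv_radius: "((\<lambda>r. circ r \<theta>) has_vector_derivative cis \<theta>) (at r within S)"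
  unfolding has_vector_derivative_def
  by (auto intro!: derivative_eq_intros simp: scaleR_conv_of_real)

lemma circ_deriv_angle: "(circ r has_vector_derivative \<i> * circ r \<theta>) (at \<theta> within S)"
proof -
  have "((\<lambda>w. of_real r * exp (\<i> * w)) has_field_derivative \<i> * circ r \<theta>) (at (of_real \<theta>))"
    by (auto intro!: derivative_eq_intros simp: cis_conv_exp)
  from has_vector_derivative_real_field[OF this] show ?thesis by (simp add: cis_conv_exp)
qed

lemma circle_integral_deriv:
  fixes f fx fy :: "complex \<Rightarrow> real"
  assumes f: "\<And>z. z \<in> annulus r0 \<Longrightarrow> has_partials f (fx z) (fy z) z"
    and c: "continuous_on (annulus r0) fx" "continuous_on (annulus r0) fy" and r0: "0 \<le> r0" and r: "r \<in> {r0<..<1}"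
  shows "((\<lambda>r. integral {0..2*pi} (\<lambda>\<theta>. f (circ r \<theta>))) has_real_derivative
     integral {0..2*pi} (\<lambda>\<theta>. cos \<theta> * fx (circ r \<theta>) + sin \<theta> * fy (circ r \<theta>))) (at r)"
proof -
  have cf: "continuous_on (annulus r0) f" by (rule has_partials_continuous_on[OF f])
  have "((\<lambda>r. integral (cbox 0 (2*pi)) (\<lambda>\<theta>. f (circ r \<theta>))) has_real_derivative
     integral (cbox 0 (2*pi)) (\<lambda>\<theta>. cos \<theta> * fx (circ r \<theta>) + sin \<theta> * fy (circ r \<theta>))) (at r within {r0<..<1})"
  proof (rule leibniz_rule_field_derivative)
    fix x t assume x: "x \<in> {r0<..<1}"
    have "((\<lambda>r. f (circ r t)) has_vector_derivative (Re (cis t) *\<^sub>R fx (circ x t) + Im (cis t) *\<^sub>R fy (circ x t))) (at x within {r0<..<1})"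
      by (rule has_partials_along[OF f[OF circ_in_annulus[OF r0 x]] circ_deriv_radius])
    thus "((\<lambda>r. f (circ r t)) has_real_derivative (cos t * fx (circ x t) + sin t * fy (circ x t))) (at x within {r0<..<1})"
      by (simp add: has_real_derivative_iff_has_vector_derivative)
  next
    fix x assume "x \<in> {r0<..<1}"
    thus "(\<lambda>\<theta>. f (circ x \<theta>)) integrable_on cbox 0 (2*pi)"
      using continuous_on_circ(2)[OF r0 cf] by (simp add: integrable_continuous_real)
  next
    show "continuous_on ({r0<..<1} \<times> cbox 0 (2*pi)) (\<lambda>(x, t). cos t * fx (circ x t) + sin t * fy (circ x t))"
      using continuous_on_circ(1)[OF r0 c(1)] continuous_on_circ(1)[OF r0 c(2)]
      unfolding split_beta by (intro continuous_intros)
  qed (use r in auto)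
  thus ?thesis using r at_within_open[OF r open_greaterThanLessThan] by simp
qed

text \<open>The integral is the circulation of a dx + b dy. Its r-derivative differs from the curl
  integral by the integral of the \<theta>-derivative of \<open>G\<close>, the form evaluated on the
  radial unit vector, and \<open>G\<close> is periodic.\<close>

lemma radial_green:
  fixes a b ax ay bx by' :: "complex \<Rightarrow> real"
  assumes a: "\<And>z. z \<in> annulus r0 \<Longrightarrow> has_partials a (ax z) (ay z) z"
    and b: "\<And>z. z \<in> annulus r0 \<Longrightarrow> has_partials b (bx z) (by' z) z"
    and c: "continuous_on (annulus r0) ax" "continuous_on (annulus r0) ay"
      "continuous_on (annulus r0) bx" "continuous_on (annulus r0) by'" and r0: "0 \<le> r0" and r: "r \<in> {r0<..<1}"
  shows "((\<lambda>r. integral {0..2*pi} (\<lambda>\<theta>. Re (circ r \<theta>) * b (circ r \<theta>) - Im (circ r \<theta>) * a (circ r \<theta>))) has_real_derivative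
     r * integral {0..2*pi} (\<lambda>\<theta>. bx (circ r \<theta>) - ay (circ r \<theta>))) (at r)"
proof -
  have ca: "continuous_on (annulus r0) a" "continuous_on (annulus r0) b"
    by (rule has_partials_continuous_on[OF a] has_partials_continuous_on[OF b]; assumption)+
  define fx where "fx z = b z + Re z * bx z - Im z * ax z" for z
  define fy where "fy z = Re z * by' z - (a z + Im z * ay z)" for z
  have "((\<lambda>r. integral {0..2*pi} (\<lambda>\<theta>. Re (circ r \<theta>) * b (circ r \<theta>) - Im (circ r \<theta>) * a (circ r \<theta>))) has_real_derivative
     integral {0..2*pi} (\<lambda>\<theta>. cos \<theta> * fx (circ r \<theta>) + sin \<theta> * fy (circ r \<theta>))) (at r)"
  proof (rule circle_integral_deriv[OF _ _ _ r0 r])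
    fix z assume z: "z \<in> annulus r0"
    show "has_partials (\<lambda>z. Re z * b z - Im z * a z) (fx z) (fy z) z"
      by (rule has_partials_eq_rhs[OF has_partials_diff[OF has_partials_mult[OF has_partials_Re b[OF z]] has_partials_mult[OF has_partials_Im a[OF z]]]])
        (simp_all add: fx_def fy_def)
  next
    show "continuous_on (annulus r0) fx" "continuous_on (annulus r0) fy"
      unfolding fx_def fy_def by (intro continuous_intros c ca)+
  qed
  moreover have "integral {0..2*pi} (\<lambda>\<theta>. cos \<theta> * fx (circ r \<theta>) + sin \<theta> * fy (circ r \<theta>))
      = r * integral {0..2*pi} (\<lambda>\<theta>. bx (circ r \<theta>) - ay (circ r \<theta>))"
  proof -
    define G where "G \<theta> = cos \<theta> * a (circ r \<theta>) + sin \<theta> * b (circ r \<theta>)" for \<theta>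
    define G' where "G' \<theta> = cos \<theta> * fx (circ r \<theta>) + sin \<theta> * fy (circ r \<theta>) - r * (bx (circ r \<theta>) - ay (circ r \<theta>))" for \<theta>
    have along: "((\<lambda>\<theta>. k (circ r \<theta>)) has_real_derivative (- r * sin \<theta> * kx (circ r \<theta>) + r * cos \<theta> * ky (circ r \<theta>))) (at \<theta> within S)"
      if "\<And>z. z \<in> annulus r0 \<Longrightarrow> has_partials k (kx z) (ky z) z" for k kx ky :: "complex \<Rightarrow> real" and \<theta> S
      using has_partials_along[OF that[OF circ_in_annulus[OF r0 r]] circ_deriv_angle[of r \<theta> S]]
      by (simp add: has_real_derivative_iff_has_vector_derivative)
    have "(G has_real_derivative G' \<theta>) (at \<theta> within {0..2*pi})" for \<theta>
    proof -
      have "(G has_real_derivative ((- sin \<theta>) * a (circ r \<theta>) + (- r * sin \<theta> * ax (circ r \<theta>) + r * cos \<theta> * ay (circ r \<theta>)) * cos \<theta>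
          + (cos \<theta> * b (circ r \<theta>) + (- r * sin \<theta> * bx (circ r \<theta>) + r * cos \<theta> * by' (circ r \<theta>)) * sin \<theta>))) (at \<theta> within {0..2*pi})"
        unfolding G_def by (intro DERIV_add DERIV_mult' [THEN DERIV_cong] along[OF a] along[OF b] DERIV_mult along
            has_field_derivative_at_within[OF DERIV_cos] has_field_derivative_at_within[OF DERIV_sin])
      moreover have "cos \<theta> * cos \<theta> + sin \<theta> * sin \<theta> - 1 = 0"
        using sin_cos_squared_add[of \<theta>] by (simp add: power2_eq_square algebra_simps)
      moreover have "(- sin \<theta>) * a (circ r \<theta>) + (- r * sin \<theta> * ax (circ r \<theta>) + r * cos \<theta> * ay (circ r \<theta>)) * cos \<theta>
          + (cos \<theta> * b (circ r \<theta>) + (- r * sin \<theta> * bx (circ r \<theta>) + r * cos \<theta> * by' (circ r \<theta>)) * sin \<theta>) = G' \<theta>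
          + r * (ay (circ r \<theta>) - bx (circ r \<theta>)) * (cos \<theta> * cos \<theta> + sin \<theta> * sin \<theta> - 1)"
      proof -
        have id: "(- s) * a' + (- r * s * u1 + r * c * u2) * c + (c * b' + (- r * s * v1 + r * c * v2) * s)
           = (c * (b' + (r * c) * v1 - (r * s) * u1) + s * ((r * c) * v2 - (a' + (r * s) * u2)) - r * (v1 - u2))
             + r * (u2 - v1) * (c * c + s * s - 1)" for a' b' c s u1 u2 v1 v2 :: real
          by (simp add: algebra_simps)
        have "Re (circ r \<theta>) = r * cos \<theta>" "Im (circ r \<theta>) = r * sin \<theta>" by auto
        thus ?thesis unfolding G'_def fx_def fy_def by (simp only: id)
      qed
      ultimately show ?thesis by simp
    qed
    hence "(G' has_integral (G (2*pi) - G 0)) {0..2*pi}"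
      by (intro fundamental_theorem_of_calculus) (auto simp: has_real_derivative_iff_has_vector_derivative)
    hence "integral {0..2*pi} G' = 0" by (simp add: G_def integral_unique)
    moreover have cfx: "continuous_on (annulus r0) fx" "continuous_on (annulus r0) fy"
      unfolding fx_def fy_def by (intro continuous_intros c ca)+
    have "integral {0..2*pi} G' = integral {0..2*pi} (\<lambda>\<theta>. cos \<theta> * fx (circ r \<theta>) + sin \<theta> * fy (circ r \<theta>))
       - integral {0..2*pi} (\<lambda>\<theta>. r * (bx (circ r \<theta>) - ay (circ r \<theta>)))"
      unfolding G'_def
      by (intro integral_diff integrable_continuous_real continuous_intros continuous_on_circ(2)[OF r0 _ r] cfx c)
    ultimately show ?thesis by simp
  qed
  ultimately show ?thesis by simp
qed

lemma Cauchy_Schwarz_integral: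
  fixes f k :: "real \<Rightarrow> real"
  assumes "continuous_on {a..b} f" "continuous_on {a..b} k"
  shows "\<bar>integral {a..b} (\<lambda>x. f x * k x)\<bar> \<le> sqrt (integral {a..b} (\<lambda>x. (f x)\<^sup>2)) * sqrt (integral {a..b} (\<lambda>x. (k x)\<^sup>2))"
proof -
  define p x y where "p = integral {a..b} (\<lambda>x. f x * k x)" and "x = integral {a..b} (\<lambda>x. (f x)\<^sup>2)"
    and "y = integral {a..b} (\<lambda>x. (k x)\<^sup>2)"
  have i: "(\<lambda>x. f x * k x) integrable_on {a..b}" "(\<lambda>x. (f x)\<^sup>2) integrable_on {a..b}" "(\<lambda>x. (k x)\<^sup>2) integrable_on {a..b}"
    using assms by (auto intro!: integrable_continuous_real continuous_intros)
  have pos: "0 \<le> s * s * x + 2 * s * t * p + t * t * y" for s t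
  proof -
    have "((\<lambda>u. (s * s) * (f u)\<^sup>2 + (2 * s * t) * (f u * k u) + (t * t) * (k u)\<^sup>2) has_integral
        (s * s * x + 2 * s * t * p + t * t * y)) {a..b}"
      unfolding x_def y_def p_def
      by (intro has_integral_add has_integral_mult_right integrable_integral i)
    moreover have "0 \<le> (s * s) * (f u)\<^sup>2 + (2 * s * t) * (f u * k u) + (t * t) * (k u)\<^sup>2" for u
    proof -
      have "0 \<le> (s * f u + t * k u)\<^sup>2" by simp
      thus ?thesis by (simp add: power2_eq_square algebra_simps)
    qed
    ultimately show ?thesis by (rule has_integral_nonneg)
  qed
  have xy: "x \<ge> 0" "y \<ge> 0" using pos[of 1 0] pos[of 0 1] by auto
  have "p * p \<le> x * y"
  \<comment> \<open>The quadratic form is tested at (-p, x) or (y, -p), according to which of x and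
    y is positive; if both vanish, at (1, 1) and (1, -1).\<close>
  proof (cases "x = 0 \<and> y = 0")
    case True
    thus ?thesis using pos[of 1 1] pos[of 1 "-1"] by simp
  next
    case False
    then consider "x > 0" | "y > 0" using xy by force
    thus ?thesis
    proof cases
      case 1
      have "0 \<le> x * (x * y - p * p)" using pos[of "- p" x] by (simp add: algebra_simps)
      thus ?thesis using 1 by (simp add: zero_le_mult_iff)
    next
      case 2
      have "0 \<le> y * (x * y - p * p)" using pos[of y "- p"] by (simp add: algebra_simps)
      thus ?thesis using 2 by (simp add: zero_le_mult_iff)
    qed
  qed
  hence "sqrt (p * p) \<le> sqrt (x * y)" by (rule real_sqrt_le_mono)
  thus ?thesis by (simp add: real_sqrt_mult p_def x_def y_def)
qed

text \<open>Multiply \<open>\<Delta>\<eta>\<close> by \<open>\<eta>\<close> and integrate over circles: the total angular derivatives drop out.\<close>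

lemma energy_bounded_on_circles:
  fixes \<eta> A B A1 A2 B1 B2 :: "complex \<Rightarrow> complex"
  assumes r0: "1/2 \<le> r0" "r0 < 1" and C: "0 \<le> C"
    and d\<eta>: "\<And>z. z \<in> annulus r0 \<Longrightarrow> has_partials \<eta> (A z) (B z) z"
    and dA: "\<And>z. z \<in> annulus r0 \<Longrightarrow> has_partials A (A1 z) (A2 z) z"
    and dB: "\<And>z. z \<in> annulus r0 \<Longrightarrow> has_partials B (B1 z) (B2 z) z"
    and c: "continuous_on (annulus r0) A1" "continuous_on (annulus r0) A2" "continuous_on (annulus r0) B1" "continuous_on (annulus r0) B2"
    and lap: "\<And>z. z \<in> annulus r0 \<Longrightarrow> norm (A1 z + B2 z) \<le> C * (1 + norm (A z) + norm (B z))"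
    and lim: "\<And>\<epsilon>. \<epsilon> > 0 \<Longrightarrow> \<exists>\<rho><1. \<forall>z. \<rho> < norm z \<and> norm z < 1 \<longrightarrow> norm (\<eta> z) \<le> \<epsilon>"
  shows "\<exists>M. \<forall>r2<1. \<exists>r. r2 < r \<and> r0 < r \<and> r < 1 \<and>
     integral {0..2*pi} (\<lambda>\<theta>. (norm (A (circ r \<theta>)))\<^sup>2 + (norm (B (circ r \<theta>)))\<^sup>2) \<le> M"
proof -
  have r00: "0 \<le> r0" using r0 by simp
  have c\<eta>: "continuous_on (annulus r0) \<eta>" "continuous_on (annulus r0) A" "continuous_on (annulus r0) B"
    by (rule has_partials_continuous_on[OF d\<eta>] has_partials_continuous_on[OF dA] has_partials_continuous_on[OF dB]; assumption)+
  define E where "E r = integral {0..2*pi} (\<lambda>\<theta>. (norm (\<eta> (circ r \<theta>)))\<^sup>2)" for r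
  define E' where "E' r = 2 * integral {0..2*pi} (\<lambda>\<theta>. \<eta> (circ r \<theta>) \<bullet> (cos \<theta> *\<^sub>R A (circ r \<theta>) + sin \<theta> *\<^sub>R B (circ r \<theta>)))" for r
  define D where "D r = integral {0..2*pi} (\<lambda>\<theta>. (norm (A (circ r \<theta>)))\<^sup>2 + (norm (B (circ r \<theta>)))\<^sup>2)" for r
  define J where "J r = integral {0..2*pi} (\<lambda>\<theta>. \<eta> (circ r \<theta>) \<bullet> (A1 (circ r \<theta>) + B2 (circ r \<theta>)))" for r
  have cc: "continuous_on {0..2*pi} (\<lambda>\<theta>. f (circ r \<theta>))" if "continuous_on (annulus r0) f" "r \<in> {r0<..<1}" for f :: "complex \<Rightarrow> complex" and r
    using continuous_on_circ(2)[OF r00 that] .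
  note ccs = cc[OF c\<eta>(1)] cc[OF c\<eta>(2)] cc[OF c\<eta>(3)] cc[OF c(1)] cc[OF c(2)] cc[OF c(3)] cc[OF c(4)]
  have dE: "(E has_real_derivative E' r) (at r)" if r: "r \<in> {r0<..<1}" for r
  proof -
    have "((\<lambda>r. integral {0..2*pi} (\<lambda>\<theta>. \<eta> (circ r \<theta>) \<bullet> \<eta> (circ r \<theta>))) has_real_derivative
       integral {0..2*pi} (\<lambda>\<theta>. cos \<theta> * (A (circ r \<theta>) \<bullet> \<eta> (circ r \<theta>) + \<eta> (circ r \<theta>) \<bullet> A (circ r \<theta>))
         + sin \<theta> * (B (circ r \<theta>) \<bullet> \<eta> (circ r \<theta>) + \<eta> (circ r \<theta>) \<bullet> B (circ r \<theta>)))) (at r)"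
      by (rule circle_integral_deriv[OF has_partials_inner[OF d\<eta> d\<eta>] _ _ r00 r]) (auto intro!: continuous_intros c\<eta>)
    moreover have "(\<lambda>\<theta>. cos \<theta> * (A (circ r \<theta>) \<bullet> \<eta> (circ r \<theta>) + \<eta> (circ r \<theta>) \<bullet> A (circ r \<theta>))
         + sin \<theta> * (B (circ r \<theta>) \<bullet> \<eta> (circ r \<theta>) + \<eta> (circ r \<theta>) \<bullet> B (circ r \<theta>)))
      = (\<lambda>\<theta>. 2 * (\<eta> (circ r \<theta>) \<bullet> (cos \<theta> *\<^sub>R A (circ r \<theta>) + sin \<theta> *\<^sub>R B (circ r \<theta>))))"
      by (auto simp: inner_add_right inner_commute algebra_simps)
    ultimately show ?thesis unfolding E_def E'_def power2_norm_eq_inner by simp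
  qed
  \<comment> \<open>Green's formula for -2 (\<eta> \<bullet> B) dx + 2 (\<eta> \<bullet> A) dy: its
    circulation is r E' and its curl is 2 (|A|^2 + |B|^2 + \<eta> \<bullet> \<Delta>\<eta>).\<close>
  have dP: "((\<lambda>r. r * E' r) has_real_derivative 2 * r * (D r + J r)) (at r)" if r: "r \<in> {r0<..<1}" for r
  proof -
    have "((\<lambda>r. integral {0..2*pi} (\<lambda>\<theta>. Re (circ r \<theta>) * (2 * (\<eta> (circ r \<theta>) \<bullet> A (circ r \<theta>))) - Im (circ r \<theta>) * (- (2 * (\<eta> (circ r \<theta>) \<bullet> B (circ r \<theta>)))))) has_real_derivative
       r * integral {0..2*pi} (\<lambda>\<theta>. 2 * (A (circ r \<theta>) \<bullet> A (circ r \<theta>) + \<eta> (circ r \<theta>) \<bullet> A1 (circ r \<theta>))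
          - (- (2 * (B (circ r \<theta>) \<bullet> B (circ r \<theta>) + \<eta> (circ r \<theta>) \<bullet> B2 (circ r \<theta>)))))) (at r)"
      by (rule radial_green[where ax = "\<lambda>z. - (2 * (A z \<bullet> B z + \<eta> z \<bullet> B1 z))" and by' = "\<lambda>z. 2 * (B z \<bullet> A z + \<eta> z \<bullet> A2 z)", OF _ _ _ _ _ _ r00 r])
        (intro has_partials_minus has_partials_linear[OF bounded_linear_mult_right] has_partials_inner d\<eta> dA dB continuous_intros c c\<eta>; assumption)+
    moreover have "(\<lambda>r. integral {0..2*pi} (\<lambda>\<theta>. Re (circ r \<theta>) * (2 * (\<eta> (circ r \<theta>) \<bullet> A (circ r \<theta>))) - Im (circ r \<theta>) * (- (2 * (\<eta> (circ r \<theta>) \<bullet> B (circ r \<theta>)))))) = (\<lambda>r. r * E' r)"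
      unfolding E'_def integral_mult_right[symmetric] by (simp add: inner_add_right algebra_simps)
    moreover have "integral {0..2*pi} (\<lambda>\<theta>. 2 * (A (circ r \<theta>) \<bullet> A (circ r \<theta>) + \<eta> (circ r \<theta>) \<bullet> A1 (circ r \<theta>))
          - (- (2 * (B (circ r \<theta>) \<bullet> B (circ r \<theta>) + \<eta> (circ r \<theta>) \<bullet> B2 (circ r \<theta>))))) = 2 * (D r + J r)"
    proof -
      have "D r + J r = integral {0..2*pi} (\<lambda>\<theta>. (norm (A (circ r \<theta>)))\<^sup>2 + (norm (B (circ r \<theta>)))\<^sup>2 + \<eta> (circ r \<theta>) \<bullet> (A1 (circ r \<theta>) + B2 (circ r \<theta>)))"
        unfolding D_def J_def
        by (rule integral_add[symmetric]; intro integrable_continuous_real continuous_intros ccs r)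
      hence "2 * (D r + J r) = integral {0..2*pi} (\<lambda>\<theta>. 2 * ((norm (A (circ r \<theta>)))\<^sup>2 + (norm (B (circ r \<theta>)))\<^sup>2 + \<eta> (circ r \<theta>) \<bullet> (A1 (circ r \<theta>) + B2 (circ r \<theta>))))"
        by (simp only: integral_mult_right)
      thus ?thesis by (simp add: power2_norm_eq_inner inner_add_right algebra_simps)
    qed
    ultimately show ?thesis by (simp add: mult.left_commute mult.assoc)
  qed
  have le_D: "integral {0..2*pi} (\<lambda>\<theta>. (norm (V \<theta>))\<^sup>2) \<le> D r"
    if r: "r \<in> {r0<..<1}" and V: "continuous_on {0..2*pi} V" "\<And>\<theta>. (norm (V \<theta>))\<^sup>2 \<le> (norm (A (circ r \<theta>)))\<^sup>2 + (norm (B (circ r \<theta>)))\<^sup>2" for V :: "real \<Rightarrow> complex" and r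
    unfolding D_def by (intro integral_le integrable_continuous_real continuous_intros ccs r V)
  have CS: "\<bar>integral {0..2*pi} (\<lambda>\<theta>. norm (\<eta> (circ r \<theta>)) * norm (V \<theta>))\<bar> \<le> sqrt (E r) * sqrt (D r)"
    if r: "r \<in> {r0<..<1}" and V: "continuous_on {0..2*pi} V" "\<And>\<theta>. (norm (V \<theta>))\<^sup>2 \<le> (norm (A (circ r \<theta>)))\<^sup>2 + (norm (B (circ r \<theta>)))\<^sup>2" for V :: "real \<Rightarrow> complex" and r
  proof -
    have "\<bar>integral {0..2*pi} (\<lambda>\<theta>. norm (\<eta> (circ r \<theta>)) * norm (V \<theta>))\<bar>
        \<le> sqrt (E r) * sqrt (integral {0..2*pi} (\<lambda>\<theta>. (norm (V \<theta>))\<^sup>2))"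
      unfolding E_def by (intro Cauchy_Schwarz_integral continuous_intros ccs r V)
    also have "\<dots> \<le> sqrt (E r) * sqrt (D r)"
      by (intro mult_left_mono real_sqrt_le_mono le_D[OF r V]) (auto simp: E_def intro!: integral_nonneg integrable_continuous_real continuous_intros ccs r)
    finally show ?thesis .
  qed
  have norm_comb: "(norm (cos \<theta> *\<^sub>R a + sin \<theta> *\<^sub>R b))\<^sup>2 \<le> (norm a)\<^sup>2 + (norm b)\<^sup>2" for \<theta> and a b :: complex
  proof -
    have "norm (cos \<theta> *\<^sub>R a + sin \<theta> *\<^sub>R b) \<le> \<bar>cos \<theta>\<bar> * norm a + \<bar>sin \<theta>\<bar> * norm b"
      by (metis norm_scaleR norm_triangle_ineq)
    hence "(norm (cos \<theta> *\<^sub>R a + sin \<theta> *\<^sub>R b))\<^sup>2 \<le> (\<bar>cos \<theta>\<bar> * norm a + \<bar>sin \<theta>\<bar> * norm b)\<^sup>2"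
      by (intro power_mono) auto
    also have "\<dots> + (\<bar>cos \<theta>\<bar> * norm b - \<bar>sin \<theta>\<bar> * norm a)\<^sup>2 = (\<bar>cos \<theta>\<bar>\<^sup>2 + \<bar>sin \<theta>\<bar>\<^sup>2) * ((norm a)\<^sup>2 + (norm b)\<^sup>2)"
    proof -
      have "(x * p + y * q)\<^sup>2 + (x * q - y * p)\<^sup>2 = (x\<^sup>2 + y\<^sup>2) * (p\<^sup>2 + q\<^sup>2)" for x y p q :: real
        by (simp add: power2_eq_square algebra_simps)
      thus ?thesis .
    qed
    hence "(\<bar>cos \<theta>\<bar> * norm a + \<bar>sin \<theta>\<bar> * norm b)\<^sup>2 \<le> (norm a)\<^sup>2 + (norm b)\<^sup>2"
      unfolding power2_abs sin_cos_squared_add2 mult_1 by (metis le_add_same_cancel1 zero_le_power2)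
    finally show ?thesis .
  qed
  \<comment> \<open>The three terms in the bound on \<Delta>\<eta> contribute C sqrt E (3 + 2 sqrt
    D), where sqrt (2 pi) \<le> 3 is used for the constant one; hence 3 C.\<close>
  interpret circle_energy E E' D J "3 * C" r0
  proof
    fix r assume r: "r \<in> {r0<..<1}"
    show "(E has_real_derivative E' r) (at r)" by (rule dE[OF r])
    show "((\<lambda>r. r * E' r) has_real_derivative 2 * r * (D r + J r)) (at r)" by (rule dP[OF r])
    show E0: "0 \<le> E r" "0 \<le> D r" unfolding E_def D_def
      by (intro integral_nonneg integrable_continuous_real continuous_intros ccs r; simp)+
    let ?V = "\<lambda>\<theta>. cos \<theta> *\<^sub>R A (circ r \<theta>) + sin \<theta> *\<^sub>R B (circ r \<theta>)"
    have cV: "continuous_on {0..2*pi} ?V" by (intro continuous_intros ccs r)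
    have "\<bar>integral {0..2*pi} (\<lambda>\<theta>. \<eta> (circ r \<theta>) \<bullet> ?V \<theta>)\<bar> \<le> integral {0..2*pi} (\<lambda>\<theta>. norm (\<eta> (circ r \<theta>)) * norm (?V \<theta>))"
      unfolding real_norm_def[symmetric]
      by (intro integral_norm_bound_integral integrable_continuous_real continuous_intros ccs r cV)
        (simp add: Cauchy_Schwarz_ineq2)
    also have "\<dots> \<le> sqrt (E r) * sqrt (D r)" using CS[OF r cV norm_comb] by simp
    finally show "\<bar>E' r\<bar> \<le> 2 * (sqrt (E r) * sqrt (D r))" by (simp add: E'_def abs_mult)
    have "\<bar>J r\<bar> \<le> integral {0..2*pi} (\<lambda>\<theta>. C * (norm (\<eta> (circ r \<theta>)) * norm (1::complex) + norm (\<eta> (circ r \<theta>)) * norm (A (circ r \<theta>)) + norm (\<eta> (circ r \<theta>)) * norm (B (circ r \<theta>))))"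
      unfolding J_def real_norm_def[symmetric]
    proof (intro integral_norm_bound_integral integrable_continuous_real continuous_intros ccs r)
      fix \<theta>
      let ?z = "circ r \<theta>"
      have "norm (\<eta> ?z \<bullet> (A1 ?z + B2 ?z)) \<le> norm (\<eta> ?z) * norm (A1 ?z + B2 ?z)"
        by (simp add: Cauchy_Schwarz_ineq2)
      also have "\<dots> \<le> norm (\<eta> ?z) * (C * (1 + norm (A ?z) + norm (B ?z)))"
        by (intro mult_left_mono lap circ_in_annulus[OF r00 r]) auto
      finally show "norm (\<eta> ?z \<bullet> (A1 ?z + B2 ?z)) \<le> C * (norm (\<eta> ?z) * norm (1::complex) + norm (\<eta> ?z) * norm (A ?z) + norm (\<eta> ?z) * norm (B ?z))"
        by (simp add: algebra_simps)
    qed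
    also have "\<dots> = C * (integral {0..2*pi} (\<lambda>\<theta>. norm (\<eta> (circ r \<theta>)) * norm (1::complex)) + integral {0..2*pi} (\<lambda>\<theta>. norm (\<eta> (circ r \<theta>)) * norm (A (circ r \<theta>)))
        + integral {0..2*pi} (\<lambda>\<theta>. norm (\<eta> (circ r \<theta>)) * norm (B (circ r \<theta>))))"
      by (subst integral_mult_right, subst integral_add, (intro integrable_continuous_real continuous_intros ccs r)+, subst integral_add,
          (intro integrable_continuous_real continuous_intros ccs r)+) simp
    also have "\<dots> \<le> C * (sqrt (E r) * 3 + sqrt (E r) * sqrt (D r) + sqrt (E r) * sqrt (D r))"
    proof (intro mult_left_mono add_mono C)
      show "integral {0..2*pi} (\<lambda>\<theta>. norm (\<eta> (circ r \<theta>)) * norm (A (circ r \<theta>))) \<le> sqrt (E r) * sqrt (D r)"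
        using CS[OF r ccs(2)[OF r]] by simp
      show "integral {0..2*pi} (\<lambda>\<theta>. norm (\<eta> (circ r \<theta>)) * norm (B (circ r \<theta>))) \<le> sqrt (E r) * sqrt (D r)"
        using CS[OF r ccs(3)[OF r]] by simp
      have "\<bar>integral {0..2*pi} (\<lambda>\<theta>. norm (\<eta> (circ r \<theta>)) * 1)\<bar> \<le> sqrt (E r) * sqrt (integral {0..2*pi} (\<lambda>\<theta>::real. 1\<^sup>2))"
        unfolding E_def by (intro Cauchy_Schwarz_integral continuous_intros ccs r)
      also have "\<dots> = sqrt (E r) * sqrt (2 * pi)" by simp
      also have "sqrt (2 * pi) \<le> sqrt 9" using pi_less_4 by (intro real_sqrt_le_mono) simp
      hence "sqrt (E r) * sqrt (2 * pi) \<le> sqrt (E r) * 3" using E0 by (intro mult_left_mono) auto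
      finally show "integral {0..2*pi} (\<lambda>\<theta>. norm (\<eta> (circ r \<theta>)) * norm (1::complex)) \<le> sqrt (E r) * 3" by simp
    qed
    also have "\<dots> \<le> 3 * C * sqrt (E r) * (1 + sqrt (D r))"
      using C E0 by (simp add: algebra_simps)
    finally show "\<bar>J r\<bar> \<le> 3 * C * sqrt (E r) * (1 + sqrt (D r))" .
  next
    show "(E \<longlongrightarrow> 0) (at_left 1)"
    proof (rule tendstoI)
      fix e :: real assume e: "e > 0"
      \<comment> \<open>With this choice 2 pi d^2 < e, because pi < 4.\<close>
      define d where "d = sqrt (e / 8)"
      have d: "d > 0" "d\<^sup>2 = e / 8" using e by (auto simp: d_def)
      from lim[OF d(1)] obtain \<rho> where \<rho>: "\<rho> < 1" "\<And>z. \<rho> < norm z \<Longrightarrow> norm z < 1 \<Longrightarrow> norm (\<eta> z) \<le> d" by blast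
      have "dist (E r) 0 < e" if r: "max \<rho> r0 < r" "r < 1" for r
      proof -
        have r': "r \<in> {r0<..<1}" "\<rho> < r" using r by auto
        have "norm (E r) \<le> integral {0..2*pi} (\<lambda>\<theta>::real. d\<^sup>2)"
          unfolding E_def
          by (intro integral_norm_bound_integral integrable_continuous_real continuous_intros ccs r')
            (use \<rho>(2)[of "circ r _"] r r' r0 in \<open>simp add: norm_mult power_mono\<close>)
        also have "\<dots> = 2 * pi * (e / 8)" by (simp add: d)
        also have "\<dots> < e" using e pi_less_4 by simp
        finally show ?thesis by simp
      qed
      thus "\<forall>\<^sub>F r in at_left 1. dist (E r) 0 < e"
        unfolding eventually_at_left_field using \<rho>(1) r0 by (intro exI[of _ "max \<rho> r0"]) auto
    qed
  qed (use r0 C in auto)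
  from energy_bounded_along_sequence show ?thesis unfolding D_def .
qed

text \<open>With a polynomial in place of \<open>H0\<close> the derivative can be moved by parts off
  X n, and uniform convergence of X n, end points included, suffices. The L^1 bound M pays for the
  replacement.\<close>

lemma weak_convergence_of_derivatives:
  fixes X X' :: "nat \<Rightarrow> real \<Rightarrow> real" and H :: "nat \<Rightarrow> real \<Rightarrow> 'a::euclidean_space"
  assumes ab: "a \<le> b"
    and dX: "\<And>n x. x \<in> {a..b} \<Longrightarrow> (X n has_real_derivative X' n x) (at x within {a..b})"
    and cX': "\<And>n. continuous_on {a..b} (X' n)"
    and X: "uniform_limit {a..b} X (\<lambda>x. 0) sequentially"
    and M: "\<And>n. integral {a..b} (\<lambda>x. \<bar>X' n x\<bar>) \<le> M"
    and cH: "\<And>n. continuous_on {a..b} (H n)" "continuous_on {a..b} H0"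
    and H: "uniform_limit {a..b} H H0 sequentially"
  shows "(\<lambda>n. integral {a..b} (\<lambda>x. X' n x *\<^sub>R H n x)) \<longlonglongrightarrow> 0"
proof (rule tendstoI)
  fix e :: real assume e: "e > 0"
  have "0 \<le> integral {a..b} (\<lambda>x. \<bar>X' 0 x\<bar>)"
    by (intro integral_nonneg integrable_continuous_real continuous_intros cX') simp
  hence M0: "0 \<le> M" using M[of 0] by linarith
  \<comment> \<open>Passing from H n to H0 and from H0 to the polynomial costs \<epsilon> M each; M
    + 1 avoids division by zero.\<close>
  define \<epsilon> where "\<epsilon> = e / (4 * (M + 1))"
  have \<epsilon>: "\<epsilon> > 0" "2 * \<epsilon> * M < e / 2 \<or> 2 * \<epsilon> * M \<le> e / 2" using e M0 by (auto simp: \<epsilon>_def field_simps)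
  obtain p where p: "polynomial_function p" "\<And>x. x \<in> {a..b} \<Longrightarrow> norm (H0 x - p x) < \<epsilon>"
    using Stone_Weierstrass_polynomial_function[OF compact_Icc cH(2) \<epsilon>(1)] by blast
  obtain p' where p': "polynomial_function p'" "\<And>x. (p has_vector_derivative p' x) (at x)"
    using has_vector_derivative_polynomial_function[OF p(1)] by blast
  have cp: "continuous_on S p" "continuous_on S p'" for S
    using p(1) p'(1) by (auto intro: continuous_on_polymonial_function)
  have parts: "integral {a..b} (\<lambda>x. X' n x *\<^sub>R p x) = X n b *\<^sub>R p b - X n a *\<^sub>R p a - integral {a..b} (\<lambda>x. X n x *\<^sub>R p' x)" for n
  proof -
    have cX: "continuous_on {a..b} (X n)"
      using dX[of _ n] by (meson DERIV_continuous_on)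
    have "((\<lambda>x. X n x *\<^sub>R p' x + X' n x *\<^sub>R p x) has_integral (X n b *\<^sub>R p b - X n a *\<^sub>R p a)) {a..b}"
      by (rule fundamental_theorem_of_calculus[OF ab])
        (rule has_vector_derivative_scaleR[OF dX has_vector_derivative_at_within[OF p'(2)]])
    hence "integral {a..b} (\<lambda>x. X n x *\<^sub>R p' x + X' n x *\<^sub>R p x) = X n b *\<^sub>R p b - X n a *\<^sub>R p a"
      by (rule integral_unique)
    moreover have "integral {a..b} (\<lambda>x. X n x *\<^sub>R p' x + X' n x *\<^sub>R p x)
       = integral {a..b} (\<lambda>x. X n x *\<^sub>R p' x) + integral {a..b} (\<lambda>x. X' n x *\<^sub>R p x)"
      by (intro integral_add integrable_continuous_real continuous_intros cX cp cX')
    ultimately have "integral {a..b} (\<lambda>x. X n x *\<^sub>R p' x) + integral {a..b} (\<lambda>x. X' n x *\<^sub>R p x)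
       = X n b *\<^sub>R p b - X n a *\<^sub>R p a" by simp
    thus ?thesis by (simp add: eq_diff_eq add.commute)
  qed
  have lim0: "(\<lambda>n. integral {a..b} (\<lambda>x. X' n x *\<^sub>R p x)) \<longlonglongrightarrow> 0"
  proof -
    have pt: "(\<lambda>n. X n x) \<longlonglongrightarrow> 0" if "x \<in> {a..b}" for x
      using tendsto_uniform_limitI[OF X that] .
    have bp: "bounded (p' ` {a..b})" using compact_continuous_image[OF cp(2) compact_Icc] compact_imp_bounded by blast
    have "uniform_limit {a..b} (\<lambda>n x. X n x *\<^sub>R p' x) (\<lambda>x. 0 *\<^sub>R p' x) sequentially"
      by (rule bounded_bilinear.bounded_uniform_limit[OF bounded_bilinear_scaleR X uniform_limit_const])
        (use bp in \<open>auto simp: bounded_iff\<close>)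
    hence ul: "uniform_limit (cbox a b) (\<lambda>n x. X n x *\<^sub>R p' x) (\<lambda>x. 0) sequentially" by simp
    have "continuous_on (cbox a b) (\<lambda>x. X n x *\<^sub>R p' x)" for n
      unfolding cbox_interval by (intro continuous_intros cp DERIV_continuous_on[OF dX])
    from uniform_limit_integral_cbox[OF ul this sequentially_bot] obtain I J where
      I: "\<And>n. ((\<lambda>x. X n x *\<^sub>R p' x) has_integral I n) (cbox a b)"
      "((\<lambda>x. 0::'a) has_integral J) (cbox a b)" "I \<longlonglongrightarrow> J" by blast
    have "J = 0" using I(2) by (simp add: has_integral_0_eq)
    hence "(\<lambda>n. integral {a..b} (\<lambda>x. X n x *\<^sub>R p' x)) \<longlonglongrightarrow> 0"
      using I(1)[THEN integral_unique] I(3) by simp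
    hence "(\<lambda>n. X n b *\<^sub>R p b - X n a *\<^sub>R p a - integral {a..b} (\<lambda>x. X n x *\<^sub>R p' x)) \<longlonglongrightarrow> 0 *\<^sub>R p b - 0 *\<^sub>R p a - 0"
      using ab by (intro tendsto_intros pt) auto
    thus ?thesis by (simp add: parts)
  qed
  have "\<forall>\<^sub>F n in sequentially. \<forall>x\<in>{a..b}. dist (H n x) (H0 x) < \<epsilon>"
    using H \<epsilon>(1) unfolding uniform_limit_iff by blast
  moreover have "\<forall>\<^sub>F n in sequentially. dist (integral {a..b} (\<lambda>x. X' n x *\<^sub>R p x)) 0 < e / 2"
    using lim0 e by (intro tendstoD) auto
  ultimately show "\<forall>\<^sub>F n in sequentially. dist (integral {a..b} (\<lambda>x. X' n x *\<^sub>R H n x)) 0 < e"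
  proof eventually_elim
    case (elim n)
    have "integral {a..b} (\<lambda>x. X' n x *\<^sub>R H n x) - integral {a..b} (\<lambda>x. X' n x *\<^sub>R p x)
        = integral {a..b} (\<lambda>x. X' n x *\<^sub>R H n x - X' n x *\<^sub>R p x)"
      by (intro integral_diff[symmetric] integrable_continuous_real continuous_intros cX' cH cp)
    also have "norm \<dots> \<le> integral {a..b} (\<lambda>x. \<bar>X' n x\<bar> * (2 * \<epsilon>))"
    proof (intro integral_norm_bound_integral integrable_continuous_real continuous_intros cX' cH cp)
      fix x assume x: "x \<in> {a..b}"
      have "norm (H n x - p x) \<le> norm (H n x - H0 x) + norm (H0 x - p x)"
        using norm_triangle_ineq[of "H n x - H0 x" "H0 x - p x"] by simp
      hence "norm (H n x - p x) \<le> 2 * \<epsilon>" using elim(1) p(2) x by (force simp: dist_norm)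
      thus "norm (X' n x *\<^sub>R H n x - X' n x *\<^sub>R p x) \<le> \<bar>X' n x\<bar> * (2 * \<epsilon>)"
        unfolding scaleR_diff_right[symmetric] norm_scaleR by (intro mult_left_mono) auto
    qed
    also have "\<dots> \<le> M * (2 * \<epsilon>)" using M[of n] \<epsilon> by simp
    also have "\<dots> \<le> e / 2" using \<epsilon>(2) by (auto simp: algebra_simps)
    finally have "norm (integral {a..b} (\<lambda>x. X' n x *\<^sub>R H n x) - integral {a..b} (\<lambda>x. X' n x *\<^sub>R p x)) \<le> e / 2" .
    thus ?case using elim(2)
      norm_triangle_ineq[of "integral {a..b} (\<lambda>x. X' n x *\<^sub>R H n x) - integral {a..b} (\<lambda>x. X' n x *\<^sub>R p x)" "integral {a..b} (\<lambda>x. X' n x *\<^sub>R p x)"]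
      by simp
  qed
qed

subsection \<open>The equality case of Wirtinger's inequality\<close>

lemma sin_over_tendsto: "((\<lambda>x::real. (x - c) / sin (x - c)) \<longlongrightarrow> 1) (at c)"
proof -
  have "((\<lambda>x::real. sin (x - c)) has_real_derivative 1) (at c)"
    by (auto intro!: derivative_eq_intros)
  hence "((\<lambda>x. (sin (x - c) - sin (c - c)) / (x - c)) \<longlongrightarrow> 1) (at c)"
    unfolding has_field_derivative_iff .
  from tendsto_inverse[OF this] show ?thesis by simp
qed

text \<open>The simple pole of cot is cancelled by the zero of f^2, of order at least two. It serves
  for c = a and c = a + pi, where the two shifts of cot agree.\<close>

lemma continuous_square_cot:
  fixes f :: "real \<Rightarrow> real"
  assumes f: "(f has_real_derivative d) (at c)" "f c = 0" and c: "\<And>x. cot (x - a) = cot (x - c)"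
  shows "isCont (\<lambda>x. (f x)\<^sup>2 * cot (x - a)) c"
proof -
  have "((\<lambda>x. (f x - f c) / (x - c)) \<longlongrightarrow> d) (at c)"
    using f(1) unfolding has_field_derivative_iff .
  hence "((\<lambda>x. f x * ((f x - f c) / (x - c)) * ((x - c) / sin (x - c)) * cos (x - c)) \<longlongrightarrow> f c * d * 1 * cos (c - c)) (at c)"
    by (intro tendsto_mult sin_over_tendsto isCont_tendsto_compose[OF isCont_cos]
        DERIV_isCont[OF f(1), unfolded isCont_def] tendsto_intros)
  moreover have "\<forall>\<^sub>F x in at c. f x * ((f x - f c) / (x - c)) * ((x - c) / sin (x - c)) * cos (x - c) = (f x)\<^sup>2 * cot (x - a)"
    unfolding eventually_at_filter c by (simp add: cot_def f(2) power2_eq_square)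
  ultimately have "((\<lambda>x. (f x)\<^sup>2 * cot (x - a)) \<longlongrightarrow> 0) (at c)"
    using f(2) by (simp add: Lim_transform_eventually)
  thus ?thesis unfolding isCont_def using f(2) by simp
qed

text \<open>Picone's identity f'^2 - f^2 = (f' - f cot)^2 + (f^2 cot)', with cot taken at x - a and
  f^2 cot vanishing at both ends. Equality forces f' = f cot, so f / sin is constant.\<close>

lemma wirtinger_half_period:
  fixes f f' :: "real \<Rightarrow> real"
  assumes df: "\<And>x. (f has_real_derivative f' x) (at x)" and cf': "continuous_on UNIV f'"
    and f0: "f a = 0" "f (a + pi) = 0"
  shows "0 \<le> integral {a..a+pi} (\<lambda>x. (f' x)\<^sup>2 - (f x)\<^sup>2)"
    and "integral {a..a+pi} (\<lambda>x. (f' x)\<^sup>2 - (f x)\<^sup>2) = 0 \<Longrightarrow>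
      \<exists>A. \<forall>x\<in>{a..a+pi}. f x = A * sin (x - a) \<and> f' x = A * cos (x - a)"
proof -
  define k where "k x = (f' x - f x * cot (x - a))\<^sup>2" for x
  have cf: "continuous_on S f" for S using df by (meson DERIV_isCont continuous_at_imp_continuous_on)
  have cf'S: "continuous_on S f'" for S using continuous_on_subset[OF cf'] by blast
  have sinpos: "sin (x - a) > 0" if "x \<in> {a<..<a+pi}" for x using that by (intro sin_gt_zero) auto
  have cotpi: "cot (x - a) = cot (x - (a + pi))" for x
  proof -
    have "sin (x - a) = - sin (x - (a + pi))" "cos (x - a) = - cos (x - (a + pi))"
      using sin_periodic_pi[of "x - (a + pi)"] cos_periodic_pi[of "x - (a + pi)"] by (simp_all add: algebra_simps)
    thus ?thesis unfolding cot_def by (metis minus_divide_divide)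
  qed
  have dG: "((\<lambda>x. (f x)\<^sup>2 * cot (x - a)) has_real_derivative ((f' x)\<^sup>2 - (f x)\<^sup>2) - k x) (at x)" if x: "x \<in> {a<..<a+pi}" for x
  proof -
    have s: "sin (x - a) \<noteq> 0" using sinpos[OF x] by simp
    have c2: "inverse ((sin (x - a))\<^sup>2) = 1 + (cot (x - a))\<^sup>2"
      using s sin_cos_squared_add[of "x - a"] by (simp add: cot_def field_simps)
    have "((\<lambda>x. cot (x - a)) has_real_derivative - inverse ((sin (x - a))\<^sup>2) * 1) (at x)"
      by (rule DERIV_chain2[where f = cot and g = "\<lambda>x. x - a", OF DERIV_cot[OF s]]) (auto intro!: derivative_eq_intros)
    from DERIV_mult[OF DERIV_power[OF df, of 2] this] show ?thesis
      unfolding c2 k_def by (simp add: power2_eq_square algebra_simps)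
  qed
  have cG: "continuous_on {a..a+pi} (\<lambda>x. (f x)\<^sup>2 * cot (x - a))"
  proof (rule continuous_at_imp_continuous_on, rule ballI)
    fix x assume "x \<in> {a..a+pi}"
    then consider "x = a" | "x = a + pi" | "x \<in> {a<..<a+pi}" by force
    thus "isCont (\<lambda>x. (f x)\<^sup>2 * cot (x - a)) x"
    proof cases
      case 1 thus ?thesis using continuous_square_cot[OF df f0(1)] by simp
    next
      case 2 thus ?thesis using continuous_square_cot[OF df f0(2) cotpi] by simp
    next
      case 3 from DERIV_isCont[OF dG[OF this]] show ?thesis .
    qed
  qed
  have "((\<lambda>x. ((f' x)\<^sup>2 - (f x)\<^sup>2) - k x) has_integral ((f (a+pi))\<^sup>2 * cot (a + pi - a) - (f a)\<^sup>2 * cot (a - a))) {a..a+pi}"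
    by (rule fundamental_theorem_of_calculus_interior[OF _ cG])
      (use dG in \<open>auto simp: has_real_derivative_iff_has_vector_derivative[symmetric]\<close>)
  hence 0: "((\<lambda>x. ((f' x)\<^sup>2 - (f x)\<^sup>2) - k x) has_integral 0) {a..a+pi}" using f0 by simp
  have i: "(\<lambda>x. (f' x)\<^sup>2 - (f x)\<^sup>2) integrable_on {a..a+pi}"
    by (intro integrable_continuous_real continuous_intros cf cf'S)
  from has_integral_diff[OF integrable_integral[OF i] 0]
  have ki: "(k has_integral integral {a..a+pi} (\<lambda>x. (f' x)\<^sup>2 - (f x)\<^sup>2)) {a..a+pi}" by simp
  show "0 \<le> integral {a..a+pi} (\<lambda>x. (f' x)\<^sup>2 - (f x)\<^sup>2)"
    by (rule has_integral_nonneg[OF ki]) (simp add: k_def)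
  assume eq: "integral {a..a+pi} (\<lambda>x. (f' x)\<^sup>2 - (f x)\<^sup>2) = 0"
  have kz: "k x = 0" if x: "x \<in> {a<..<a+pi}" for x
  proof -
    \<comment> \<open>\<open>k\<close> is shown continuous only away from the end points, so an
      interior interval around x is used.\<close>
    define s t where "s = (a + x) / 2" and "t = (x + (a + pi)) / 2"
    have st: "a < s" "s < x" "x < t" "t < a + pi" using x by (auto simp: s_def t_def field_simps)
    have ck: "continuous_on {s..t} k"
    proof (rule continuous_at_imp_continuous_on, rule ballI)
      fix u assume "u \<in> {s..t}"
      hence s: "sin (u - a) \<noteq> 0" using sinpos[of u] st by auto
      have "isCont (\<lambda>x. cot (x - a)) u"
        by (rule isCont_o2[where f = "\<lambda>x. x - a" and g = cot, OF _ isCont_cot[OF s]]) auto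
      moreover have "isCont f u" "isCont f' u" using DERIV_isCont[OF df] cf' by (auto simp: continuous_on_eq_continuous_at)
      ultimately show "isCont k u" unfolding k_def using s by (intro continuous_intros) simp_all
    qed
    have "integral {s..t} k \<le> integral {a..a+pi} k"
      by (rule integral_subset_le) (use st ck ki in \<open>auto simp: k_def intro!: integrable_continuous_real has_integral_integrable[OF ki]\<close>)
    hence "integral {s..t} k \<le> 0" using integral_unique[OF ki] eq by simp
    moreover have "0 \<le> integral {s..t} k" by (intro integral_nonneg integrable_continuous_real ck) (simp add: k_def)
    ultimately have "(k has_integral 0) (cbox s t)" using integrable_integral[OF integrable_continuous_real[OF ck]] by simp
    from has_integral_0_cbox_imp_0[OF _ _ this, of x] ck st show ?thesis by (auto simp: k_def)
  qed
  have fc: "f' x * sin (x - a) = f x * cos (x - a)" if x: "x \<in> {a<..<a+pi}" for x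
    using kz[OF x] sinpos[OF x] by (simp add: k_def cot_def field_simps)
  define A where "A = f (a + pi/2)"
  have fA: "f x = A * sin (x - a)" if x: "x \<in> {a<..<a+pi}" for x
  proof -
    have "((\<lambda>x. f x / sin (x - a)) has_real_derivative 0) (at u within {a<..<a+pi})" if u: "u \<in> {a<..<a+pi}" for u
    proof -
      have "((\<lambda>x. f x / sin (x - a)) has_real_derivative (f' u * sin (u - a) - f u * cos (u - a)) / (sin (u - a) * sin (u - a))) (at u within {a<..<a+pi})"
        using sinpos[OF u] by (intro DERIV_divide has_field_derivative_at_within[OF df]) (auto intro!: derivative_eq_intros)
      thus ?thesis using fc[OF u] by simp
    qed
    from has_field_derivative_zero_constant[OF _ this] obtain c where "\<And>u. u \<in> {a<..<a+pi} \<Longrightarrow> f u / sin (u - a) = c"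
      by (auto simp: convex_real_interval)
    from this[OF x] this[of "a + pi/2"] sinpos[OF x] show ?thesis by (simp add: A_def field_simps)
  qed
  have f'A: "f' x = A * cos (x - a)" if x: "x \<in> {a<..<a+pi}" for x
    using fc[OF x] fA[OF x] sinpos[OF x] by (simp add: mult.commute mult.left_commute)
  have "f x = A * sin (x - a)" if "x \<in> {a..a+pi}" for x
    using that fA[of x] f0 by (cases "x = a"; cases "x = a + pi") auto
  moreover have "f' x = A * cos (x - a)" if x: "x \<in> {a..a+pi}" for x
  proof -
    have "f' x - A * cos (x - a) = 0"
    proof (rule continuous_constant_on_closure[of "{a<..<a+pi}" "\<lambda>x. f' x - A * cos (x - a)"])
      show "continuous_on (closure {a<..<a+pi}) (\<lambda>x. f' x - A * cos (x - a))"
        by (intro continuous_intros cf'S)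
      show "x \<in> closure {a<..<a+pi}" using x by simp
    qed (use f'A in auto)
    thus ?thesis by simp
  qed
  ultimately show "\<exists>A. \<forall>x\<in>{a..a+pi}. f x = A * sin (x - a) \<and> f' x = A * cos (x - a)" by blast
qed

lemma integral_periodic_shift:
  fixes f :: "real \<Rightarrow> real"
  assumes c: "continuous_on UNIV f" and p: "\<And>x. f (x + 2 * pi) = f x" and a: "0 \<le> a" "a \<le> 2 * pi"
  shows "integral {a..a + 2*pi} f = integral {0..2*pi} f"
proof -
  have i: "f integrable_on {u..v}" for u v
    by (rule integrable_continuous_real[OF continuous_on_subset[OF c]]) auto
  have "integral {0 + 2*pi..a + 2*pi} f = integral {0..a} (f \<circ> ((+) (2*pi)))"
    by (rule integral_shift_Icc_real[symmetric])
  also have "f \<circ> ((+) (2*pi)) = f" using p by (auto simp: add.commute)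
  finally have "integral {2*pi..a + 2*pi} f = integral {0..a} f" by simp
  moreover have "integral {a..2*pi} f + integral {2*pi..a + 2*pi} f = integral {a..a + 2*pi} f"
    using a by (intro Henstock_Kurzweil_Integration.integral_combine i) auto
  moreover have "integral {0..a} f + integral {a..2*pi} f = integral {0..2*pi} f"
    using a by (intro Henstock_Kurzweil_Integration.integral_combine i) auto
  ultimately show ?thesis by simp
qed

text \<open>After translating \<open>y\<^sub>1\<close> so that it vanishes at two antipodal points, the difference of the two integrals is
  \<open>\<integral> y\<^sub>3'\<^sup>2 + \<integral> (y\<^sub>2' - y\<^sub>1)\<^sup>2 + \<integral> (y\<^sub>1'\<^sup>2 - y\<^sub>1\<^sup>2)\<close>.\<close>

lemma isoperimetric_equality:
  fixes y1 y2 y1' y2' y3' :: "real \<Rightarrow> real"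
  assumes d1: "\<And>x. (y1 has_real_derivative y1' x) (at x)" and d2: "\<And>x. (y2 has_real_derivative y2' x) (at x)"
    and c: "continuous_on UNIV y1'" "continuous_on UNIV y2'" "continuous_on UNIV y3'"
    and p: "\<And>x. y1 (x + 2 * pi) = y1 x" "\<And>x. y2 (x + 2 * pi) = y2 x"
      "\<And>x. y1' (x + 2 * pi) = y1' x" "\<And>x. y2' (x + 2 * pi) = y2' x" "\<And>x. y3' (x + 2 * pi) = y3' x"
    and eq: "integral {0..2*pi} (\<lambda>x. (y1' x)\<^sup>2 + (y2' x)\<^sup>2 + (y3' x)\<^sup>2) = integral {0..2*pi} (\<lambda>x. y1 x * y2' x - y2 x * y1' x)"
  shows "\<exists>A \<alpha>. \<forall>x\<in>{0..2*pi}. y1' x = A * cos (x - \<alpha>) \<and> y2' x = A * sin (x - \<alpha>) \<and> y3' x = 0"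
proof -
  have cy: "continuous_on S y1" "continuous_on S y2" for S
    using d1 d2 by (meson DERIV_isCont continuous_at_imp_continuous_on)+
  have c': "continuous_on S y1'" "continuous_on S y2'" "continuous_on S y3'" for S
    using continuous_on_subset[OF c(1)] continuous_on_subset[OF c(2)] continuous_on_subset[OF c(3)] by blast+
  \<comment> \<open>Intermediate values: y1 (x + pi) - y1 x changes sign over half a period.\<close>
  have "\<exists>\<alpha>. 0 \<le> \<alpha> \<and> \<alpha> \<le> pi \<and> y1 (\<alpha> + pi) = y1 \<alpha>"
  proof -
    define h where "h x = y1 (x + pi) - y1 x" for x
    have ch: "continuous_on {0..pi} h"
      unfolding h_def by (intro continuous_intros cy continuous_on_compose2[OF cy(1)[of UNIV]]) auto
    have "h pi = - h 0" using p(1)[of 0] by (simp add: h_def)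
    hence "(h 0 \<le> 0 \<and> 0 \<le> h pi) \<or> (h pi \<le> 0 \<and> 0 \<le> h 0)" by linarith
    then obtain x where "0 \<le> x" "x \<le> pi" "h x = 0"
      using IVT'[of h 0 0 pi] IVT2'[of h pi 0 0] ch pi_ge_zero by blast
    thus ?thesis by (auto simp: h_def)
  qed
  then obtain \<alpha> where \<alpha>: "0 \<le> \<alpha>" "\<alpha> \<le> pi" "y1 (\<alpha> + pi) = y1 \<alpha>" by blast
  define f where "f x = y1 x - y1 \<alpha>" for x
  have df: "(f has_real_derivative y1' x) (at x)" for x
    unfolding f_def using d1 by (auto intro!: derivative_eq_intros)
  have cf: "continuous_on S f" for S unfolding f_def by (intro continuous_intros cy)
  have f0: "f \<alpha> = 0" "f (\<alpha> + pi) = 0" "f (\<alpha> + pi + pi) = 0" using \<alpha>(3) p(1)[of \<alpha>] by (auto simp: f_def add.assoc)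
  let ?I = "\<lambda>k. integral {\<alpha>..\<alpha> + 2*pi} k"
  have shift: "?I k = integral {0..2*pi} k" if "continuous_on UNIV k" "\<And>x. k (x + 2*pi) = k x" for k :: "real \<Rightarrow> real"
    using integral_periodic_shift[OF that] \<alpha> by simp
  have e1: "?I (\<lambda>x. (y1' x)\<^sup>2 + (y2' x)\<^sup>2 + (y3' x)\<^sup>2) = ?I (\<lambda>x. y1 x * y2' x - y2 x * y1' x)"
    using eq by (subst (1 2) shift) (auto intro!: continuous_intros c cy simp: p)
  \<comment> \<open>The derivative of (y1 - 2 y1 \<alpha>) y2. Adding this null integral turns y1
    y2' - y2 y1' into 2 f y2'.\<close>
  have "((\<lambda>x. y1' x * (y2 x) + y2' x * (y1 x - 2 * y1 \<alpha>)) has_integral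
      ((y1 (\<alpha> + 2*pi) - 2 * y1 \<alpha>) * y2 (\<alpha> + 2*pi) - (y1 \<alpha> - 2 * y1 \<alpha>) * y2 \<alpha>)) {\<alpha>..\<alpha>+2*pi}"
    by (rule fundamental_theorem_of_calculus)
      (auto intro!: derivative_eq_intros has_field_derivative_at_within[OF d1] has_field_derivative_at_within[OF d2]
        simp: has_real_derivative_iff_has_vector_derivative[symmetric])
  hence ibp: "((\<lambda>x. y1' x * y2 x + y2' x * (y1 x - 2 * y1 \<alpha>)) has_integral 0) {\<alpha>..\<alpha>+2*pi}" using p by simp
  have hi: "(k has_integral ?I k) {\<alpha>..\<alpha>+2*pi}" if "continuous_on {\<alpha>..\<alpha>+2*pi} k" for k :: "real \<Rightarrow> real"
    using integrable_integral[OF integrable_continuous_real[OF that]] .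
  define U where "U = ?I (\<lambda>x. (y3' x)\<^sup>2)"
  define V where "V = ?I (\<lambda>x. (y2' x - f x)\<^sup>2)"
  define W where "W = ?I (\<lambda>x. (y1' x)\<^sup>2 - (f x)\<^sup>2)"
  have "((\<lambda>x. ((y3' x)\<^sup>2 + (y2' x - f x)\<^sup>2 + ((y1' x)\<^sup>2 - (f x)\<^sup>2)) + ((y1 x * y2' x - y2 x * y1' x) + (y1' x * y2 x + y2' x * (y1 x - 2 * y1 \<alpha>))))
     has_integral ((U + V + W) + (?I (\<lambda>x. y1 x * y2' x - y2 x * y1' x) + 0))) {\<alpha>..\<alpha>+2*pi}"
    unfolding U_def V_def W_def by (intro has_integral_add hi ibp continuous_intros c' cf cy)
  moreover have "((y3' x)\<^sup>2 + (y2' x - f x)\<^sup>2 + ((y1' x)\<^sup>2 - (f x)\<^sup>2)) + ((y1 x * y2' x - y2 x * y1' x) + (y1' x * y2 x + y2' x * (y1 x - 2 * y1 \<alpha>)))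
      = (y1' x)\<^sup>2 + (y2' x)\<^sup>2 + (y3' x)\<^sup>2" for x
    by (simp add: f_def power2_eq_square algebra_simps)
  ultimately have "((\<lambda>x. (y1' x)\<^sup>2 + (y2' x)\<^sup>2 + (y3' x)\<^sup>2) has_integral ((U + V + W) + ?I (\<lambda>x. y1 x * y2' x - y2 x * y1' x))) {\<alpha>..\<alpha>+2*pi}"
    by (simp only: add_0_right)
  hence UVW: "U + V + W = 0" using e1 by (simp add: integral_unique)
  have U0: "U \<ge> 0" "V \<ge> 0" unfolding U_def V_def
    by (intro integral_nonneg integrable_continuous_real continuous_intros c' cf; simp)+
  define W1 where "W1 = integral {\<alpha>..\<alpha>+pi} (\<lambda>x. (y1' x)\<^sup>2 - (f x)\<^sup>2)"
  define W2 where "W2 = integral {\<alpha>+pi..\<alpha>+pi+pi} (\<lambda>x. (y1' x)\<^sup>2 - (f x)\<^sup>2)"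
  note w1 = wirtinger_half_period[OF df c(1) f0(1,2), folded W1_def]
  note w2 = wirtinger_half_period[OF df c(1) f0(2,3), folded W2_def]
  have "W1 + W2 = W" unfolding W1_def W2_def W_def mult_2 add.assoc[symmetric]
    by (intro Henstock_Kurzweil_Integration.integral_combine integrable_continuous_real continuous_intros c' cf) auto
  hence z: "U = 0" "V = 0" "W1 = 0" "W2 = 0" using UVW U0 w1(1) w2(1) by auto
  obtain A where A: "\<And>x. x \<in> {\<alpha>..\<alpha>+pi} \<Longrightarrow> f x = A * sin (x - \<alpha>) \<and> y1' x = A * cos (x - \<alpha>)"
    using w1(2)[OF z(3)] by blast
  obtain B where B: "\<And>x. x \<in> {\<alpha>+pi..\<alpha>+pi+pi} \<Longrightarrow> f x = B * sin (x - (\<alpha> + pi)) \<and> y1' x = B * cos (x - (\<alpha> + pi))"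
    using w2(2)[OF z(4)] by blast
  \<comment> \<open>Matching y1' at the common end point joins the two half waves into a single
    sine.\<close>
  have BA: "B = - A" using A[of "\<alpha> + pi"] B[of "\<alpha> + pi"] by auto
  have full: "f x = A * sin (x - \<alpha>) \<and> y1' x = A * cos (x - \<alpha>)" if x: "x \<in> {\<alpha>..\<alpha>+2*pi}" for x
  proof (cases "x \<le> \<alpha> + pi")
    case True thus ?thesis using A x by auto
  next
    case False
    have "sin (x - (\<alpha> + pi)) = - sin (x - \<alpha>)" "cos (x - (\<alpha> + pi)) = - cos (x - \<alpha>)"
      using sin_periodic_pi[of "x - (\<alpha> + pi)"] cos_periodic_pi[of "x - (\<alpha> + pi)"] by (simp_all add: algebra_simps)
    thus ?thesis using B[of x] False x BA by auto
  qed
  have zero: "k x = 0" if "continuous_on {\<alpha>..\<alpha>+2*pi} k" "?I (\<lambda>x. (k x)\<^sup>2) = 0" "x \<in> {\<alpha>..\<alpha>+2*pi}" for k :: "real \<Rightarrow> real" and x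
  proof -
    have ck2: "continuous_on {\<alpha>..\<alpha>+2*pi} (\<lambda>x. (k x)\<^sup>2)" by (intro continuous_intros that)
    have "((\<lambda>x. (k x)\<^sup>2) has_integral 0) (cbox \<alpha> (\<alpha>+2*pi))" using hi[OF ck2] that(2) by simp
    from has_integral_0_cbox_imp_0[OF _ _ this, of x] ck2 that(3) pi_gt_zero show ?thesis by (auto simp del: pi_gt_zero)
  qed
  have y3: "y3' x = 0" if "x \<in> {\<alpha>..\<alpha>+2*pi}" for x
    using zero[OF c'(3) _ that] z(1) by (simp add: U_def)
  have y2: "y2' x = f x" if "x \<in> {\<alpha>..\<alpha>+2*pi}" for x
    using zero[of "\<lambda>x. y2' x - f x", OF _ _ that] z(2) by (simp add: V_def continuous_on_diff c' cf)
  have "y1' x = A * cos (x - \<alpha>) \<and> y2' x = A * sin (x - \<alpha>) \<and> y3' x = 0" if x: "x \<in> {0..2*pi}" for x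
  proof (cases "\<alpha> \<le> x")
    case True thus ?thesis using full[of x] y3[of x] y2[of x] x \<alpha> by auto
  next
    case False
    hence x2: "x + 2*pi \<in> {\<alpha>..\<alpha>+2*pi}" using x \<alpha> by auto
    have "cos (x + 2*pi - \<alpha>) = cos (x - \<alpha>)" "sin (x + 2*pi - \<alpha>) = sin (x - \<alpha>)"
      using cos_periodic[of "x - \<alpha>"] sin_periodic[of "x - \<alpha>"] by (simp_all add: algebra_simps)
    thus ?thesis using full[OF x2] y3[OF x2] y2[OF x2] p by auto
  qed
  thus ?thesis by blast
qed

subsection \<open>Boundary values along circles\<close>

definition closed_annulus :: "real \<Rightarrow> complex set" where "closed_annulus r1 = {z. r1 \<le> norm z \<and> norm z \<le> 1}"

lemma compact_closed_annulus: "compact (closed_annulus r1)"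
proof -
  have "closed_annulus r1 = cball 0 1 - ball 0 r1" by (auto simp: closed_annulus_def)
  thus ?thesis by (simp add: compact_diff)
qed

lemma radial_uniform:
  fixes f :: "complex \<Rightarrow> 'a::metric_space"
  assumes f: "continuous_on (closed_annulus r1) f" and r1: "0 \<le> r1" "r1 < 1" and e: "\<epsilon> > 0"
  shows "\<exists>\<rho>. r1 \<le> \<rho> \<and> \<rho> < 1 \<and> (\<forall>r \<theta>. \<rho> < r \<longrightarrow> r \<le> 1 \<longrightarrow> dist (f (circ r \<theta>)) (f (cis \<theta>)) < \<epsilon>)"
proof -
  have "uniformly_continuous_on (closed_annulus r1) f"
    by (rule compact_uniformly_continuous[OF f compact_closed_annulus])
  then obtain d where d: "d > 0" "\<And>x y. x \<in> closed_annulus r1 \<Longrightarrow> y \<in> closed_annulus r1 \<Longrightarrow> dist y x < d \<Longrightarrow> dist (f y) (f x) < \<epsilon>"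
    unfolding uniformly_continuous_on_def using e by meson
  have "dist (f (circ r \<theta>)) (f (cis \<theta>)) < \<epsilon>" if r: "max r1 (1 - d) < r" "r \<le> 1" for r \<theta>
  proof (rule d(2))
    show "cis \<theta> \<in> closed_annulus r1" "circ r \<theta> \<in> closed_annulus r1"
      using r r1 by (auto simp: closed_annulus_def norm_mult)
    have "circ r \<theta> - cis \<theta> = of_real (r - 1) * cis \<theta>" by (simp add: algebra_simps)
    hence "dist (circ r \<theta>) (cis \<theta>) = \<bar>r - 1\<bar>" by (simp add: dist_norm norm_mult del: of_real_diff)
    thus "dist (circ r \<theta>) (cis \<theta>) < d" using r by auto
  qed
  thus ?thesis using r1 d(1) by (intro exI[of _ "max r1 (1 - d)"]) auto
qed

lemma uniform_limit_circ:
  fixes f :: "complex \<Rightarrow> 'a::metric_space"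
  assumes f: "continuous_on (closed_annulus r1) f" and r1: "0 \<le> r1" "r1 < 1"
    and r: "\<And>n. r n < 1" "r \<longlonglongrightarrow> 1"
  shows "uniform_limit S (\<lambda>n \<theta>. f (circ (r n) \<theta>)) (\<lambda>\<theta>. f (cis \<theta>)) sequentially"
  unfolding uniform_limit_iff
proof (intro allI impI)
  fix e :: real assume "e > 0"
  from radial_uniform[OF f r1 this] obtain \<rho> where \<rho>: "\<rho> < 1" "\<And>r \<theta>. \<rho> < r \<Longrightarrow> r \<le> 1 \<Longrightarrow> dist (f (circ r \<theta>)) (f (cis \<theta>)) < e" by blast
  have "\<forall>\<^sub>F n in sequentially. \<rho> < r n" using r(2) \<rho>(1) by (intro order_tendstoD)
  thus "\<forall>\<^sub>F n in sequentially. \<forall>\<theta>\<in>S. dist (f (circ (r n) \<theta>)) (f (cis \<theta>)) < e"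
    by eventually_elim (use \<rho>(2) r(1) less_imp_le in blast)
qed

lemma continuous_on_closed_circ:
  fixes f :: "complex \<Rightarrow> 'a::topological_space"
  assumes f: "continuous_on (closed_annulus r1) f" and "0 \<le> r1" "r1 \<le> r" "r \<le> 1"
  shows "continuous_on S (\<lambda>\<theta>. f (circ r \<theta>))"
  by (rule continuous_on_compose2[OF f])
    (use assms in \<open>auto simp: closed_annulus_def norm_mult intro!: continuous_intros\<close>)

lemma continuous_on_cis_comp:
  fixes f :: "complex \<Rightarrow> 'a::topological_space"
  assumes f: "continuous_on (closed_annulus r1) f" and "r1 \<le> 1"
  shows "continuous_on S (\<lambda>\<theta>. f (cis \<theta>))"
  by (rule continuous_on_compose2[OF f])
    (use assms in \<open>auto simp: closed_annulus_def intro!: continuous_intros\<close>)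

lemma tendsto_integral_uniform:
  fixes f :: "nat \<Rightarrow> real \<Rightarrow> 'a::banach"
  assumes u: "uniform_limit {a..b} f k sequentially" and c: "\<And>n. continuous_on {a..b} (f n)"
  shows "(\<lambda>n. integral {a..b} (f n)) \<longlonglongrightarrow> integral {a..b} k"
proof -
  have "uniform_limit (cbox a b) f k sequentially" "\<And>n. continuous_on (cbox a b) (f n)" using u c by simp_all
  from uniform_limit_integral_cbox[OF this sequentially_bot] obtain I J where
    I: "\<And>n. (f n has_integral I n) (cbox a b)" "(k has_integral J) (cbox a b)" "I \<longlonglongrightarrow> J" by blast
  thus ?thesis using I(1)[THEN integral_unique] I(2)[THEN integral_unique] by simp
qed

text \<open>On the circle dz is \<i> z d\<theta>, which puts the factor z into the numerator of the
  kernel.\<close>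

lemma Cauchy_formula_circ:
  fixes F :: "complex \<Rightarrow> complex"
  assumes F: "F holomorphic_on ball 0 1" and r: "norm w < r" "r < 1"
  shows "((\<lambda>\<theta>. F (circ r \<theta>) * (circ r \<theta> / (circ r \<theta> - w))) has_integral (2 * pi * F w)) {0..2*pi}"
proof -
  have "cball 0 r \<subseteq> ball (0::complex) 1" using r by auto
  hence hol: "F holomorphic_on cball 0 r" by (rule holomorphic_on_subset[OF F])
  have "continuous_on (cball 0 r) F" "F holomorphic_on ball 0 r"
    using holomorphic_on_imp_continuous_on[OF hol] holomorphic_on_subset[OF hol ball_subset_cball] by auto
  hence "((\<lambda>u. F u / (u - w)) has_contour_integral (2 * of_real pi * \<i> * F w)) (circlepath 0 r)"
    using r by (intro Cauchy_integral_circlepath) auto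
  hence "((\<lambda>t. F (0 + of_real r * cis t) / (0 + of_real r * cis t - w) * of_real r * \<i> * cis t) has_integral (2 * of_real pi * \<i> * F w)) {0..2*pi}"
    unfolding circlepath_def by (subst (asm) has_contour_integral_part_circlepath_iff) auto
  from has_integral_mult_right[OF this, of "- \<i>"]
  show ?thesis by (simp add: mult_ac)
qed

text \<open>\<open>h\<close> stands for \<sigma> sqrt (1 - R^2), so both signs form one case.
  Conformality is assumed inside and reaches the circle by continuity.\<close>

locale cmc_cap = cmc_disc +
  fixes R h \<phi> :: real
  assumes R: "0 < R" and h: "R\<^sup>2 + h\<^sup>2 = 1"
    and dX_closed: "z \<in> cball 0 1 \<Longrightarrow> (X has_derivative (\<lambda>v. Re v *\<^sub>R X1 z + Im v *\<^sub>R X2 z)) (at z within cball 0 1)"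
    and cX_closed: "continuous_on (cball 0 1) X1" "continuous_on (cball 0 1) X2"
    and normal_nonzero: "norm z = 1 \<Longrightarrow> cross3 (X1 z) (X2 z) \<noteq> 0"
    and unit_normal_boundary: "cross3 (X1 (cis \<theta>)) (X2 (cis \<theta>)) /\<^sub>R norm (cross3 (X1 (cis \<theta>)) (X2 (cis \<theta>)))
      = vector [R * cos (\<theta> + \<phi>), R * sin (\<theta> + \<phi>), h]"
begin

text \<open>Equalities pass to the closure, but X1 \<noteq> 0 does not: on the circle it comes from
  \<open>normal_nonzero\<close>.\<close>

lemma conf_closed:
  assumes z: "z \<in> cball 0 1"
  shows "X2 z \<bullet> X2 z = X1 z \<bullet> X1 z" "X1 z \<bullet> X2 z = 0" "X1 z \<noteq> 0"
proof -
  have cl: "closure (ball 0 1) = cball (0::complex) 1" by simp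
  have "X2 z \<bullet> X2 z - X1 z \<bullet> X1 z = 0"
    by (rule continuous_constant_on_closure[of "ball 0 1" "\<lambda>z. X2 z \<bullet> X2 z - X1 z \<bullet> X1 z"])
      (use z conf in \<open>auto simp: cl intro!: continuous_intros cX_closed\<close>)
  thus "X2 z \<bullet> X2 z = X1 z \<bullet> X1 z" by simp
  show "X1 z \<bullet> X2 z = 0"
    by (rule continuous_constant_on_closure[of "ball 0 1" "\<lambda>z. X1 z \<bullet> X2 z"])
      (use z conf in \<open>auto simp: cl intro!: continuous_intros cX_closed\<close>)
  show "X1 z \<noteq> 0"
  proof (cases "norm z = 1")
    case True
    thus ?thesis using normal_nonzero[OF True] by auto
  next
    case False
    thus ?thesis using z conf(3)[of z] by auto
  qed
qed

lemma frame_closed: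
  assumes z: "z \<in> cball 0 1"
  shows "cross3 (X1 z) (X2 z) = L z *\<^sub>R nu z" "nu z \<bullet> nu z = 1" "nu z \<bullet> X1 z = 0" "nu z \<bullet> X2 z = 0"
    "cross3 (nu z) (X1 z) = X2 z" "cross3 (nu z) (X2 z) = - X1 z" "X1 z \<bullet> nu z = 0" "X2 z \<bullet> nu z = 0" "L z > 0"
  using conformal_frame[OF conf_closed[OF z]] conf_closed(3)[OF z] unfolding nu_def L_def by auto

lemma nu_boundary: "nu (cis \<theta>) = vector [R * cos (\<theta> + \<phi>), R * sin (\<theta> + \<phi>), h]"
proof -
  have c: "cis \<theta> \<in> cball 0 1" by simp
  have "norm (nu (cis \<theta>)) = 1" using frame_closed(2)[OF c] by (simp add: norm_eq_sqrt_inner)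
  thus ?thesis using unit_normal_boundary[of \<theta>] frame_closed(1,9)[OF c] by simp
qed

lemma continuous_closed:
  "continuous_on (cball 0 1) X" "continuous_on (cball 0 1) L" "continuous_on (cball 0 1) nu"
proof -
  show "continuous_on (cball 0 1) X"
    using dX_closed has_derivative_continuous continuous_on_eq_continuous_within by blast
  show L: "continuous_on (cball 0 1) L"
    unfolding L_def by (intro continuous_intros cX_closed)
  show "continuous_on (cball 0 1) nu"
    unfolding nu_def using frame_closed(9)
    by (intro continuous_on_scaleR continuous_on_inverse L
        bounded_bilinear.continuous_on[OF bounded_bilinear_cross3 cX_closed]) force
qed

lemma closed_annulus_subset: "closed_annulus r1 \<subseteq> cball 0 1"
  by (auto simp: closed_annulus_def)

lemmas continuous_closed_annulus = continuous_closed[THEN continuous_on_subset[OF _ closed_annulus_subset]]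
  cX_closed[THEN continuous_on_subset[OF _ closed_annulus_subset]]

text \<open>The boundary values of \<open>nu\<close> avoid the south pole because R > 0, whatever
  the sign of \<open>h\<close>.\<close>

lemma h_pos: "1 + h > 0"
proof -
  have "h\<^sup>2 < 1" using h R by (smt (verit) zero_less_power)
  thus ?thesis using abs_square_less_1[of h] by auto
qed

lemma height_boundary: "height (cis \<theta>) = 1 + h"
  by (simp add: height_def nu_boundary)

lemma boundary_annulus: "\<exists>r0. 1/2 \<le> r0 \<and> r0 < 1 \<and> (\<forall>z\<in>closed_annulus r0. height z \<ge> (1 + h) / 2)"
proof -
  have "continuous_on (closed_annulus 0) height"
    unfolding height_def by (intro continuous_intros continuous_closed_annulus)
  from radial_uniform[OF this, of "(1 + h) / 2"] obtain \<rho> where \<rho>: "0 \<le> \<rho>" "\<rho> < 1"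
    "\<And>r \<theta>. \<rho> < r \<Longrightarrow> r \<le> 1 \<Longrightarrow> dist (height (circ r \<theta>)) (height (cis \<theta>)) < (1 + h) / 2"
    using h_pos by auto
  define r0 where "r0 = (max \<rho> (1/2) + 1) / 2"
  have r0: "1/2 \<le> r0" "r0 < 1" "\<rho> < r0" using \<rho> by (auto simp: r0_def field_simps)
  have "height z \<ge> (1 + h) / 2" if z: "z \<in> closed_annulus r0" for z
  proof -
    have "z = circ (norm z) (Arg z)" using rcis_cmod_Arg[of z] by (simp add: rcis_def)
    moreover have "dist (height (circ (norm z) (Arg z))) (height (cis (Arg z))) < (1 + h) / 2"
      using z r0 by (intro \<rho>(3)) (auto simp: closed_annulus_def)
    ultimately have "dist (height z) (1 + h) < (1 + h) / 2" using height_boundary by metis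
    hence "1 + h - height z < (1 + h) / 2" unfolding dist_real_def abs_less_iff by simp
    thus ?thesis by (simp add: field_simps)
  qed
  thus ?thesis using r0 by blast
qed

text \<open>The constant c of the overview. Its modulus R / (1 + h) is \<open>rho R\<close> for h
  \<ge> 0 and the inverse of \<open>rho R\<close> for h < 0.\<close>

definition slope :: complex where "slope = of_real (R / (1 + h)) * cis \<phi>"

lemma psi_boundary: "psi (cis \<theta>) = slope * cis \<theta>"
  by (simp add: psi_def stereo_def horizontal_def nu_boundary slope_def complex_eq_iff cos_add sin_add field_simps)

text \<open>The energy estimate is applied to psi - slope z, which vanishes on the circle and has
  the same Laplacian as \<open>psi\<close>.\<close>

lemma energy_bounded:
  "\<exists>r0 M. 1/2 \<le> r0 \<and> r0 < 1 \<and> annulus r0 \<subseteq> chart \<and> closed_annulus r0 \<subseteq> {z. height z > 0} \<and>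
     (\<forall>r2<1. \<exists>r. r2 < r \<and> r0 < r \<and> r < 1 \<and>
      integral {0..2*pi} (\<lambda>\<theta>. (norm (P1 (circ r \<theta>) - slope))\<^sup>2 + (norm (P2 (circ r \<theta>) - \<i> * slope))\<^sup>2) \<le> M)"
proof -
  obtain r0 where r0: "1/2 \<le> r0" "r0 < 1" and hgt: "\<And>z. z \<in> closed_annulus r0 \<Longrightarrow> height z \<ge> (1 + h) / 2"
    using boundary_annulus by blast
  have ann: "annulus r0 \<subseteq> closed_annulus r0" by (auto simp: annulus_def closed_annulus_def)
  have chart: "annulus r0 \<subseteq> chart"
    using hgt h_pos ann by (force simp: chart_def annulus_def closed_annulus_def)
  have pos: "closed_annulus r0 \<subseteq> {z. height z > 0}" using hgt h_pos by force
  obtain P11 P12 where P1: "\<And>z. z \<in> chart \<Longrightarrow> has_partials P1 (P11 z) (P12 z) z"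
    and c1: "continuous_on chart P11" "continuous_on chart P12"
    using C1_P(1) unfolding C1_partials_on_def by blast
  obtain P21 P22 where P2: "\<And>z. z \<in> chart \<Longrightarrow> has_partials P2 (P21 z) (P22 z) z"
    and c2: "continuous_on chart P21" "continuous_on chart P22"
    using C1_P(2) unfolding C1_partials_on_def by blast
  have "bounded (X1 ` cball 0 1)"    by (intro compact_imp_bounded compact_continuous_image[OF cX_closed(1)] compact_cball)
  then obtain K where Kb: "\<forall>x\<in>X1 ` cball 0 1. norm x \<le> K" unfolding bounded_iff ..
  have K: "norm (X1 z) \<le> K" if "z \<in> cball 0 1" for z by (rule bspec[OF Kb imageI[OF that]])
  have K0: "0 \<le> K" by (rule order_trans[OF norm_ge_zero K[of 0]]) simp
  \<comment> \<open>\<open>C0\<close> bounds |X1| / |height| on the annulus; in \<open>C\<close>,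
    passing from the gradient of \<open>psi\<close> to that of the difference costs |slope| in each
    variable.\<close>
  define C0 where "C0 = K / ((1 + h) / 2)"
  have C0: "0 \<le> C0" using K0 h_pos by (simp add: C0_def)
  define C where "C = C0 * (1 + 2 * norm slope)"
  have psi_c: "continuous_on (closed_annulus r0) (\<lambda>z. psi z - slope * z)"
    unfolding psi_def stereo_def
    by (intro continuous_intros bounded_linear.continuous_on[OF bounded_linear_horizontal] continuous_closed_annulus)
      (use pos in \<open>force simp: height_def\<close>)
  have "\<exists>M. \<forall>r2<1. \<exists>r. r2 < r \<and> r0 < r \<and> r < 1 \<and>
      integral {0..2*pi} (\<lambda>\<theta>. (norm (P1 (circ r \<theta>) - slope))\<^sup>2 + (norm (P2 (circ r \<theta>) - \<i> * slope))\<^sup>2) \<le> M"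
  proof (rule energy_bounded_on_circles[where \<eta> = "\<lambda>z. psi z - slope * z" and A = "\<lambda>z. P1 z - slope" and B = "\<lambda>z. P2 z - \<i> * slope"
        and ?A1.0 = P11 and ?A2.0 = P12 and ?B1.0 = P21 and ?B2.0 = P22 and C = C, OF r0])
    show "0 \<le> C" using C0 by (simp add: C_def)
    fix z assume "z \<in> annulus r0"
    hence z: "z \<in> chart" "z \<in> closed_annulus r0" "z \<in> cball 0 1" using chart ann by (auto simp: annulus_def)
    have "has_partials (\<lambda>z. slope * z) (slope * 1) (slope * \<i>) z"
      by (rule has_partials_linear[OF bounded_linear_mult_right has_partials_ident])
    from has_partials_diff[OF dpsi[OF z(1)] this]
    show "has_partials (\<lambda>z. psi z - slope * z) (P1 z - slope) (P2 z - \<i> * slope) z" by (simp add: mult.commute)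
    show "has_partials (\<lambda>z. P1 z - slope) (P11 z) (P12 z) z" "has_partials (\<lambda>z. P2 z - \<i> * slope) (P21 z) (P22 z) z"
      using has_partials_diff[OF P1[OF z(1)] has_partials_const] has_partials_diff[OF P2[OF z(1)] has_partials_const] by auto
    have hz: "\<bar>height z\<bar> \<ge> (1 + h) / 2" using hgt[OF z(2)] by simp
    have "norm (P11 z + P22 z) \<le> norm (X1 z) / \<bar>height z\<bar> * (norm (P1 z) + norm (P2 z))"
      by (rule norm_laplacian_psi_le[OF z(1) P1[OF z(1)] P2[OF z(1)]])
    also have "\<dots> \<le> C0 * (norm (P1 z) + norm (P2 z))"
      unfolding C0_def using hz h_pos K[OF z(3)] K0 by (intro mult_right_mono frac_le) auto
    also have "\<dots> \<le> C0 * ((norm (P1 z - slope) + norm slope) + (norm (P2 z - \<i> * slope) + norm slope))"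
      using norm_triangle_ineq[of "P1 z - slope" slope] norm_triangle_ineq[of "P2 z - \<i> * slope" "\<i> * slope"] C0
      by (intro mult_left_mono add_mono) (auto simp: norm_mult)
    also have "\<dots> \<le> C * (1 + norm (P1 z - slope) + norm (P2 z - \<i> * slope))"
    proof -
      have "(norm (P1 z - slope) + norm slope) + (norm (P2 z - \<i> * slope) + norm slope)
        \<le> (1 + 2 * norm slope) * (1 + norm (P1 z - slope) + norm (P2 z - \<i> * slope))"
        by (simp add: algebra_simps)
      from mult_left_mono[OF this C0] show ?thesis by (simp add: C_def mult.assoc)
    qed
    finally show "norm (P11 z + P22 z) \<le> C * (1 + norm (P1 z - slope) + norm (P2 z - \<i> * slope))" .
  next
    show "continuous_on (annulus r0) P11" "continuous_on (annulus r0) P12" "continuous_on (annulus r0) P21" "continuous_on (annulus r0) P22"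
      using c1 c2 chart continuous_on_subset by blast+
  next
    fix \<epsilon> :: real assume "\<epsilon> > 0"
    from radial_uniform[OF psi_c _ r0(2) this] r0 obtain \<rho> where \<rho>: "\<rho> < 1"
      "\<And>r \<theta>. \<rho> < r \<Longrightarrow> r \<le> 1 \<Longrightarrow> dist (psi (circ r \<theta>) - slope * circ r \<theta>) (psi (cis \<theta>) - slope * cis \<theta>) < \<epsilon>" by auto
    have "norm (psi z - slope * z) \<le> \<epsilon>" if z: "\<rho> < norm z" "norm z < 1" for z
    proof -
      have "z = circ (norm z) (Arg z)" using rcis_cmod_Arg[of z] by (simp add: rcis_def)
      moreover have "dist (psi (circ (norm z) (Arg z)) - slope * circ (norm z) (Arg z)) (psi (cis (Arg z)) - slope * cis (Arg z)) < \<epsilon>"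
        using z by (intro \<rho>(2)) auto
      ultimately have "dist (psi z - slope * z) 0 < \<epsilon>" using psi_boundary[of "Arg z"] by simp
      thus ?thesis by simp
    qed
    thus "\<exists>\<rho><1. \<forall>z. \<rho> < norm z \<and> norm z < 1 \<longrightarrow> norm (psi z - slope * z) \<le> \<epsilon>" using \<rho>(1) by blast
  qed
  thus ?thesis using r0 chart pos by blast
qed

definition nu_theta :: "complex \<Rightarrow> real^3" where "nu_theta z = Re z *\<^sub>R N2 z - Im z *\<^sub>R N1 z"

lemma nu_theta_deriv:
  assumes "0 \<le> r" "r < 1"
  shows "((\<lambda>\<theta>. nu (circ r \<theta>) $ i) has_real_derivative nu_theta (circ r \<theta>) $ i) (at \<theta> within S)"
proof -
  have "circ r \<theta> \<in> ball 0 1" using assms by (simp add: norm_mult)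
  from has_partials_along[OF dnu[OF this] circ_deriv_angle]
  have "((\<lambda>\<theta>. nu (circ r \<theta>)) has_vector_derivative nu_theta (circ r \<theta>)) (at \<theta> within S)"
    by (simp add: nu_theta_def)
  from bounded_linear.has_vector_derivative[OF bounded_linear_vec_nth this]
  show ?thesis by (simp add: has_real_derivative_iff_has_vector_derivative)
qed

text \<open>Converts the energy density into a bound whose integral controls the L^1 norm of the
  angular derivative, through x \<le> 1 + x^2; the outer factor 2 bounds the height.\<close>

lemma norm_nu_theta_le:
  assumes z: "z \<in> chart"
  shows "norm (nu_theta z) \<le> 2 * (2 + 2 * norm slope + ((norm (P1 z - slope))\<^sup>2 + (norm (P2 z - \<i> * slope))\<^sup>2))"
proof -
  have z1: "norm z < 1" using chartD(1)[OF z] by simp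
  have "\<bar>nu z $ 3\<bar> \<le> norm (nu z)" by (rule component_le_norm_cart)
  also have "norm (nu z) = 1" using frame_facts(2)[OF chartD(1)[OF z]] by (simp add: norm_eq_sqrt_inner)
  finally have hz: "\<bar>height z\<bar> \<le> 2" by (simp add: height_def)
  have sq: "x \<le> 1 + x\<^sup>2" for x :: real
  proof -
    have "0 \<le> (x - 1/2)\<^sup>2" by simp
    thus ?thesis by (simp add: power2_eq_square algebra_simps)
  qed
  have "norm (nu_theta z) = \<bar>height z\<bar> * norm ((- Im z) *\<^sub>R P1 z + Re z *\<^sub>R P2 z)"
    using norm_N_combination[OF z, of "- Im z" "Re z"] by (simp add: nu_theta_def)
  also have "\<dots> \<le> 2 * (1 * norm (P1 z) + 1 * norm (P2 z))"
  proof (intro mult_mono hz)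
    have "norm ((- Im z) *\<^sub>R P1 z + Re z *\<^sub>R P2 z) \<le> \<bar>Im z\<bar> * norm (P1 z) + \<bar>Re z\<bar> * norm (P2 z)"
      using norm_triangle_ineq[of "(- Im z) *\<^sub>R P1 z" "Re z *\<^sub>R P2 z"] by simp
    also have "\<dots> \<le> 1 * norm (P1 z) + 1 * norm (P2 z)"
      using z1 abs_Re_le_cmod[of z] abs_Im_le_cmod[of z] by (intro add_mono mult_right_mono) auto
    finally show "norm ((- Im z) *\<^sub>R P1 z + Re z *\<^sub>R P2 z) \<le> 1 * norm (P1 z) + 1 * norm (P2 z)" .
  qed auto
  also have "\<dots> \<le> 2 * ((norm (P1 z - slope) + norm slope) + (norm (P2 z - \<i> * slope) + norm slope))"
    using norm_triangle_ineq[of "P1 z - slope" slope] norm_triangle_ineq[of "P2 z - \<i> * slope" "\<i> * slope"]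
    by (auto simp: norm_mult)
  also have "\<dots> \<le> 2 * (2 + 2 * norm slope + ((norm (P1 z - slope))\<^sup>2 + (norm (P2 z - \<i> * slope))\<^sup>2))"
    using sq[of "norm (P1 z - slope)"] sq[of "norm (P2 z - \<i> * slope)"] by simp
  finally show ?thesis .
qed

text \<open>The derivative of the boundary values of \<open>nu\<close> and, at the same time, their
  cross product with \<open>e3\<close> from the left.\<close>

definition g_theta :: "real \<Rightarrow> real^3" where "g_theta \<theta> = vector [- R * sin (\<theta> + \<phi>), R * cos (\<theta> + \<phi>), 0]"

lemma nu_boundary_deriv:
  "((\<lambda>\<theta>. nu (cis \<theta>) $ i) has_real_derivative g_theta \<theta> $ i) (at \<theta> within S)"
  unfolding nu_boundary g_theta_def using exhaust_3[of i]
  by (auto intro!: derivative_eq_intros)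

lemma norm_g_theta: "\<bar>g_theta \<theta> $ i\<bar> \<le> R"
  using exhaust_3[of i] R by (auto simp: g_theta_def abs_mult mult_left_le)

text \<open>The boundary values of \<open>z\<^sup>2 q\<close>: the tangential derivative of the Gauss map converges weakly along the
  circles of bounded energy, while all other factors converge uniformly.\<close>

definition hopf_boundary :: "real \<Rightarrow> complex" where
  "hopf_boundary \<theta> = - of_real (L (cis \<theta>))
     + 2 * \<i> * cis \<theta> * (of_real (g_theta \<theta> \<bullet> X1 (cis \<theta>)) - \<i> * of_real (g_theta \<theta> \<bullet> X2 (cis \<theta>)))"

lemma cauchy_boundary:
  assumes w: "norm w < 1"
  shows "integral {0..2*pi} (\<lambda>\<theta>. hopf_boundary \<theta> * (cis \<theta> / (cis \<theta> - w))) = 2 * pi * (w\<^sup>2 * q w)"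
proof -
  obtain r0 M where r0: "1/2 \<le> r0" "r0 < 1" and chart: "annulus r0 \<subseteq> chart"
    and M: "\<And>r2. r2 < 1 \<Longrightarrow> \<exists>r. r2 < r \<and> r0 < r \<and> r < 1 \<and>
      integral {0..2*pi} (\<lambda>\<theta>. (norm (P1 (circ r \<theta>) - slope))\<^sup>2 + (norm (P2 (circ r \<theta>) - \<i> * slope))\<^sup>2) \<le> M"
    using energy_bounded by blast
  \<comment> \<open>Larger than |w| as well, so that the kernel has no pole on the closed
    annulus.\<close>
  define r1 where "r1 = (max r0 (norm w) + 1) / 2"
  have r1: "r0 < r1" "norm w < r1" "r1 < 1" "0 \<le> r1" using r0 w by (auto simp: r1_def field_simps)
  have "\<forall>n. \<exists>r. max r1 (1 - 1 / real (Suc n)) < r \<and> r0 < r \<and> r < 1 \<and>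
      integral {0..2*pi} (\<lambda>\<theta>. (norm (P1 (circ r \<theta>) - slope))\<^sup>2 + (norm (P2 (circ r \<theta>) - \<i> * slope))\<^sup>2) \<le> M"
    by (rule allI, rule M) (use r1 in auto)
  from choice[OF this] obtain r where r': "\<And>n. max r1 (1 - 1 / real (Suc n)) < r n \<and> r0 < r n \<and> r n < 1 \<and>
      integral {0..2*pi} (\<lambda>\<theta>. (norm (P1 (circ (r n) \<theta>) - slope))\<^sup>2 + (norm (P2 (circ (r n) \<theta>) - \<i> * slope))\<^sup>2) \<le> M"
    by blast
  have r: "r1 < r n" "1 - 1 / real (Suc n) < r n" "r n < 1"
    "integral {0..2*pi} (\<lambda>\<theta>. (norm (P1 (circ (r n) \<theta>) - slope))\<^sup>2 + (norm (P2 (circ (r n) \<theta>) - \<i> * slope))\<^sup>2) \<le> M" for n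
    using r'[of n] by simp_all
  have r_lim: "r \<longlonglongrightarrow> 1"
  proof (rule tendsto_sandwich)
    show "(\<lambda>n. 1 - 1 / real (Suc n)) \<longlonglongrightarrow> 1"
      using tendsto_diff[OF tendsto_const LIMSEQ_inverse_real_of_nat, of 1] by (simp add: inverse_eq_divide)
    show "(\<lambda>n. 1::real) \<longlonglongrightarrow> 1" by simp
  qed (use r in \<open>auto intro!: always_eventually less_imp_le\<close>)
  have rr: "0 \<le> r n" "r n \<in> {r0<..<1}" "r1 \<le> r n" "r n \<le> 1" for n using r(1)[of n] r(3)[of n] r1 r0 by auto
  define ker where "ker z = z / (z - w)" for z
  \<comment> \<open>\<open>hopf_polar\<close> times the kernel splits into \<open>K0\<close>, free
    of derivatives of \<open>nu\<close>, and the components of the angular derivative multiplied by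
    \<open>H i\<close>; both \<open>K0\<close> and \<open>H i\<close> are continuous up to the
    circle.\<close>
  define K0 where "K0 z = - of_real ((norm z)\<^sup>2 * L z) * ker z" for z
  define H where "H i z = 2 * \<i> * z * (of_real (X1 z $ i) - \<i> * of_real (X2 z $ i)) * ker z" for i z
  have cker: "continuous_on (closed_annulus r1) ker"
    unfolding ker_def by (intro continuous_intros) (use r1 in \<open>auto simp: closed_annulus_def\<close>)
  have cK0: "continuous_on (closed_annulus r1) K0"
    unfolding K0_def by (intro continuous_intros cker continuous_closed_annulus)
  have cH: "continuous_on (closed_annulus r1) (H i)" for i
    unfolding H_def by (intro continuous_intros cker continuous_closed_annulus)
  note circ_c = continuous_on_closed_circ[OF _ r1(4) rr(3,4)]
  note ul = uniform_limit_circ[OF _ r1(4,3) r(3) r_lim]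
  have zb: "circ (r n) \<theta> \<in> ball 0 1" for n \<theta> using rr[of n] by (simp add: norm_mult)
  have zc: "circ (r n) \<theta> \<in> chart" for n \<theta>
    using chart circ_in_annulus[of r0 "r n" \<theta>] rr(2)[of n] r0 by auto
  have cT: "continuous_on S (\<lambda>\<theta>. nu_theta (circ (r n) \<theta>) $ i)" for n S i
  proof -
    have "continuous_on (annulus r0) nu_theta"
      unfolding nu_theta_def
      by (intro continuous_intros continuous_on_subset[OF continuous_N(1)] continuous_on_subset[OF continuous_N(2)])
        (auto simp: annulus_def)
    from continuous_on_circ(2)[OF _ this rr(2)] r0 show ?thesis by (auto intro!: continuous_intros)
  qed
  have cg: "continuous_on S (\<lambda>\<theta>. g_theta \<theta> $ i)" for S i
    using exhaust_3[of i] by (elim disjE; simp add: g_theta_def; intro continuous_intros)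
  have cgv: "continuous_on S g_theta" for S
    using continuous_on_vec_lambda[where f = "\<lambda>i \<theta>. g_theta \<theta> $ i", OF cg, of S] by simp
  have expand: "K0 z + (\<Sum>i\<in>UNIV. (V $ i) *\<^sub>R H i z)
     = (- of_real ((norm z)\<^sup>2 * L z) + 2 * \<i> * z * (of_real (V \<bullet> X1 z) - \<i> * of_real (V \<bullet> X2 z))) * ker z" for V z
    by (simp add: K0_def H_def inner_vec_def sum_3 scaleR_conv_of_real[where 'a = complex] algebra_simps)
  have int_n: "integral {0..2*pi} (\<lambda>\<theta>. K0 (circ (r n) \<theta>)) + (\<Sum>i\<in>UNIV. integral {0..2*pi} (\<lambda>\<theta>. (nu_theta (circ (r n) \<theta>) $ i) *\<^sub>R H i (circ (r n) \<theta>)))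
      = 2 * pi * (w\<^sup>2 * q w)" for n
  proof -
    have "((\<lambda>\<theta>. (circ (r n) \<theta>)\<^sup>2 * q (circ (r n) \<theta>) * (circ (r n) \<theta> / (circ (r n) \<theta> - w))) has_integral (2 * pi * (w\<^sup>2 * q w))) {0..2*pi}"
      by (rule Cauchy_formula_circ[of "\<lambda>z. z\<^sup>2 * q z"])
        (use r1 r(1)[of n] r(3)[of n] in \<open>auto intro!: holomorphic_intros hopf_holomorphic\<close>)
    moreover have "(circ (r n) \<theta>)\<^sup>2 * q (circ (r n) \<theta>) * (circ (r n) \<theta> / (circ (r n) \<theta> - w))
      = K0 (circ (r n) \<theta>) + (\<Sum>i\<in>UNIV. (nu_theta (circ (r n) \<theta>) $ i) *\<^sub>R H i (circ (r n) \<theta>))" for \<theta>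
      unfolding expand ker_def hopf_polar[OF zb] nu_theta_def ..
    ultimately have "integral {0..2*pi} (\<lambda>\<theta>. K0 (circ (r n) \<theta>) + (\<Sum>i\<in>UNIV. (nu_theta (circ (r n) \<theta>) $ i) *\<^sub>R H i (circ (r n) \<theta>))) = 2 * pi * (w\<^sup>2 * q w)"
      by (simp add: integral_unique)
    moreover have "integral {0..2*pi} (\<lambda>\<theta>. K0 (circ (r n) \<theta>) + (\<Sum>i\<in>UNIV. (nu_theta (circ (r n) \<theta>) $ i) *\<^sub>R H i (circ (r n) \<theta>)))
      = integral {0..2*pi} (\<lambda>\<theta>. K0 (circ (r n) \<theta>)) + integral {0..2*pi} (\<lambda>\<theta>. \<Sum>i\<in>UNIV. (nu_theta (circ (r n) \<theta>) $ i) *\<^sub>R H i (circ (r n) \<theta>))"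
      by (intro integral_add integrable_continuous_real continuous_intros circ_c cK0 cH cT)
    moreover have "integral {0..2*pi} (\<lambda>\<theta>. \<Sum>i\<in>UNIV. (nu_theta (circ (r n) \<theta>) $ i) *\<^sub>R H i (circ (r n) \<theta>))
      = (\<Sum>i\<in>UNIV. integral {0..2*pi} (\<lambda>\<theta>. (nu_theta (circ (r n) \<theta>) $ i) *\<^sub>R H i (circ (r n) \<theta>)))"
      by (intro integral_sum integrable_continuous_real continuous_intros circ_c cH cT) auto
    ultimately show ?thesis by simp
  qed
  have lim_K0: "(\<lambda>n. integral {0..2*pi} (\<lambda>\<theta>. K0 (circ (r n) \<theta>))) \<longlonglongrightarrow> integral {0..2*pi} (\<lambda>\<theta>. K0 (cis \<theta>))"
    by (rule tendsto_integral_uniform[OF ul[OF cK0] circ_c[OF cK0]])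
  have lim_H: "(\<lambda>n. integral {0..2*pi} (\<lambda>\<theta>. (nu_theta (circ (r n) \<theta>) $ i) *\<^sub>R H i (circ (r n) \<theta>)))
      \<longlonglongrightarrow> integral {0..2*pi} (\<lambda>\<theta>. (g_theta \<theta> $ i) *\<^sub>R H i (cis \<theta>))" for i
  proof -
    \<comment> \<open>\<open>norm_nu_theta_le\<close> integrated over the circle, plus R (2 pi) for
      \<open>g_theta\<close>.\<close>
    define B where "B = 2 * ((2 + 2 * norm slope) * (2 * pi) + M) + R * (2 * pi)"
    have weak: "(\<lambda>n. integral {0..2*pi} (\<lambda>\<theta>. (nu_theta (circ (r n) \<theta>) $ i - g_theta \<theta> $ i) *\<^sub>R H i (circ (r n) \<theta>))) \<longlonglongrightarrow> 0"
    proof (rule weak_convergence_of_derivatives[where X = "\<lambda>n \<theta>. nu (circ (r n) \<theta>) $ i - nu (cis \<theta>) $ i" and M = B and ?H0.0 = "\<lambda>\<theta>. H i (cis \<theta>)"])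
      show "((\<lambda>\<theta>. nu (circ (r n) \<theta>) $ i - nu (cis \<theta>) $ i) has_real_derivative nu_theta (circ (r n) x) $ i - g_theta x $ i) (at x within {0..2*pi})" for n x
        by (intro DERIV_diff nu_theta_deriv nu_boundary_deriv rr(1) r(3))
      show "continuous_on {0..2*pi} (\<lambda>\<theta>. nu_theta (circ (r n) \<theta>) $ i - g_theta \<theta> $ i)" for n
        by (intro continuous_intros cT cg)
      have cnu: "continuous_on (closed_annulus r1) (\<lambda>z. nu z $ i)" by (intro continuous_intros continuous_closed_annulus)
      have "uniform_limit {0..2*pi} (\<lambda>n \<theta>. nu (circ (r n) \<theta>) $ i - nu (cis \<theta>) $ i) (\<lambda>\<theta>. nu (cis \<theta>) $ i - nu (cis \<theta>) $ i) sequentially"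
        by (rule uniform_limit_minus[OF ul[OF cnu] uniform_limit_const])
      thus "uniform_limit {0..2*pi} (\<lambda>n \<theta>. nu (circ (r n) \<theta>) $ i - nu (cis \<theta>) $ i) (\<lambda>x. 0) sequentially" by simp
      show "integral {0..2*pi} (\<lambda>x. \<bar>nu_theta (circ (r n) x) $ i - g_theta x $ i\<bar>) \<le> B" for n
      proof -
        have cP: "continuous_on {0..2*pi} (\<lambda>\<theta>. P1 (circ (r n) \<theta>))" "continuous_on {0..2*pi} (\<lambda>\<theta>. P2 (circ (r n) \<theta>))"
          using continuous_on_circ(2)[OF _ _ rr(2)] continuous_on_subset[OF C1_partials_on_continuous[OF C1_P(1)] chart]
            continuous_on_subset[OF C1_partials_on_continuous[OF C1_P(2)] chart] r0 by auto
        let ?e = "\<lambda>\<theta>. (norm (P1 (circ (r n) \<theta>) - slope))\<^sup>2 + (norm (P2 (circ (r n) \<theta>) - \<i> * slope))\<^sup>2"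
        have ie: "?e integrable_on {0..2*pi}" by (intro integrable_continuous_real continuous_intros cP)
        have "((\<lambda>\<theta>. 2 * (2 + 2 * norm slope + ?e \<theta>) + R) has_integral (2 * ((2 + 2 * norm slope) * (2 * pi) + integral {0..2*pi} ?e) + R * (2 * pi))) {0..2*pi}"
          using has_integral_const_real[of "2 + 2 * norm slope" 0 "2*pi"] has_integral_const_real[of R 0 "2*pi"]
          by (intro has_integral_add has_integral_mult_right integrable_integral[OF ie]) (simp_all add: mult.commute)
        moreover have "integral {0..2*pi} (\<lambda>x. \<bar>nu_theta (circ (r n) x) $ i - g_theta x $ i\<bar>) \<le> integral {0..2*pi} (\<lambda>\<theta>. 2 * (2 + 2 * norm slope + ?e \<theta>) + R)"
        proof (rule integral_le)
          have "continuous_on {0..2*pi} (\<lambda>\<theta>. nu_theta (circ (r n) \<theta>) $ i - g_theta \<theta> $ i)"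
            by (intro continuous_on_diff cT cg)
          thus "(\<lambda>x. \<bar>nu_theta (circ (r n) x) $ i - g_theta x $ i\<bar>) integrable_on {0..2*pi}"
            by (intro integrable_continuous_real continuous_on_rabs)
          show "(\<lambda>\<theta>. 2 * (2 + 2 * norm slope + ?e \<theta>) + R) integrable_on {0..2*pi}"
            by (intro integrable_continuous_real continuous_intros cP)
          fix x
          have "\<bar>nu_theta (circ (r n) x) $ i\<bar> \<le> norm (nu_theta (circ (r n) x))" by (rule component_le_norm_cart)
          also have "\<dots> \<le> 2 * (2 + 2 * norm slope + ?e x)" by (rule norm_nu_theta_le[OF zc])
          finally show "\<bar>nu_theta (circ (r n) x) $ i - g_theta x $ i\<bar> \<le> 2 * (2 + 2 * norm slope + ?e x) + R"
            using norm_g_theta[of x i] by linarith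
        qed
        ultimately show ?thesis using r(4)[of n] by (simp add: integral_unique B_def)
      qed
    qed (use circ_c[OF cH] ul[OF cH] continuous_on_cis_comp[OF cH] r1 in auto)
    have "uniform_limit {0..2*pi} (\<lambda>n \<theta>. (g_theta \<theta> $ i) *\<^sub>R H i (circ (r n) \<theta>)) (\<lambda>\<theta>. (g_theta \<theta> $ i) *\<^sub>R H i (cis \<theta>)) sequentially"
    proof (rule bounded_bilinear.bounded_uniform_limit[OF bounded_bilinear_scaleR uniform_limit_const ul[OF cH]])
      show "bounded ((\<lambda>\<theta>. H i (cis \<theta>)) ` {0..2*pi})" "bounded ((\<lambda>\<theta>. g_theta \<theta> $ i) ` {0..2*pi})"
        using continuous_on_cis_comp[OF cH] cg r1 by (auto intro!: compact_imp_bounded compact_continuous_image)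
    qed
    from tendsto_integral_uniform[OF this continuous_on_scaleR[OF cg circ_c[OF cH]]]
    have "(\<lambda>n. integral {0..2*pi} (\<lambda>\<theta>. (g_theta \<theta> $ i) *\<^sub>R H i (circ (r n) \<theta>))) \<longlonglongrightarrow> integral {0..2*pi} (\<lambda>\<theta>. (g_theta \<theta> $ i) *\<^sub>R H i (cis \<theta>))" .
    from tendsto_add[OF weak this]
    have "(\<lambda>n. integral {0..2*pi} (\<lambda>\<theta>. (nu_theta (circ (r n) \<theta>) $ i - g_theta \<theta> $ i) *\<^sub>R H i (circ (r n) \<theta>))
        + integral {0..2*pi} (\<lambda>\<theta>. (g_theta \<theta> $ i) *\<^sub>R H i (circ (r n) \<theta>))) \<longlonglongrightarrow> integral {0..2*pi} (\<lambda>\<theta>. (g_theta \<theta> $ i) *\<^sub>R H i (cis \<theta>))" by simp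
    moreover have "integral {0..2*pi} (\<lambda>\<theta>. (nu_theta (circ (r n) \<theta>) $ i - g_theta \<theta> $ i) *\<^sub>R H i (circ (r n) \<theta>))
        + integral {0..2*pi} (\<lambda>\<theta>. (g_theta \<theta> $ i) *\<^sub>R H i (circ (r n) \<theta>))
      = integral {0..2*pi} (\<lambda>\<theta>. (nu_theta (circ (r n) \<theta>) $ i) *\<^sub>R H i (circ (r n) \<theta>))" for n
    proof (subst integral_add[symmetric])
      show "(\<lambda>\<theta>. (nu_theta (circ (r n) \<theta>) $ i - g_theta \<theta> $ i) *\<^sub>R H i (circ (r n) \<theta>)) integrable_on {0..2*pi}"
        "(\<lambda>\<theta>. (g_theta \<theta> $ i) *\<^sub>R H i (circ (r n) \<theta>)) integrable_on {0..2*pi}"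
        by (intro integrable_continuous_real continuous_intros cT cg circ_c cH)+
    qed (simp add: scaleR_diff_left)
    ultimately show ?thesis by simp
  qed
  have "(\<lambda>n. integral {0..2*pi} (\<lambda>\<theta>. K0 (circ (r n) \<theta>)) + (\<Sum>i\<in>UNIV. integral {0..2*pi} (\<lambda>\<theta>. (nu_theta (circ (r n) \<theta>) $ i) *\<^sub>R H i (circ (r n) \<theta>))))
     \<longlonglongrightarrow> integral {0..2*pi} (\<lambda>\<theta>. K0 (cis \<theta>)) + (\<Sum>i\<in>UNIV. integral {0..2*pi} (\<lambda>\<theta>. (g_theta \<theta> $ i) *\<^sub>R H i (cis \<theta>)))"
    by (intro tendsto_add lim_K0 tendsto_sum lim_H)
  hence "2 * pi * (w\<^sup>2 * q w) = integral {0..2*pi} (\<lambda>\<theta>. K0 (cis \<theta>)) + (\<Sum>i\<in>UNIV. integral {0..2*pi} (\<lambda>\<theta>. (g_theta \<theta> $ i) *\<^sub>R H i (cis \<theta>)))"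
    unfolding int_n using LIMSEQ_unique tendsto_const by blast
  also have "\<dots> = integral {0..2*pi} (\<lambda>\<theta>. K0 (cis \<theta>)) + integral {0..2*pi} (\<lambda>\<theta>. \<Sum>i\<in>UNIV. (g_theta \<theta> $ i) *\<^sub>R H i (cis \<theta>))"
    by (subst integral_sum) (use continuous_on_cis_comp[OF cH] cgv r1 in \<open>auto intro!: integrable_continuous_real continuous_intros\<close>)
  also have "\<dots> = integral {0..2*pi} (\<lambda>\<theta>. K0 (cis \<theta>) + (\<Sum>i\<in>UNIV. (g_theta \<theta> $ i) *\<^sub>R H i (cis \<theta>)))"
    by (rule integral_add[symmetric]) (use continuous_on_cis_comp[OF cH] continuous_on_cis_comp[OF cK0] cgv r1 in \<open>auto intro!: integrable_continuous_real continuous_intros\<close>)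
  also have "\<dots> = integral {0..2*pi} (\<lambda>\<theta>. hopf_boundary \<theta> * (cis \<theta> / (cis \<theta> - w)))"
    unfolding expand by (simp add: hopf_boundary_def ker_def)
  finally show ?thesis by simp
qed

end

section \<open>Inverse stereographic projection\<close>

definition istereo :: "complex \<Rightarrow> real^3" where
  "istereo w = vector [2 * Re w / (1 + (norm w)\<^sup>2), 2 * Im w / (1 + (norm w)\<^sup>2), (1 - (norm w)\<^sup>2) / (1 + (norm w)\<^sup>2)]"

lemma one_plus_norm_pos: "1 + (norm (w::complex))\<^sup>2 > 0"
  by (simp add: add_pos_nonneg)

lemma istereo_third: "1 + istereo w $ 3 = 2 / (1 + (norm w)\<^sup>2)" "1 + istereo w $ 3 \<noteq> 0"
proof -
  have *: "1 + (norm w)\<^sup>2 \<noteq> 0" using one_plus_norm_pos[of w] by simp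
  show "1 + istereo w $ 3 = 2 / (1 + (norm w)\<^sup>2)" using * by (simp add: istereo_def field_simps)
  thus "1 + istereo w $ 3 \<noteq> 0" using * by simp
qed

lemma stereo_istereo: "stereo (istereo w) = w"
proof -
  have "1 + (norm w)\<^sup>2 \<noteq> 0" using one_plus_norm_pos[of w] by simp
  thus ?thesis
    unfolding stereo_def istereo_third by (simp add: istereo_def horizontal_def complex_eq_iff del: of_real_divide of_real_inverse)
qed

lemma istereo_stereo:
  fixes n :: "real^3"
  assumes n: "n \<bullet> n = 1" and a: "1 + n $ 3 \<noteq> 0"
  shows "istereo (stereo n) = n"
proof -
  define p s b where "p = Re (stereo n)" and "s = Im (stereo n)" and "b = 1 + n $ 3"
  note c = stereo_coordinates[OF n a, folded p_def s_def b_def]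
  have b: "b \<noteq> 0" using a by (simp add: b_def)
  have nw: "(norm (stereo n))\<^sup>2 = (2 - b) / b"
    unfolding cmod_power2 p_def[symmetric] s_def[symmetric]
    using c(4) b by (simp add: power2_eq_square field_simps)
  have d: "1 + (2 - b) / b = 2 / b" using b by (simp add: field_simps)
  show ?thesis
    unfolding istereo_def nw d p_def[symmetric] s_def[symmetric] vec_eq_iff
    using b c by (auto simp: forall_3 field_simps)
qed

lemma continuous_istereo: "continuous_on S istereo"
proof -
  have "continuous_on S (\<lambda>w. \<chi> i. istereo w $ i)"
  proof (rule continuous_on_vec_lambda)
    fix i :: 3
    have "1 + (norm w)\<^sup>2 \<noteq> 0" for w :: complex using one_plus_norm_pos[of w] by simp
    thus "continuous_on S (\<lambda>w. istereo w $ i)"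
      using exhaust_3[of i] by (elim disjE; simp add: istereo_def; intro continuous_intros; simp)
  qed
  thus ?thesis by simp
qed

context cmc_cap
begin

subsection \<open>Rigidity of the boundary curve\<close>

text \<open>\<open>tang\<close> and \<open>conormal\<close> are X_\<theta> and X_r on the unit
  circle, the tangent of the boundary curve and the outer conormal of the surface.\<close>

definition tang :: "real \<Rightarrow> real^3" where "tang \<theta> = cos \<theta> *\<^sub>R X2 (cis \<theta>) - sin \<theta> *\<^sub>R X1 (cis \<theta>)"
definition conormal :: "real \<Rightarrow> real^3" where "conormal \<theta> = cos \<theta> *\<^sub>R X1 (cis \<theta>) + sin \<theta> *\<^sub>R X2 (cis \<theta>)"

text \<open>The derivative of \<open>X\<close> within the closed disk is enough, as the curve stays
  in it.\<close>

lemma boundary_curve_deriv: "((\<lambda>\<theta>. X (cis \<theta>)) has_vector_derivative tang \<theta>) (at \<theta>)"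
proof -
  have c: "(cis has_derivative (\<lambda>t. t *\<^sub>R (\<i> * cis \<theta>))) (at \<theta> within UNIV)"
    using circ_deriv_angle[of 1 \<theta> UNIV] by (simp add: has_vector_derivative_def)
  have "((\<lambda>\<theta>. X (cis \<theta>)) has_derivative (\<lambda>t. Re (t *\<^sub>R (\<i> * cis \<theta>)) *\<^sub>R X1 (cis \<theta>) + Im (t *\<^sub>R (\<i> * cis \<theta>)) *\<^sub>R X2 (cis \<theta>))) (at \<theta> within UNIV)"
    by (rule has_derivative_in_compose2[OF dX_closed _ _ c]) auto
  thus ?thesis unfolding has_vector_derivative_def tang_def
    by (simp add: algebra_simps)
qed

lemma continuous_boundary:
  "continuous_on S (\<lambda>\<theta>. X (cis \<theta>))" "continuous_on S tang" "continuous_on S conormal"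
proof -
  have c: "continuous_on S (\<lambda>\<theta>. f (cis \<theta>))" if "continuous_on (cball 0 1) f" for f :: "complex \<Rightarrow> real^3"
    by (rule continuous_on_compose2[OF that]) (auto intro!: continuous_intros)
  show "continuous_on S (\<lambda>\<theta>. X (cis \<theta>))" "continuous_on S tang" "continuous_on S conormal"
    unfolding tang_def conormal_def by (intro continuous_intros c continuous_closed cX_closed)+
qed

text \<open>The last identity is the third component of cross3 nu tang = - conormal:
  \<open>g_theta\<close> is the horizontal part of \<open>nu\<close> turned by a right
  angle.\<close>

lemma boundary_frame:
  "tang \<theta> \<bullet> tang \<theta> = L (cis \<theta>)" "tang \<theta> \<bullet> conormal \<theta> = 0" "nu (cis \<theta>) \<bullet> tang \<theta> = 0"
  "g_theta \<theta> \<bullet> tang \<theta> = - conormal \<theta> $ 3"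
proof -
  have z: "cis \<theta> \<in> cball 0 1" by simp
  note cf = conf_closed[OF z] and f = frame_closed[OF z]
  have sc: "sin \<theta> * sin \<theta> + cos \<theta> * cos \<theta> = 1"
    using sin_cos_squared_add[of \<theta>] by (simp add: power2_eq_square)
  have "(c *\<^sub>R X2 (cis \<theta>) - s *\<^sub>R X1 (cis \<theta>)) \<bullet> (c *\<^sub>R X2 (cis \<theta>) - s *\<^sub>R X1 (cis \<theta>)) = (s * s + c * c) * (X1 (cis \<theta>) \<bullet> X1 (cis \<theta>))" for c s
    using cf by (simp add: inner_diff_left inner_diff_right inner_commute[of "X2 (cis \<theta>)" "X1 (cis \<theta>)"] algebra_simps)
  hence "tang \<theta> \<bullet> tang \<theta> = (sin \<theta> * sin \<theta> + cos \<theta> * cos \<theta>) * (X1 (cis \<theta>) \<bullet> X1 (cis \<theta>))"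
    unfolding tang_def .
  thus "tang \<theta> \<bullet> tang \<theta> = L (cis \<theta>)" unfolding sc by (simp add: L_def)
  show "tang \<theta> \<bullet> conormal \<theta> = 0"
    using cf by (simp add: tang_def conormal_def inner_diff_left inner_add_right inner_commute[of "X2 (cis \<theta>)" "X1 (cis \<theta>)"] algebra_simps)
  show "nu (cis \<theta>) \<bullet> tang \<theta> = 0" using f by (simp add: tang_def inner_diff_right)
  have "cross3 (nu (cis \<theta>)) (tang \<theta>) = - conormal \<theta>"
    using f by (simp add: tang_def conormal_def cross_mult_right right_diff_distrib Cross3.right_diff_distrib)
  hence "cross3 (nu (cis \<theta>)) (tang \<theta>) $ 3 = - conormal \<theta> $ 3" by simp
  thus "g_theta \<theta> \<bullet> tang \<theta> = - conormal \<theta> $ 3"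
    by (simp add: nu_boundary cross3_def g_theta_def inner_vec_def sum_3 algebra_simps)
qed

lemma hopf_boundary_frame:
  "hopf_boundary \<theta> = Complex (2 * (g_theta \<theta> \<bullet> tang \<theta>) - L (cis \<theta>)) (2 * (g_theta \<theta> \<bullet> conormal \<theta>))"
  by (simp add: hopf_boundary_def tang_def conormal_def complex_eq_iff inner_diff_right inner_add_right algebra_simps)

text \<open>The flux contains only \<open>X\<close> and its first derivatives, so ordinary uniform
  convergence carries it to the circle.\<close>

lemma boundary_flux:
  "((\<lambda>\<theta>. conormal \<theta> $ 3 + (1/2) * (X (cis \<theta>) $ 1 * tang \<theta> $ 2 - X (cis \<theta>) $ 2 * tang \<theta> $ 1)) has_integral 0) {0..2*pi}"
proof -
  define G where "G z = Re z *\<^sub>R (X1 z + (1/2) *\<^sub>R cross3 (X z) (X2 z)) - Im z *\<^sub>R (- X2 z + (1/2) *\<^sub>R cross3 (X z) (X1 z))" for z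
  have cG: "continuous_on (closed_annulus 0) G"
    unfolding G_def by (intro continuous_intros continuous_closed_annulus bounded_bilinear.continuous_on[OF bounded_bilinear_cross3])
  define r where "r n = 1 - 1 / real (Suc n)" for n
  have r: "0 \<le> r n" "r n < 1" "r n \<le> 1" for n by (auto simp: r_def)
  have r_lim: "r \<longlonglongrightarrow> 1"
    unfolding r_def using tendsto_diff[OF tendsto_const LIMSEQ_inverse_real_of_nat, of 1] by (simp add: inverse_eq_divide)
  have "(\<lambda>n. integral {0..2*pi} (\<lambda>\<theta>. G (circ (r n) \<theta>))) \<longlonglongrightarrow> integral {0..2*pi} (\<lambda>\<theta>. G (cis \<theta>))"
    by (intro tendsto_integral_uniform uniform_limit_circ[OF cG] continuous_on_closed_circ[OF cG] r r_lim) auto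
  moreover have "integral {0..2*pi} (\<lambda>\<theta>. G (circ (r n) \<theta>)) = 0" for n
    unfolding G_def by (rule integral_unique[OF flux_zero[OF r(1,2)]])
  ultimately have "(\<lambda>n::nat. 0) \<longlonglongrightarrow> integral {0..2*pi} (\<lambda>\<theta>. G (cis \<theta>))" by simp
  hence "integral {0..2*pi} (\<lambda>\<theta>. G (cis \<theta>)) = 0" using LIMSEQ_unique tendsto_const by blast
  hence "((\<lambda>\<theta>. G (cis \<theta>)) has_integral 0) {0..2*pi}"
    using integrable_integral[OF integrable_continuous_real[OF continuous_on_cis_comp[OF cG, of "{0..2*pi}"]]] by simp
  from has_integral_linear[OF this bounded_linear_vec_nth[of 3]]
  have "((\<lambda>\<theta>. G (cis \<theta>) $ 3) has_integral 0) {0..2*pi}" by (simp add: o_def)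
  moreover have "G (cis \<theta>) $ 3 = conormal \<theta> $ 3 + (1/2) * (X (cis \<theta>) $ 1 * tang \<theta> $ 2 - X (cis \<theta>) $ 2 * tang \<theta> $ 1)" for \<theta>
    by (simp add: G_def conormal_def tang_def cross3_def field_simps)
  ultimately show ?thesis by simp
qed

text \<open>At w = 0 the kernel of \<open>cauchy_boundary\<close> is 1 and its right side vanishes;
  this is the real part.\<close>

lemma hopf_boundary_mean: "((\<lambda>\<theta>. 2 * (g_theta \<theta> \<bullet> tang \<theta>) - tang \<theta> \<bullet> tang \<theta>) has_integral 0) {0..2*pi}"
proof -
  have "integral {0..2*pi} hopf_boundary = 0"
    using cauchy_boundary[of 0] by simp
  moreover have "continuous_on {0..2*pi} hopf_boundary"
  proof -
    have c: "continuous_on S (\<lambda>\<theta>. f (cis \<theta>))" if "continuous_on (cball 0 1) f" for f :: "complex \<Rightarrow> 'z::topological_space" and S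
      by (rule continuous_on_compose2[OF that]) (auto intro!: continuous_intros)
    have "continuous_on S (\<lambda>\<theta>. \<chi> i. g_theta \<theta> $ i)" for S
    proof (rule continuous_on_vec_lambda)
      fix i show "continuous_on S (\<lambda>\<theta>. g_theta \<theta> $ i)"
        using exhaust_3[of i] by (elim disjE; simp add: g_theta_def; intro continuous_intros)
    qed
    hence "continuous_on S g_theta" for S by simp
    thus ?thesis unfolding hopf_boundary_def by (intro continuous_intros c continuous_closed cX_closed)
  qed
  ultimately have "(hopf_boundary has_integral 0) {0..2*pi}"
    using integrable_integral[OF integrable_continuous_real] by metis
  from has_integral_linear[OF this bounded_linear_Re]
  show ?thesis by (simp add: o_def hopf_boundary_frame boundary_frame)
qed

text \<open>Once the boundary curve is a horizontal circle of radius |A|, orthogonality to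
  \<open>nu\<close> fixes its phase and the mean identity fixes A. The outcome is tang = 2 g_theta,
  to which \<open>conormal\<close> is orthogonal, so real and imaginary part both vanish.\<close>

lemma hopf_boundary_zero:
  assumes \<theta>: "\<theta> \<in> {0..2*pi}"
  shows "hopf_boundary \<theta> = 0"
proof -
  define y where "y i \<theta> = X (cis \<theta>) $ i" for i \<theta>
  have dy: "(y i has_real_derivative tang \<theta> $ i) (at \<theta>)" for i \<theta>
    using bounded_linear.has_vector_derivative[OF bounded_linear_vec_nth boundary_curve_deriv]
    unfolding y_def has_real_derivative_iff_has_vector_derivative .
  have per: "cis (x + 2 * pi) = cis x" for x by (simp add: complex_eq_iff)
  have pt: "tang (x + 2 * pi) = tang x" for x by (simp add: tang_def per)
  have ct: "continuous_on UNIV (\<lambda>\<theta>. tang \<theta> $ i)" for i by (intro continuous_intros continuous_boundary)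
  have eq: "integral {0..2*pi} (\<lambda>x. (tang x $ 1)\<^sup>2 + (tang x $ 2)\<^sup>2 + (tang x $ 3)\<^sup>2)
      = integral {0..2*pi} (\<lambda>x. y 1 x * tang x $ 2 - y 2 x * tang x $ 1)"
  proof -
    \<comment> \<open>Twice the flux identity plus the mean identity: the conormal terms
      cancel.\<close>
    have "((\<lambda>x. 2 * (conormal x $ 3 + (1/2) * (X (cis x) $ 1 * tang x $ 2 - X (cis x) $ 2 * tang x $ 1))
        + (2 * (g_theta x \<bullet> tang x) - tang x \<bullet> tang x)) has_integral 2 * 0 + 0) {0..2*pi}"
      by (intro has_integral_add has_integral_mult_right boundary_flux hopf_boundary_mean)
    moreover have "2 * (conormal x $ 3 + (1/2) * (X (cis x) $ 1 * tang x $ 2 - X (cis x) $ 2 * tang x $ 1))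
        + (2 * (g_theta x \<bullet> tang x) - tang x \<bullet> tang x)
      = (y 1 x * tang x $ 2 - y 2 x * tang x $ 1) - ((tang x $ 1)\<^sup>2 + (tang x $ 2)\<^sup>2 + (tang x $ 3)\<^sup>2)" for x
      unfolding boundary_frame(4) by (simp add: y_def inner_vec_def sum_3 power2_eq_square)
    ultimately have "((\<lambda>x. (y 1 x * tang x $ 2 - y 2 x * tang x $ 1) - ((tang x $ 1)\<^sup>2 + (tang x $ 2)\<^sup>2 + (tang x $ 3)\<^sup>2)) has_integral 0) {0..2*pi}"
      by simp
    moreover have "integral {0..2*pi} (\<lambda>x. (y 1 x * tang x $ 2 - y 2 x * tang x $ 1) - ((tang x $ 1)\<^sup>2 + (tang x $ 2)\<^sup>2 + (tang x $ 3)\<^sup>2))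
      = integral {0..2*pi} (\<lambda>x. y 1 x * tang x $ 2 - y 2 x * tang x $ 1) - integral {0..2*pi} (\<lambda>x. (tang x $ 1)\<^sup>2 + (tang x $ 2)\<^sup>2 + (tang x $ 3)\<^sup>2)"
      unfolding y_def by (intro integral_diff integrable_continuous_real continuous_intros continuous_boundary)
    ultimately show ?thesis by (simp add: integral_unique)
  qed
  obtain A \<alpha> where A: "\<And>x. x \<in> {0..2*pi} \<Longrightarrow> tang x $ 1 = A * cos (x - \<alpha>) \<and> tang x $ 2 = A * sin (x - \<alpha>) \<and> tang x $ 3 = 0"
    using isoperimetric_equality[OF dy dy ct ct ct _ _ _ _ _ eq] by (auto simp: pt) (auto simp: y_def per)
  have tt: "tang x \<bullet> tang x = A * A" if "x \<in> {0..2*pi}" for x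
  proof -
    define c s where "c = cos (x - \<alpha>)" and "s = sin (x - \<alpha>)"
    have "tang x \<bullet> tang x = A * A * (s * s + c * c)"
      using A[OF that, folded c_def s_def] by (simp add: inner_vec_def sum_3 algebra_simps)
    also have "s * s + c * c = 1"
      using sin_cos_squared_add[of "x - \<alpha>"] by (simp add: c_def s_def power2_eq_square)
    finally show ?thesis by simp
  qed
  have A0: "A \<noteq> 0" using tt[OF \<theta>] boundary_frame(1)[of \<theta>] frame_closed(9)[of "cis \<theta>"] by auto
  \<comment> \<open>As \<open>tang\<close> has no vertical component, this is nu \<bullet> tang =
    0.\<close>
  have "R * A * cos (\<alpha> + \<phi>) = 0"
  proof -
    have "R * A * (cos (\<theta> + \<phi>) * cos (\<theta> - \<alpha>) + sin (\<theta> + \<phi>) * sin (\<theta> - \<alpha>)) = 0"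
      using boundary_frame(3)[of \<theta>] A[OF \<theta>] by (simp add: nu_boundary inner_vec_def sum_3 algebra_simps)
    thus ?thesis unfolding cos_diff[symmetric] by (simp add: algebra_simps)
  qed
  hence cos0: "cos (\<alpha> + \<phi>) = 0" using A0 R by simp
  have gt: "g_theta x \<bullet> tang x = - R * A * sin (\<alpha> + \<phi>)" if "x \<in> {0..2*pi}" for x
  proof -
    have "g_theta x \<bullet> tang x = - R * A * (sin (x + \<phi>) * cos (x - \<alpha>) - cos (x + \<phi>) * sin (x - \<alpha>))"
      using A[OF that] by (simp add: g_theta_def inner_vec_def sum_3 algebra_simps)
    thus ?thesis unfolding sin_diff[symmetric] by (simp add: algebra_simps)
  qed
  \<comment> \<open>Both products are constant along the circle, so the vanishing mean becomes an
    equation for A.\<close>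
  have "((\<lambda>x. - 2 * R * A * sin (\<alpha> + \<phi>) - A * A) has_integral 0) {0..2*pi}"
    by (rule has_integral_eq[OF _ hopf_boundary_mean]) (simp add: gt tt)
  moreover have "((\<lambda>x. - 2 * R * A * sin (\<alpha> + \<phi>) - A * A) has_integral ((2 * pi) *\<^sub>R (- 2 * R * A * sin (\<alpha> + \<phi>) - A * A))) {0..2*pi}"
    using has_integral_const_real[of "- 2 * R * A * sin (\<alpha> + \<phi>) - A * A" 0 "2*pi"] by simp
  ultimately have "(2 * pi) *\<^sub>R (- 2 * R * A * sin (\<alpha> + \<phi>) - A * A) = 0"
    using has_integral_unique by blast
  hence "- 2 * R * A * sin (\<alpha> + \<phi>) - A * A = 0"
    by (metis mult_eq_0_iff pi_neq_zero real_scaleR_def zero_neq_numeral)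
  hence "A * (- 2 * R * sin (\<alpha> + \<phi>) - A) = 0" by (simp add: algebra_simps)
  hence Aeq: "A = - 2 * R * sin (\<alpha> + \<phi>)" using A0 by simp
  have "(sin (\<alpha> + \<phi>))\<^sup>2 = 1" using sin_cos_squared_add[of "\<alpha> + \<phi>"] cos0 by simp
  hence AA: "A * A = 4 * (R * R)" unfolding Aeq by (simp add: power2_eq_square algebra_simps)
  have gt2: "2 * (g_theta \<theta> \<bullet> tang \<theta>) = A * A" unfolding gt[OF \<theta>] by (subst (2) Aeq) simp
  have gg: "g_theta \<theta> \<bullet> g_theta \<theta> = R * R"
  proof -
    have "vector [- R * s, R * c, 0] \<bullet> (vector [- R * s, R * c, 0] :: real^3) = R * R * (s\<^sup>2 + c\<^sup>2)" for c s
      by (simp add: inner_vec_def sum_3 power2_eq_square algebra_simps)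
    thus ?thesis unfolding g_theta_def by simp
  qed
  \<comment> \<open>The square expands to A^2 - 2 A^2 + 4 R^2 = 0: equality in
    Cauchy-Schwarz.\<close>
  have "(tang \<theta> - 2 *\<^sub>R g_theta \<theta>) \<bullet> (tang \<theta> - 2 *\<^sub>R g_theta \<theta>) = 0"
    using gt2 gg AA tt[OF \<theta>] by (simp add: inner_diff_left inner_diff_right inner_commute[of "tang \<theta>" "g_theta \<theta>"])
  hence "tang \<theta> = 2 *\<^sub>R g_theta \<theta>" by simp
  hence "g_theta \<theta> \<bullet> conormal \<theta> = 0" using boundary_frame(2)[of \<theta>] by simp
  thus ?thesis using gt2 tt[OF \<theta>] boundary_frame(1)[of \<theta>] by (simp add: hopf_boundary_frame complex_eq_iff)
qed

text \<open>Cauchy's formula yields w^2 q w = 0, which leaves the origin to continuity.\<close>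

lemma hopf_zero:
  assumes z: "z \<in> ball 0 1" shows "q z = 0"
proof -
  have nz: "q w = 0" if w: "w \<in> ball 0 1" "w \<noteq> 0" for w
  proof -
    have "integral {0..2*pi} (\<lambda>\<theta>. hopf_boundary \<theta> * (cis \<theta> / (cis \<theta> - w))) = 0"
      by (intro integral_unique has_integral_is_0) (simp add: hopf_boundary_zero)
    thus ?thesis using cauchy_boundary[of w] w by simp
  qed
  have "isCont q 0"
    using holomorphic_on_imp_continuous_on[OF hopf_holomorphic] unfolding continuous_on_eq_continuous_at[OF open_ball] by simp
  hence "q \<midarrow>0\<rightarrow> q 0" by (simp add: isCont_def)
  moreover have "q \<midarrow>0\<rightarrow> 0"
    by (rule Lim_transform_within_open[OF tendsto_const open_ball[of 0 1]]) (use nz in auto)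
  ultimately have "q 0 = 0" using LIM_unique by blast
  thus ?thesis using nz[OF z] by blast
qed

subsection \<open>The spherical cap\<close>

lemma immersion_from_gauss_map: "\<exists>a. \<forall>z\<in>cball 0 1. X z = a + 2 *\<^sub>R nu z"
proof -
  have "\<exists>c. \<forall>z\<in>ball 0 1. X z - 2 *\<^sub>R nu z = c"
  proof (rule has_derivative_zero_constant)
    fix z :: complex assume z: "z \<in> ball 0 1"
    have "has_partials (\<lambda>z. X z - 2 *\<^sub>R nu z) (X1 z - 2 *\<^sub>R N1 z) (X2 z - 2 *\<^sub>R N2 z) z"
      by (intro has_partials_diff has_partials_linear[OF bounded_linear_scaleR_right] dX dnu z)
    hence "has_partials (\<lambda>z. X z - 2 *\<^sub>R nu z) 0 0 z"
      using hopf_zero_imp[OF z hopf_zero[OF z]] by simp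
    thus "((\<lambda>z. X z - 2 *\<^sub>R nu z) has_derivative (\<lambda>h. 0)) (at z within ball 0 1)"
      unfolding has_partials_def by (simp add: has_derivative_at_withinI)
  qed simp
  then obtain c where c: "\<And>z. z \<in> ball 0 1 \<Longrightarrow> X z - 2 *\<^sub>R nu z = c" by blast
  have "X z - 2 *\<^sub>R nu z = c" if "z \<in> cball 0 1" for z
    by (rule continuous_constant_on_closure[of "ball 0 1" "\<lambda>z. X z - 2 *\<^sub>R nu z"])
      (use c that in \<open>auto intro!: continuous_intros continuous_closed\<close>)
  hence "\<forall>z\<in>cball 0 1. X z = c + 2 *\<^sub>R nu z" by (metis diff_add_cancel)
  thus ?thesis by blast
qed

text \<open>Only the outer boundary values of \<open>\<psi> - c z\<close> are known, so the maximum principle is applied to its product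
  with \<open>z\<^sup>N\<close>, and \<open>N\<close> is sent to infinity.\<close>

lemma psi_linear_near_boundary:
  "\<exists>r1. 0 \<le> r1 \<and> r1 < 1 \<and> annulus r1 \<subseteq> chart \<and> (\<forall>z\<in>annulus r1. psi z = slope * z)"
proof -
  obtain r0 where r0: "1/2 \<le> r0" "r0 < 1" "annulus r0 \<subseteq> chart" "closed_annulus r0 \<subseteq> {z. height z > 0}"
    using energy_bounded by blast
  define r1 where "r1 = (r0 + 1) / 2"
  have r1: "r0 < r1" "r1 < 1" "0 < r1" using r0 by (auto simp: r1_def)
  have sub: "annulus r1 \<subseteq> chart" using r0(3) r1 by (auto simp: annulus_def)
  define \<eta> where "\<eta> z = psi z - slope * z" for z
  have c0: "continuous_on (closed_annulus r0) \<eta>"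
    unfolding \<eta>_def psi_def stereo_def
    by (intro continuous_intros bounded_linear.continuous_on[OF bounded_linear_horizontal] continuous_closed_annulus)
      (use r0(4) in \<open>force simp: height_def\<close>)
  have c1: "continuous_on (closed_annulus r1) \<eta>"
    by (rule continuous_on_subset[OF c0]) (use r1 in \<open>auto simp: closed_annulus_def\<close>)
  have "bounded (\<eta> ` closed_annulus r1)"
    by (intro compact_imp_bounded compact_continuous_image[OF c1] compact_closed_annulus)
  then obtain K where K: "\<forall>x\<in>\<eta> ` closed_annulus r1. norm x \<le> K" unfolding bounded_iff ..
  have hol: "\<eta> holomorphic_on annulus r1"
    unfolding holomorphic_on_open[OF open_annulus] \<eta>_def
  proof (intro ballI)
    fix z assume "z \<in> annulus r1"
    hence z: "z \<in> chart" using sub by blast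
    have "((\<lambda>z. psi z - slope * z) has_field_derivative (P1 z - slope * 1)) (at z)"
      by (intro DERIV_diff DERIV_cmult DERIV_ident hopf_zero_imp_holomorphic[OF z hopf_zero[OF chartD(1)[OF z]]])
    thus "\<exists>f'. ((\<lambda>z. psi z - slope * z) has_field_derivative f') (at z)" by blast
  qed
  have closure: "closure (annulus r1) \<subseteq> closed_annulus r1"
    by (rule closure_minimal) (auto simp: annulus_def closed_annulus_def compact_imp_closed[OF compact_closed_annulus, unfolded closed_annulus_def])
  have zero: "\<eta> z = 0" if z: "z \<in> annulus r1" for z
  proof -
    have bnd: "norm (\<eta> z) \<le> (r1 / norm z) ^ N * K" for N
    proof -
      have z0: "norm z > 0" using z r1 by (auto simp: annulus_def)
      \<comment> \<open>On the frontier the product is at most r1^N K at the inner circle and 0 at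
        the outer one; division by |z|^N then gives a ratio below 1.\<close>
      have "norm (z ^ N * \<eta> z) \<le> r1 ^ N * K"
      proof (rule maximum_modulus_frontier[of "\<lambda>z. z ^ N * \<eta> z" "annulus r1"])
        show "(\<lambda>z. z ^ N * \<eta> z) holomorphic_on interior (annulus r1)"
          unfolding interior_open[OF open_annulus] by (intro holomorphic_intros hol)
        show "continuous_on (closure (annulus r1)) (\<lambda>z. z ^ N * \<eta> z)"
          by (intro continuous_intros continuous_on_subset[OF c1 closure])
        show "bounded (annulus r1)" by (rule bounded_subset[of "ball 0 1"]) (auto simp: annulus_def)
        fix u assume u: "u \<in> frontier (annulus r1)"
        hence u1: "u \<in> closed_annulus r1" "u \<notin> annulus r1"
          using closure by (auto simp: frontier_def interior_open[OF open_annulus])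
        hence "norm u = r1 \<or> norm u = 1" by (auto simp: closed_annulus_def annulus_def)
        thus "norm (u ^ N * \<eta> u) \<le> r1 ^ N * K"
        proof
          assume "norm u = r1"
          thus ?thesis using bspec[OF K imageI[OF u1(1)]] r1 by (simp add: norm_mult norm_power)
        next
          assume "norm u = 1"
          hence "u = cis (Arg u)" using rcis_cmod_Arg[of u] by (simp add: rcis_def)
          hence "\<eta> u = 0" using psi_boundary[of "Arg u"] by (simp add: \<eta>_def)
          moreover have "0 \<le> K" using bspec[OF K imageI[OF u1(1)]] norm_ge_zero order_trans by blast
          ultimately show ?thesis using r1 by simp
        qed
      qed (rule z)
      thus ?thesis using z0 by (simp add: norm_mult norm_power power_divide field_simps)
    qed
    have q1: "0 \<le> r1 / norm z" "r1 / norm z < 1" using z r1 by (auto simp: annulus_def divide_less_eq)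
    have "(\<lambda>N. (r1 / norm z) ^ N * K) \<longlonglongrightarrow> 0 * K"
      by (intro tendsto_mult tendsto_const LIMSEQ_realpow_zero q1)
    hence "norm (\<eta> z) \<le> 0 * K" by (rule LIMSEQ_le_const) (use bnd in auto)
    thus ?thesis by simp
  qed
  show ?thesis using r1 sub zero by (intro exI[of _ r1]) (auto simp: \<eta>_def)
qed

text \<open>Analytic continuation of \<open>psi\<close> could stop where \<open>nu\<close> meets the
  south pole. The set \<open>S\<close> of points near which the formula holds is open by
  construction; it is closed because at a limit point \<open>nu\<close> is already a value of
  \<open>istereo\<close>, hence not the pole, and the identity theorem applies around it.\<close>

lemma gauss_map_is_cap:
  assumes "z \<in> cball 0 1" shows "nu z = istereo (slope * z)"
proof -
  define D where "D w = nu w - istereo (slope * w)" for w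
  have cD: "continuous_on (cball 0 1) D"
    unfolding D_def by (intro continuous_intros continuous_closed continuous_on_compose2[OF continuous_istereo[of UNIV]]) auto
  have nu_psi: "D w = 0" if "w \<in> chart" "psi w = slope * w" for w
    using istereo_stereo[OF frame_facts(2)[OF chartD(1)[OF that(1)]] chartD(2)[OF that(1)]] that(2)
    by (simp add: D_def psi_def)
  have psi_nu: "psi w = slope * w" if "D w = 0" for w
    using stereo_istereo[of "slope * w"] that by (simp add: D_def psi_def)
  define S where "S = {p \<in> ball 0 1. \<exists>r>0. ball p r \<subseteq> ball 0 1 \<and> (\<forall>w\<in>ball p r. D w = 0)}"
  obtain r1 where r1: "0 \<le> r1" "r1 < 1" "annulus r1 \<subseteq> chart" "\<And>z. z \<in> annulus r1 \<Longrightarrow> psi z = slope * z"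
    using psi_linear_near_boundary by blast
  have "S = {} \<or> S = ball 0 1"
  proof (rule connected_clopen[THEN iffD1, rule_format, OF connected_ball], rule conjI)
    have "open S"
      unfolding open_contains_ball
    proof
      fix p assume "p \<in> S"
      then obtain r where r: "r > 0" "ball p r \<subseteq> ball 0 1" "\<And>w. w \<in> ball p r \<Longrightarrow> D w = 0" unfolding S_def by blast
      have "ball p r \<subseteq> S"
      proof
        fix u assume u: "u \<in> ball p r"
        then obtain s where s: "s > 0" "ball u s \<subseteq> ball p r" using openE[OF open_ball] by metis
        show "u \<in> S" unfolding S_def using r s u by blast
      qed
      thus "\<exists>r>0. ball p r \<subseteq> S" using r(1) by blast
    qed
    thus "openin (top_of_set (ball 0 1)) S" by (intro open_subset) (auto simp: S_def)
    show "closedin (top_of_set (ball 0 1)) S"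
      unfolding closedin_limpt
    proof (intro conjI allI impI)
      show "S \<subseteq> ball 0 1" by (auto simp: S_def)
      fix p assume p: "p islimpt S \<and> p \<in> ball 0 1"
      have "D p = 0"
      proof (rule continuous_constant_on_closure[of S D])
        have "closure S \<subseteq> closure (ball 0 1)" by (rule closure_mono) (auto simp: S_def)
        thus "continuous_on (closure S) D" using continuous_on_subset[OF cD] by simp
        show "D x = 0" if "x \<in> S" for x using that by (auto simp: S_def)
        show "p \<in> closure S" using p by (simp add: closure_def)
      qed
      \<comment> \<open>\<open>istereo\<close> never takes the south pole as a value, so the
        projection is usable around p.\<close>
      hence "height p \<noteq> 0" using istereo_third(2)[of "slope * p"] by (simp add: height_def D_def)
      hence "p \<in> chart" using p by (simp add: chart_def)
      then obtain r where r: "r > 0" "ball p r \<subseteq> chart" using open_chart open_contains_ball by blast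
      obtain s where s: "s \<in> S" "s \<in> ball p r" using p r(1) unfolding islimpt_def by (metis centre_in_ball open_ball)
      then obtain r' where r': "r' > 0" "\<And>w. w \<in> ball s r' \<Longrightarrow> D w = 0" by (auto simp: S_def)
      have eq: "psi w = slope * w" if "w \<in> ball p r" for w
      proof (rule analytic_continuation_open[of "ball s r' \<inter> ball p r" "ball p r" psi "\<lambda>w. slope * w"])
        have "s \<in> ball s r' \<inter> ball p r" using s(2) r'(1) by simp
        thus "ball s r' \<inter> ball p r \<noteq> {}" by blast
        show "psi holomorphic_on ball p r"
          unfolding holomorphic_on_open[OF open_ball]
          using hopf_zero_imp_holomorphic[OF _ hopf_zero[OF chartD(1)]] r(2) by blast
        show "(\<lambda>w. slope * w) holomorphic_on ball p r" by (intro holomorphic_intros)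
      qed (use that psi_nu r' in auto)
      have "ball p r \<subseteq> ball 0 1" using r(2) by (auto simp: chart_def)
      thus "p \<in> S" unfolding S_def using p r eq nu_psi by blast
    qed
  qed
  moreover have "S \<noteq> {}"
  proof -
    define p where "p = complex_of_real ((r1 + 1) / 2)"
    have p: "p \<in> annulus r1" using r1 by (auto simp: p_def annulus_def simp del: of_real_divide of_real_add)
    obtain r where r: "r > 0" "ball p r \<subseteq> annulus r1" using open_annulus p open_contains_ball by blast
    moreover have "annulus r1 \<subseteq> ball 0 1" by (auto simp: annulus_def)
    ultimately have "p \<in> S" unfolding S_def using p r1 nu_psi by blast
    thus ?thesis by blast
  qed
  ultimately have Sb: "S = ball 0 1" by blast
  have D0: "D w = 0" if "w \<in> ball 0 1" for w
  proof -
    have "w \<in> S" using that Sb by simp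
    then obtain r where "r > 0" "\<forall>u\<in>ball w r. D u = 0" unfolding S_def by blast
    thus ?thesis by simp
  qed
  have "D z = 0"
    by (rule continuous_constant_on_closure[of "ball 0 1" D]) (use assms cD D0 in auto)
  thus ?thesis by (simp add: D_def)
qed

end

subsection \<open>Translation to real coordinates\<close>

definition to_plane :: "complex \<Rightarrow> real^2" where "to_plane z = vector [Re z, Im z]"

lemma norm_to_plane: "norm (to_plane z) = norm z"
  by (simp add: to_plane_def norm_vec_def L2_set_def sum_2 cmod_def)

lemma to_plane_basis: "to_plane z = Re z *\<^sub>R axis 1 1 + Im z *\<^sub>R axis 2 1"
  by (simp add: to_plane_def vec_eq_iff forall_2 axis_def)

lemma bounded_linear_to_plane: "bounded_linear to_plane"
  unfolding to_plane_basis
  by (intro bounded_linear_intros bounded_linear_Re bounded_linear_Im)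

lemma to_plane_ball: "to_plane z \<in> ball 0 1 \<longleftrightarrow> z \<in> ball 0 1" "to_plane z \<in> cball 0 1 \<longleftrightarrow> z \<in> cball 0 1"
  by (simp_all add: norm_to_plane)

lemma to_plane_circ: "to_plane (circ r \<theta>) = polar (r, \<theta>)"
  by (simp add: to_plane_def polar_def)

lemma pd_has_derivative:
  assumes f: "f differentiable_on S" and z: "to_plane z \<in> S"
  shows "((\<lambda>w. f (to_plane w)) has_derivative (\<lambda>h. Re h *\<^sub>R pd S 1 f (to_plane z) + Im h *\<^sub>R pd S 2 f (to_plane z)))
     (at z within to_plane -` S)"
proof -
  define F where "F = frechet_derivative f (at (to_plane z) within S)"
  have F: "(f has_derivative F) (at (to_plane z) within S)"
    using f z unfolding F_def differentiable_on_def frechet_derivative_works by blast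
  interpret F: bounded_linear F using F by (rule has_derivative_bounded_linear)
  have "((\<lambda>w. f (to_plane w)) has_derivative (\<lambda>h. F (to_plane h))) (at z within to_plane -` S)"
    by (rule has_derivative_in_compose[OF bounded_linear_imp_has_derivative[OF bounded_linear_to_plane]
          has_derivative_subset[OF F]]) auto
  moreover have "F (to_plane h) = Re h *\<^sub>R pd S 1 f (to_plane z) + Im h *\<^sub>R pd S 2 f (to_plane z)" for h
    unfolding to_plane_basis[of h] F.add F.scaleR by (simp add: pd_def F_def)
  ultimately show ?thesis by simp
qed

lemma has_partials_pd:
  assumes "f differentiable_on ball 0 1" and z: "z \<in> ball 0 1"
  shows "has_partials (\<lambda>w. f (to_plane w)) (pd (ball 0 1) 1 f (to_plane z)) (pd (ball 0 1) 2 f (to_plane z)) z"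
proof -
  have v: "to_plane -` ball 0 1 = ball 0 1" using to_plane_ball(1) by blast
  have "to_plane z \<in> ball 0 1" using z to_plane_ball(1) by blast
  from pd_has_derivative[OF assms(1) this] show ?thesis
    unfolding has_partials_def v at_within_open[OF z open_ball] .
qed

text \<open>The C^1 data live on the closed disk and the C^2 data on the open one; inside, both are
  the ordinary derivative.\<close>

lemma pd_cball:
  assumes "p \<in> ball 0 1" shows "pd (cball 0 1) i f p = pd (ball 0 1) i f p"
proof -
  have "at p within cball 0 1 = at p" by (rule at_within_interior) (use assms in simp)
  moreover have "at p within ball 0 1 = at p" by (rule at_within_open[OF assms open_ball])
  ultimately show ?thesis by (simp add: pd_def)
qed

lemma continuous_on_to_plane:
  assumes "continuous_on S f" "\<And>z. z \<in> T \<Longrightarrow> to_plane z \<in> S"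
  shows "continuous_on T (\<lambda>z. f (to_plane z))"
  by (rule continuous_on_compose2[OF assms(1) linear_continuous_on[OF bounded_linear_to_plane]])
    (use assms(2) in blast)

text \<open>First derivatives are taken within the closed disk, so that the same functions serve
  inside and on the circle; second derivatives are taken within the open disk.\<close>

lemma cmc_cap_of_immersion:
  fixes R \<sigma> \<phi> :: real and Y :: "real^2 \<Rightarrow> real^3"
  assumes R: "0 < R" "R < 1" and \<sigma>: "\<sigma> \<in> {1, -1}"
    and C2: "C2_on (ball 0 1) Y" and C1: "C1_on (cball 0 1) Y"
    and conformal: "conformal_immersion_on (ball 0 1) Y"
    and pde: "\<forall>p\<in>ball 0 1. - laplacian (ball 0 1) Y p = cross3 (pd (ball 0 1) 1 Y p) (pd (ball 0 1) 2 Y p)"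
    and bd: "\<forall>\<theta>. normal_field (cball 0 1) Y (polar (1, \<theta>)) \<noteq> 0 \<and>
             unit_normal (cball 0 1) Y (polar (1, \<theta>)) = g R \<sigma> (\<theta> + \<phi>)"
  shows "cmc_cap (\<lambda>z. Y (to_plane z)) (\<lambda>z. pd (cball 0 1) 1 Y (to_plane z)) (\<lambda>z. pd (cball 0 1) 2 Y (to_plane z))
    (\<lambda>z. pd (ball 0 1) 1 (pd (ball 0 1) 1 Y) (to_plane z)) (\<lambda>z. pd (ball 0 1) 2 (pd (ball 0 1) 1 Y) (to_plane z))
    (\<lambda>z. pd (ball 0 1) 2 (pd (ball 0 1) 2 Y) (to_plane z)) R (\<sigma> * sqrt (1 - R\<^sup>2)) \<phi>"
proof -
  let ?B = "ball (0::real^2) 1"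
  have dY: "Y differentiable_on ?B" and dpd: "pd ?B i Y differentiable_on ?B"
    and cpd: "continuous_on ?B (pd ?B j (pd ?B i Y))" for i j
    using C2 by (auto simp: C2_on_def C1_on_def)
  have dYc: "Y differentiable_on cball 0 1" and cYc: "continuous_on (cball 0 1) (pd (cball 0 1) i Y)" for i
    using C1 by (auto simp: C1_on_def)
  have inb: "to_plane z \<in> ?B" if "z \<in> ball 0 1" for z using that to_plane_ball(1) by blast
  have p1: "has_partials (\<lambda>z. Y (to_plane z)) (pd (cball 0 1) 1 Y (to_plane z)) (pd (cball 0 1) 2 Y (to_plane z)) z"
    if "z \<in> ball 0 1" for z
    using has_partials_pd[OF dY that] pd_cball[OF inb[OF that]] by simp
  have p2: "has_partials (\<lambda>z. pd (cball 0 1) i Y (to_plane z)) (pd ?B 1 (pd ?B i Y) (to_plane z)) (pd ?B 2 (pd ?B i Y) (to_plane z)) z"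
    if "z \<in> ball 0 1" for i z
    by (rule has_partials_cong[OF has_partials_pd[OF dpd that] open_ball that])
      (use pd_cball[OF inb] in simp)
  \<comment> \<open>The locale has one \<open>X12\<close> for both orders of
    differentiation.\<close>
  have sym: "pd ?B 1 (pd ?B 2 Y) (to_plane z) = pd ?B 2 (pd ?B 1 Y) (to_plane z)" if z: "z \<in> ball 0 1" for z
  proof -
    obtain r where r: "r > 0" "ball z r \<subseteq> ball 0 1" using openE[OF open_ball z] by metis
    from mixed_partials_eq[OF r(1) p1 p2[OF z] p2[OF z]] r(2) show ?thesis by (metis subsetD)
  qed
  have polar: "polar (1, \<theta>) = to_plane (cis \<theta>)" for \<theta> using to_plane_circ[of 1 \<theta>] by simp
  show ?thesis
  proof unfold_locales
    fix z :: complex assume z: "z \<in> ball 0 1"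
    show "has_partials (\<lambda>z. Y (to_plane z)) (pd (cball 0 1) 1 Y (to_plane z)) (pd (cball 0 1) 2 Y (to_plane z)) z"
      by (rule p1[OF z])
    show "has_partials (\<lambda>z. pd (cball 0 1) 1 Y (to_plane z)) (pd ?B 1 (pd ?B 1 Y) (to_plane z)) (pd ?B 2 (pd ?B 1 Y) (to_plane z)) z"
      by (rule p2[OF z])
    show "has_partials (\<lambda>z. pd (cball 0 1) 2 Y (to_plane z)) (pd ?B 2 (pd ?B 1 Y) (to_plane z)) (pd ?B 2 (pd ?B 2 Y) (to_plane z)) z"
      using p2[OF z, of 2] sym[OF z] by simp
    have cf: "norm (pd ?B 1 Y (to_plane z)) = norm (pd ?B 2 Y (to_plane z))" "norm (pd ?B 2 Y (to_plane z)) \<noteq> 0"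
      "pd ?B 1 Y (to_plane z) \<bullet> pd ?B 2 Y (to_plane z) = 0"
      using conformal inb[OF z] by (auto simp: conformal_immersion_on_def simp del: mem_ball)
    show "pd (cball 0 1) 2 Y (to_plane z) \<bullet> pd (cball 0 1) 2 Y (to_plane z) = pd (cball 0 1) 1 Y (to_plane z) \<bullet> pd (cball 0 1) 1 Y (to_plane z)"
      "pd (cball 0 1) 1 Y (to_plane z) \<bullet> pd (cball 0 1) 2 Y (to_plane z) = 0" "pd (cball 0 1) 1 Y (to_plane z) \<noteq> 0"
      unfolding pd_cball[OF inb[OF z]] using cf by (auto simp flip: power2_norm_eq_inner)
    show "pd ?B 1 (pd ?B 1 Y) (to_plane z) + pd ?B 2 (pd ?B 2 Y) (to_plane z)
        = - cross3 (pd (cball 0 1) 1 Y (to_plane z)) (pd (cball 0 1) 2 Y (to_plane z))"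
      unfolding pd_cball[OF inb[OF z]] using pde inb[OF z] by (metis laplacian_def minus_equation_iff)
  next
    show "continuous_on (ball 0 1) (\<lambda>z. pd ?B 1 (pd ?B 1 Y) (to_plane z))" "continuous_on (ball 0 1) (\<lambda>z. pd ?B 2 (pd ?B 1 Y) (to_plane z))"
      "continuous_on (ball 0 1) (\<lambda>z. pd ?B 2 (pd ?B 2 Y) (to_plane z))"
      by (rule continuous_on_to_plane[OF cpd inb], assumption)+
    show "continuous_on (cball 0 1) (\<lambda>z. pd (cball 0 1) 1 Y (to_plane z))" "continuous_on (cball 0 1) (\<lambda>z. pd (cball 0 1) 2 Y (to_plane z))"
      by (rule continuous_on_to_plane[OF cYc], use to_plane_ball(2) in blast)+
    show "0 < R" by (rule R)
    have "R\<^sup>2 \<le> 1" using R by (simp add: power_le_one)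
    thus "R\<^sup>2 + (\<sigma> * sqrt (1 - R\<^sup>2))\<^sup>2 = 1" using \<sigma> by (auto simp: power_mult_distrib)
  next
    fix z :: complex assume z: "z \<in> cball 0 1"
    have v: "to_plane -` cball 0 1 = cball 0 1" using to_plane_ball(2) by blast
    have "to_plane z \<in> cball 0 1" using z to_plane_ball(2) by blast
    from pd_has_derivative[OF dYc this]
    show "((\<lambda>z. Y (to_plane z)) has_derivative (\<lambda>v. Re v *\<^sub>R pd (cball 0 1) 1 Y (to_plane z) + Im v *\<^sub>R pd (cball 0 1) 2 Y (to_plane z))) (at z within cball 0 1)"
      unfolding v .
  next
    fix z :: complex assume "norm z = 1"
    hence "z = cis (Arg z)" using rcis_cmod_Arg[of z] by (simp add: rcis_def)
    thus "cross3 (pd (cball 0 1) 1 Y (to_plane z)) (pd (cball 0 1) 2 Y (to_plane z)) \<noteq> 0"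
      using bd[rule_format, of "Arg z"] unfolding normal_field_def polar by simp
  next
    fix \<theta>
    show "cross3 (pd (cball 0 1) 1 Y (to_plane (cis \<theta>))) (pd (cball 0 1) 2 Y (to_plane (cis \<theta>))) /\<^sub>R
        norm (cross3 (pd (cball 0 1) 1 Y (to_plane (cis \<theta>))) (pd (cball 0 1) 2 Y (to_plane (cis \<theta>))))
      = vector [R * cos (\<theta> + \<phi>), R * sin (\<theta> + \<phi>), \<sigma> * sqrt (1 - R\<^sup>2)]"
      using bd[rule_format, of \<theta>] unfolding unit_normal_def normal_field_def polar g_def by simp
  qed
qed

lemma istereo_plus:
  assumes "0 < R" "R < 1"
  shows "istereo (of_real (R / (1 + sqrt (1 - R\<^sup>2))) * cis \<phi> * circ r \<theta>) = u_plus R (r, \<theta> + \<phi>)"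
proof -
  have w: "of_real (R / (1 + sqrt (1 - R\<^sup>2))) * cis \<phi> * circ r \<theta> = circ (rho R * r) (\<theta> + \<phi>)"
    by (simp add: rho_def cis_mult[symmetric] mult_ac)
  have n: "(norm (circ (rho R * r) (\<theta> + \<phi>)))\<^sup>2 = (rho R)\<^sup>2 * r\<^sup>2"
    by (simp add: norm_mult power_mult_distrib)
  show ?thesis
    unfolding w istereo_def n by (simp add: u_plus_def Let_def mult_ac)
qed

text \<open>R / (1 - sqrt (1 - R^2)) is 1 / \<rho>, so z / \<rho> is projected back. In the
  horizontal coordinates the shift by pi undoes the outer sign, so that sign reverses only the
  vertical coordinate of \<open>u_minus\<close>.\<close>

lemma istereo_minus:
  assumes R: "0 < R" "R < 1"
  shows "istereo (of_real (R / (1 - sqrt (1 - R\<^sup>2))) * cis \<phi> * circ r \<theta>) = - u_minus R (r, \<theta> + \<phi> + pi)"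
proof -
  define s where "s = sqrt (1 - R\<^sup>2)"
  have R2: "R\<^sup>2 < 1" using R by (simp add: power_less_one_iff)
  have s: "0 < s" "s * s = 1 - R * R" using R2 by (simp_all add: s_def power2_eq_square)
  have s1: "s < 1" unfolding s_def using R by (simp add: real_sqrt_lt_1_iff)
  have rho: "rho R > 0" using R s by (simp add: rho_def s_def[symmetric])
  have "R / (1 - s) = 1 / rho R"
    using R s s1 by (simp add: rho_def s_def[symmetric] field_simps)
  hence w: "of_real (R / (1 - sqrt (1 - R\<^sup>2))) * cis \<phi> * circ r \<theta> = circ (r / rho R) (\<theta> + \<phi>)"
    unfolding s_def[symmetric] by (simp add: cis_mult[symmetric] mult_ac)
  have n: "(norm (circ (r / rho R) (\<theta> + \<phi>)))\<^sup>2 = r\<^sup>2 / (rho R)\<^sup>2"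
    by (simp add: norm_mult norm_divide power_divide)
  have d: "1 + r\<^sup>2 / (rho R)\<^sup>2 = ((rho R)\<^sup>2 + r\<^sup>2) / (rho R)\<^sup>2" "1 - r\<^sup>2 / (rho R)\<^sup>2 = ((rho R)\<^sup>2 - r\<^sup>2) / (rho R)\<^sup>2"
    using rho by (simp_all add: field_simps)
  have nz: "(rho R)\<^sup>2 + r\<^sup>2 \<noteq> 0" using rho by (simp add: add_pos_nonneg less_imp_neq[symmetric])
  show ?thesis
  proof -
    define p y where "p = rho R" and "y = (rho R)\<^sup>2 + r\<^sup>2"
    have p: "p \<noteq> 0" and y: "y \<noteq> 0" using rho nz by (auto simp: p_def y_def)
    have e: "2 * (r / p * c) / (y / p\<^sup>2) = 2 * p * r / y * c" "x / p\<^sup>2 / (y / p\<^sup>2) = x / y" for c x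
      using p y by (simp_all add: field_simps power2_eq_square)
    have "istereo (circ (r / rho R) (\<theta> + \<phi>)) = vector [2 * (r / p * cos (\<theta> + \<phi>)) / (y / p\<^sup>2),
        2 * (r / p * sin (\<theta> + \<phi>)) / (y / p\<^sup>2), (p\<^sup>2 - r\<^sup>2) / p\<^sup>2 / (y / p\<^sup>2)]"
      unfolding istereo_def n d p_def y_def by simp
    also have "\<dots> = vector [2 * p * r / y * cos (\<theta> + \<phi>), 2 * p * r / y * sin (\<theta> + \<phi>), (p\<^sup>2 - r\<^sup>2) / y]"
      unfolding e ..
    also have "\<dots> = - u_minus R (r, \<theta> + \<phi> + pi)"
    proof -
      have "(p\<^sup>2 - r\<^sup>2) / y = - ((r\<^sup>2 - p\<^sup>2) / y)" by (metis minus_diff_eq minus_divide_left)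
      moreover have "- u_minus R (r, \<theta> + \<phi> + pi) = vector [2 * p * r / y * cos (\<theta> + \<phi>), 2 * p * r / y * sin (\<theta> + \<phi>), - ((r\<^sup>2 - p\<^sup>2) / y)]"
        unfolding p_def y_def by (simp add: u_minus_def Let_def vec_eq_iff forall_3)
      ultimately show ?thesis by simp
    qed
    finally show ?thesis unfolding w .
  qed
qed

theorem corollary1p2:
  fixes R \<sigma> \<phi> :: real and Y :: "real^2 \<Rightarrow> real^3"
  assumes "0 < R" and "R < 1"
    and "\<sigma> \<in> {1, -1}"
    and "C2_on (ball 0 1) Y"
    and "C1_on (cball 0 1) Y"
    and "conformal_immersion_on (ball 0 1) Y"
    and "\<forall>p\<in>ball 0 1. - laplacian (ball 0 1) Y p = cross3 (pd (ball 0 1) 1 Y p) (pd (ball 0 1) 2 Y p)"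
    and "\<forall>\<theta>. normal_field (cball 0 1) Y (polar (1, \<theta>)) \<noteq> 0 \<and>
             unit_normal (cball 0 1) Y (polar (1, \<theta>)) = g R \<sigma> (\<theta> + \<phi>)"
  shows "\<exists>a::real^3. \<forall>r\<in>{0..1}. \<forall>\<theta>. Y (polar (r, \<theta>)) = a + (Z R \<sigma> \<circ> rotation \<phi>) (r, \<theta>)"
proof -
  interpret cmc_cap "\<lambda>z. Y (to_plane z)" "\<lambda>z. pd (cball 0 1) 1 Y (to_plane z)" "\<lambda>z. pd (cball 0 1) 2 Y (to_plane z)"
    "\<lambda>z. pd (ball 0 1) 1 (pd (ball 0 1) 1 Y) (to_plane z)" "\<lambda>z. pd (ball 0 1) 2 (pd (ball 0 1) 1 Y) (to_plane z)"
    "\<lambda>z. pd (ball 0 1) 2 (pd (ball 0 1) 2 Y) (to_plane z)" R "\<sigma> * sqrt (1 - R\<^sup>2)" \<phi>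
    by (rule cmc_cap_of_immersion[OF assms])
  obtain a where a: "\<And>z. z \<in> cball 0 1 \<Longrightarrow> Y (to_plane z) = a + 2 *\<^sub>R nu z"
    using immersion_from_gauss_map by blast
  have Y: "Y (polar (r, \<theta>)) = a + 2 *\<^sub>R istereo (slope * circ r \<theta>)" if "r \<in> {0..1}" for r \<theta>
  proof -
    have "circ r \<theta> \<in> cball 0 1" using that by (simp add: norm_mult)
    from a[OF this] gauss_map_is_cap[OF this] show ?thesis by (simp add: to_plane_circ)
  qed
  show ?thesis
  proof (cases "\<sigma> = 1")
    case True
    have "istereo (slope * circ r \<theta>) = u_plus R (r, \<theta> + \<phi>)" for r \<theta>
    proof -
      have "slope = of_real (R / (1 + sqrt (1 - R\<^sup>2))) * cis \<phi>" unfolding slope_def using True by simp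
      thus ?thesis using istereo_plus[OF assms(1,2), of \<phi> r \<theta>] by simp
    qed
    \<comment> \<open>\<open>Z_plus\<close> is twice \<open>u_plus\<close> up to a vertical
      translation, which the constant absorbs.\<close>
    with Y True show ?thesis
      by (intro exI[of _ "a + (2 * sqrt (1 - R\<^sup>2)) *\<^sub>R e3"]) (simp add: Z_def Z_plus_def rotation_def)
  next
    case False
    hence \<sigma>: "\<sigma> = -1" using assms(3) by simp
    have "istereo (slope * circ r \<theta>) = - u_minus R (r, \<theta> + \<phi> + pi)" for r \<theta>
    proof -
      have "slope = of_real (R / (1 - sqrt (1 - R\<^sup>2))) * cis \<phi>" unfolding slope_def using \<sigma> by simp
      thus ?thesis using istereo_minus[OF assms(1,2), of \<phi> r \<theta>] by simp
    qed
    with Y \<sigma> show ?thesis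
      by (intro exI[of _ "a - (2 * sqrt (1 - R\<^sup>2)) *\<^sub>R e3"]) (simp add: Z_def Z_minus_def rotation_def)
  qed
qed

end
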